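(* Let $p$ be an odd prime, and let $K_m$ be the Markov chain on the irreducible modules $V(0),\ldots,V(p-1)$ of $\mathrm{SL}_2(p)$ over an algebraic closure of $\mathbb F_p$, started at $V(0)$, which at each step, with probability $\frac12$ tensors with $V(p-1)$ and with probability $\frac12$ tensors with $V(1)$. Let $\pi$ be its stationary distribution. Then for all $p\ge 23$ and all $\ell\ge1$: (i) $\|K_m^\ell-\pi\|_\infty\ge e^{-(2\log 2)(\ell+1)+(4/3)\log p}$, and (ii) $\|K_m^\ell-\pi\|_\infty\le e^{-\ell/4+2\log p}$. In fact, as $p\to\infty$, the walks $K_m$ have cutoff (in the $\|\cdot\|_\infty$ distance) at time $\log_2 p^2$.
   Context: $V(a)=S^a(V(1))$ $(0\le a\le p-1)$ is the $a$th symmetric power of the natural $2$-dimensional module $V(1)$, of dimension $a+1$; these are all the irreducible modules of $\mathrm{SL}_2(p)$ in characteristic $p$. "Tensoring with $W$" from the state $V(a)$ means moving to $V(b)$ with probability $\dfrac{[V(a)\otimes W:V(b)]\,\dim V(b)}{\dim V(a)\dim W}$, where $[M:V(b)]$ is the multiplicity of $V(b)$ as a composition factor of $M$. Thus $K_m=\frac12K_{V(p-1)}+\frac12K_{V(1)}$. The stationary distribution is $\pi(V(0))=\frac1{p^2-1}$, $\pi(V(a))=\frac{2(a+1)}{p^2-1}$ for $1\le a\le p-2$, and $\pi(V(p-1))=\frac{p}{p^2-1}$. The distance is $\|K_m^\ell-\pi\|_\infty=\max_{0\le a\le p-1}\left|\frac{K_m^\ell(V(0),V(a))}{\pi(V(a))}-1\right|$.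 Cutoff at time $t_p=\log_2p^2$ means: for each fixed $\epsilon\in(0,1)$, as $p\to\infty$, the distance tends to $0$ when $\ell\approx(1+\epsilon)t_p$ and tends to $\infty$ when $\ell\approx(1-\epsilon)t_p$. Here $\log$ is the natural logarithm. *)

theory Defs
  imports
    Complex_Main
    "HOL-Algebra.Algebraic_Closure"
    "HOL-Algebra.UnivPoly"
    "HOL-Library.Landau_Symbols"
    "Jordan_Normal_Form.Matrix"
begin

section \<open>Modules for a group over a commutative ring\<close>

record ('k, 'v, 'g) gmod = "('k, 'v) module" +
  act :: "'g \<Rightarrow> 'v \<Rightarrow> 'v"

locale group_module = G: group G + module R M
  for G :: "('g, 'a) monoid_scheme" and R :: "('k, 'b) ring_scheme"
    and M :: "('k, 'v, 'g, 'c) gmod_scheme" +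
  assumes act_closed: "g \<in> carrier G \<Longrightarrow> v \<in> carrier M \<Longrightarrow> act M g v \<in> carrier M"
    and act_add: "g \<in> carrier G \<Longrightarrow> v \<in> carrier M \<Longrightarrow> w \<in> carrier M \<Longrightarrow>
      act M g (v \<oplus>\<^bsub>M\<^esub> w) = act M g v \<oplus>\<^bsub>M\<^esub> act M g w"
    and act_smult: "g \<in> carrier G \<Longrightarrow> c \<in> carrier R \<Longrightarrow> v \<in> carrier M \<Longrightarrow>
      act M g (c \<odot>\<^bsub>M\<^esub> v) = c \<odot>\<^bsub>M\<^esub> act M g v"
    and act_one: "v \<in> carrier M \<Longrightarrow> act M \<one>\<^bsub>G\<^esub> v = v"
    and act_mult: "g \<in> carrier G \<Longrightarrow> h \<in> carrier G \<Longrightarrow> v \<in> carrier M \<Longrightarrow>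
      act M (g \<otimes>\<^bsub>G\<^esub> h) v = act M g (act M h v)"

definition gsubmodule ::
    "('g, 'a) monoid_scheme \<Rightarrow> ('k, 'b) ring_scheme \<Rightarrow> ('k, 'v, 'g) gmod \<Rightarrow> 'v set \<Rightarrow> bool" where
  "gsubmodule G R M N \<longleftrightarrow>
     submodule N R M \<and> (\<forall>g\<in>carrier G. \<forall>v\<in>N. act M g v \<in> N)"

definition irreducible_gmod ::
    "('g, 'a) monoid_scheme \<Rightarrow> ('k, 'b) ring_scheme \<Rightarrow> ('k, 'v, 'g) gmod \<Rightarrow> bool" where
  "irreducible_gmod G R M \<longleftrightarrow>
     group_module G R M \<and> carrier M \<noteq> {\<zero>\<^bsub>M\<^esub>} \<and>
     (\<forall>N. gsubmodule G R M N \<longrightarrow> N = {\<zero>\<^bsub>M\<^esub>} \<or> N = carrier M)"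

text \<open>The library's module record extends the ring record, so a module also has fields
  for a product and a unit; they play no role and are left undefined.\<close>

definition quotient_gmod :: "('k, 'v, 'g) gmod \<Rightarrow> 'v set \<Rightarrow> ('k, 'v set, 'g) gmod" where
  "quotient_gmod M N =
     \<lparr>carrier = a_rcosets\<^bsub>M\<^esub> N, monoid.mult = undefined, one = undefined,
      zero = N, add = (\<lambda>A B. A <+>\<^bsub>M\<^esub> B),
      smult = (\<lambda>c A. \<Union>v\<in>A. N +>\<^bsub>M\<^esub> (c \<odot>\<^bsub>M\<^esub> v)),
      act = (\<lambda>g A. \<Union>v\<in>A. N +>\<^bsub>M\<^esub> act M g v)\<rparr>"

definition isomorphic_gmod ::
    "('g, 'a) monoid_scheme \<Rightarrow> ('k, 'b) ring_scheme \<Rightarrow>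
     ('k, 'v, 'g) gmod \<Rightarrow> ('k, 'w, 'g) gmod \<Rightarrow> bool" where
  "isomorphic_gmod G R M M' \<longleftrightarrow>
     (\<exists>f\<in>iso (add_monoid M) (add_monoid M').
        (\<forall>c\<in>carrier R. \<forall>v\<in>carrier M. f (c \<odot>\<^bsub>M\<^esub> v) = c \<odot>\<^bsub>M'\<^esub> f v) \<and>
        (\<forall>g\<in>carrier G. \<forall>v\<in>carrier M. f (act M g v) = act M' g (f v)))"

text \<open>A composition series of length \<open>n\<close> is \<open>{0} = N 0 \<subseteq> \<dots> \<subseteq> N n = M\<close>; the values
  of \<open>N\<close> beyond \<open>n\<close> are irrelevant.\<close>

definition series_factor ::
    "('k, 'v, 'g) gmod \<Rightarrow> (nat \<Rightarrow> 'v set) \<Rightarrow> nat \<Rightarrow> ('k, 'v set, 'g) gmod" where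
  "series_factor M N i = quotient_gmod (M\<lparr>carrier := N (Suc i)\<rparr>) (N i)"

definition composition_series ::
    "('g, 'a) monoid_scheme \<Rightarrow> ('k, 'b) ring_scheme \<Rightarrow> ('k, 'v, 'g) gmod \<Rightarrow>
     nat \<Rightarrow> (nat \<Rightarrow> 'v set) \<Rightarrow> bool" where
  "composition_series G R M n N \<longleftrightarrow>
     group_module G R M \<and> N 0 = {\<zero>\<^bsub>M\<^esub>} \<and> N n = carrier M \<and>
     (\<forall>i\<le>n. gsubmodule G R M (N i)) \<and>
     (\<forall>i<n. N i \<subseteq> N (Suc i) \<and> irreducible_gmod G R (series_factor M N i))"

text \<open>\<open>[M : L]\<close>. By the Jordan--Hoelder theorem the number does not depend on the
  composition series.\<close>

definition comp_mult ::
    "('g, 'a) monoid_scheme \<Rightarrow> ('k, 'b) ring_scheme \<Rightarrow>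
     ('k, 'v, 'g) gmod \<Rightarrow> ('k, 'w, 'g) gmod \<Rightarrow> nat" where
  "comp_mult G R M L =
     (THE m. \<exists>n N. composition_series G R M n N \<and>
        m = card {i. i < n \<and> isomorphic_gmod G R (series_factor M N i) L})"

section \<open>Modules given in coordinates\<close>

text \<open>A matrix representation consists of a finite set indexing a basis \<open>e\<close> and, for each
  group element \<open>g\<close>, the matrix with \<open>g e\<^sub>j = \<Sum>\<^sub>i entry g i j e\<^sub>i\<close>.\<close>

record ('k, 'g, 'i) matrep =
  basis :: "'i set"
  entry :: "'g \<Rightarrow> 'i \<Rightarrow> 'i \<Rightarrow> 'k"

definition gmod_of :: "('k, 'b) ring_scheme \<Rightarrow> ('k, 'g, 'i) matrep \<Rightarrow> ('k, 'i \<Rightarrow> 'k, 'g) gmod" where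
  "gmod_of R V =
     \<lparr>carrier = basis V \<rightarrow>\<^sub>E carrier R, monoid.mult = undefined, one = undefined,
      zero = (\<lambda>i\<in>basis V. \<zero>\<^bsub>R\<^esub>), add = (\<lambda>v w. \<lambda>i\<in>basis V. v i \<oplus>\<^bsub>R\<^esub> w i),
      smult = (\<lambda>c v. \<lambda>i\<in>basis V. c \<otimes>\<^bsub>R\<^esub> v i),
      act = (\<lambda>g v. \<lambda>i\<in>basis V. \<Oplus>\<^bsub>R\<^esub>j\<in>basis V. entry V g i j \<otimes>\<^bsub>R\<^esub> v j)\<rparr>"

definition rep_dim :: "('k, 'g, 'i) matrep \<Rightarrow> nat" where
  "rep_dim V = card (basis V)"

text \<open>The tensor product, with basis \<open>e\<^sub>i \<otimes> f\<^sub>j\<close> and \<open>g (e\<^sub>i \<otimes> f\<^sub>j) = g e\<^sub>i \<otimes> g f\<^sub>j\<close>.\<close>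

definition tensor_rep ::
    "('k, 'b) ring_scheme \<Rightarrow> ('k, 'g, 'i) matrep \<Rightarrow> ('k, 'g, 'j) matrep \<Rightarrow>
     ('k, 'g, 'i \<times> 'j) matrep" where
  "tensor_rep R V W =
     \<lparr>basis = basis V \<times> basis W,
      entry = (\<lambda>g r c. entry V g (fst r) (fst c) \<otimes>\<^bsub>R\<^esub> entry W g (snd r) (snd c))\<rparr>"

section \<open>The group and its symmetric power modules\<close>

text \<open>The tuple \<open>(a, b, c, d)\<close> stands for the matrix with rows \<open>(a, b)\<close> and \<open>(c, d)\<close>.\<close>

definition SL2 :: "('k, 'b) ring_scheme \<Rightarrow> ('k \<times> 'k \<times> 'k \<times> 'k) monoid" where
  "SL2 R =
     \<lparr>carrier = {(a, b, c, d). {a, b, c, d} \<subseteq> carrier R \<and>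
        a \<otimes>\<^bsub>R\<^esub> d \<ominus>\<^bsub>R\<^esub> b \<otimes>\<^bsub>R\<^esub> c = \<one>\<^bsub>R\<^esub>},
      monoid.mult = (\<lambda>(a, b, c, d) (a', b', c', d').
        (a \<otimes>\<^bsub>R\<^esub> a' \<oplus>\<^bsub>R\<^esub> b \<otimes>\<^bsub>R\<^esub> c', a \<otimes>\<^bsub>R\<^esub> b' \<oplus>\<^bsub>R\<^esub> b \<otimes>\<^bsub>R\<^esub> d',
         c \<otimes>\<^bsub>R\<^esub> a' \<oplus>\<^bsub>R\<^esub> d \<otimes>\<^bsub>R\<^esub> c', c \<otimes>\<^bsub>R\<^esub> b' \<oplus>\<^bsub>R\<^esub> d \<otimes>\<^bsub>R\<^esub> d')),
      one = (\<one>\<^bsub>R\<^esub>, \<zero>\<^bsub>R\<^esub>, \<zero>\<^bsub>R\<^esub>, \<one>\<^bsub>R\<^esub>)\<rparr>"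

text \<open>The symmetric algebra of the natural module with basis \<open>x, y\<close> is the polynomial ring
  in \<open>x, y\<close>, and its \<open>n\<close>th symmetric power is the space of binary forms of degree \<open>n\<close>,
  with basis \<open>x\<^sup>n\<^sup>-\<^sup>j y\<^sup>j\<close> for \<open>0 \<le> j \<le> n\<close>. The matrix \<open>(a, b, c, d)\<close> acts by the algebra
  homomorphism \<open>x \<mapsto> a x + c y\<close>, \<open>y \<mapsto> b x + d y\<close>, so it sends \<open>x\<^sup>n\<^sup>-\<^sup>j y\<^sup>j\<close> to
  \<open>(a x + c y)\<^sup>n\<^sup>-\<^sup>j (b x + d y)\<^sup>j\<close>. Forms of fixed degree are written as polynomials in \<open>y\<close>
  by putting \<open>x = 1\<close>; the monomial \<open>x\<^sup>n\<^sup>-\<^sup>i y\<^sup>i\<close> then corresponds to \<open>y\<^sup>i\<close>.\<close>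

definition linear_poly :: "('k, 'b) ring_scheme \<Rightarrow> 'k \<Rightarrow> 'k \<Rightarrow> nat \<Rightarrow> 'k" where
  "linear_poly R s t = up_ring.monom (UP R) s 0 \<oplus>\<^bsub>UP R\<^esub> up_ring.monom (UP R) t 1"

definition sym_rep :: "('k, 'b) ring_scheme \<Rightarrow> nat \<Rightarrow> ('k, 'k \<times> 'k \<times> 'k \<times> 'k, nat) matrep" where
  "sym_rep R n =
     \<lparr>basis = {0..n},
      entry = (\<lambda>(a, b, c, d) i j. up_ring.coeff (UP R)
        ((linear_poly R a c [^]\<^bsub>UP R\<^esub> (n - j)) \<otimes>\<^bsub>UP R\<^esub> (linear_poly R b d [^]\<^bsub>UP R\<^esub> j)) i)\<rparr>"

section \<open>The Markov chains\<close>

definition tensor_prob ::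
    "('g, 'a) monoid_scheme \<Rightarrow> ('k, 'b) ring_scheme \<Rightarrow> ('k, 'g, 'w) matrep \<Rightarrow>
     ('k, 'g, 'i) matrep \<Rightarrow> ('k, 'g, 'j) matrep \<Rightarrow> real" where
  "tensor_prob G R W V V' =
     real (comp_mult G R (gmod_of R (tensor_rep R V W)) (gmod_of R V')) * real (rep_dim V')
       / (real (rep_dim V) * real (rep_dim W))"

text \<open>In the following, \<open>R\<close> is an algebraic closure of its subfield \<open>F\<close> with \<open>p\<close> elements,
  and the state \<open>V(a)\<close> is represented by the index \<open>a < p\<close>.\<close>

definition tensor_walk :: "'k ring \<Rightarrow> 'k set \<Rightarrow> nat \<Rightarrow> nat \<Rightarrow> real mat" where
  "tensor_walk R F p w =
     mat p p (\<lambda>(a, b). tensor_prob (SL2 (R\<lparr>carrier := F\<rparr>)) R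
       (sym_rep R w) (sym_rep R a) (sym_rep R b))"

definition mixed_walk :: "'k ring \<Rightarrow> 'k set \<Rightarrow> nat \<Rightarrow> real mat" where
  "mixed_walk R F p =
     (1/2) \<cdot>\<^sub>m tensor_walk R F p (p - 1) + (1/2) \<cdot>\<^sub>m tensor_walk R F p 1"

definition stationary_distribution :: "nat \<Rightarrow> real mat \<Rightarrow> (nat \<Rightarrow> real) \<Rightarrow> bool" where
  "stationary_distribution n K \<mu> \<longleftrightarrow>
     (\<forall>a<n. 0 \<le> \<mu> a) \<and> (\<Sum>a<n. \<mu> a) = 1 \<and> (\<forall>b<n. (\<Sum>a<n. \<mu> a * K $$ (a, b)) = \<mu> b)"

definition linf_distance :: "nat \<Rightarrow> real mat \<Rightarrow> (nat \<Rightarrow> real) \<Rightarrow> nat \<Rightarrow> real" where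
  "linf_distance n K \<mu> l = Max ((\<lambda>a. \<bar>(K ^\<^sub>m l) $$ (0, a) / \<mu> a - 1\<bar>) ` {..<n})"

definition odd_primes :: "nat filter" where
  "odd_primes = inf at_top (principal {p. prime p \<and> odd p})"

text \<open>Integer times \<open>\<ell> \<approx> (1 \<plusminus> \<epsilon>) t\<^sub>p\<close> are read as arbitrary sequences \<open>l\<close> of natural numbers
  with \<open>l p / ((1 \<plusminus> \<epsilon>) t p) \<longrightarrow> 1\<close>.\<close>

definition has_cutoff :: "nat filter \<Rightarrow> (nat \<Rightarrow> nat \<Rightarrow> real) \<Rightarrow> (nat \<Rightarrow> real) \<Rightarrow> bool" where
  "has_cutoff \<F> D t \<longleftrightarrow>
     (\<forall>\<epsilon>::real. 0 < \<epsilon> \<and> \<epsilon> < 1 \<longrightarrow>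
        (\<forall>l::nat \<Rightarrow> nat. (\<lambda>p. real (l p)) \<sim>[\<F>] (\<lambda>p. (1 + \<epsilon>) * t p) \<longrightarrow>
           ((\<lambda>p. D p (l p)) \<longlongrightarrow> 0) \<F>) \<and>
        (\<forall>l::nat \<Rightarrow> nat. (\<lambda>p. real (l p)) \<sim>[\<F>] (\<lambda>p. (1 - \<epsilon>) * t p) \<longrightarrow>
           filterlim (\<lambda>p. D p (l p)) at_top \<F>))"

end

theory Submission
  imports "HOL-Real_Asymp.Real_Asymp" Defs "HOL-Number_Theory.Number_Theory"
    "HOL-Computational_Algebra.Polynomial"
begin

text \<open>Multiplication by \<open>x\<^sub>1 y\<^sub>2 - y\<^sub>1 x\<^sub>2\<close> followed by restriction to the diagonal is an exact sequence
  \<open>0 \<rightarrow> S\<^sup>m \<otimes> S\<^sup>n \<rightarrow> S\<^sup>m\<^sup>+\<^sup>1 \<otimes> S\<^sup>n\<^sup>+\<^sup>1 \<rightarrow> S\<^sup>m\<^sup>+\<^sup>n\<^sup>+\<^sup>2 \<rightarrow> 0\<close>, and the Frobenius map gives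
  \<open>0 \<rightarrow> V(1) \<otimes> S\<^sup>r \<rightarrow> S\<^sup>p\<^sup>+\<^sup>r \<rightarrow> V(p - 2 - r) \<rightarrow> 0\<close> for \<open>r \<le> p - 2\<close>. By the Jordan--Hoelder theorem these two
  sequences determine the composition factors of all \<open>V(a) \<otimes> V(w)\<close>. Hence Brauer characters, that is
  the functions \<open>a \<mapsto> sin((a + 1) \<theta>) / ((a + 1) sin \<theta>)\<close> for \<open>\<theta> \<in> 2 \<pi> \<int> / (p \<plusminus> 1)\<close>, are eigenfunctions of the walk,
  with eigenvalue \<open>(cos \<theta> + sin(p \<theta>) / (p sin \<theta>)) / 2\<close>, of absolute value at most
  \<open>(1 + 1/p) / 2\<close> unless \<open>\<theta> = 0\<close>. Fourier inversion against the characters of the projective covers yields the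
  upper bounds.

  The eigenvalue at \<open>\<theta> = 2 \<pi> / (p - 1)\<close> is at least \<open>1/2\<close>, so the distance is at least \<open>2\<^sup>-\<^sup>l\<close>; this
  proves the lower bound for \<open>2\<^sup>l\<^sup>+\<^sup>2 \<ge> p\<^sup>4\<^sup>/\<^sup>3\<close>. For smaller \<open>l\<close> it suffices to bound
  below the probability of being at \<open>V(0)\<close> or \<open>V(1)\<close>. For the cutoff, the walk stays within
  \<open>V(0), \<dots>, V(l)\<close> for \<open>l\<close> steps with probability at least \<open>2\<^sup>-\<^sup>l\<close>, and the stationary measure of
  this set is \<open>O(l\<^sup>2 / p\<^sup>2)\<close>.\<close>

section \<open>Composition factors\<close>

text \<open>Brauer characters are never formed as traces of lifts. All that is used of them is
  additivity along the two exact sequences. For the tensor sequence this is a polynomial identity;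
  for the Frobenius sequence it comes down to the single equation
  \<open>cheb x p = x + cheb x (p - 2)\<close>, that is cos(p \<theta>) = cos \<theta> for x = 2 cos
  \<theta>, and this is what selects the angles. The coefficient field enters almost only through
  the reduction \<open>emb\<close> of integers: every linear map is given by an integer matrix, and
  exactness is certified by integer splittings modulo \<open>p\<close>. Symmetric powers are
  representations of all integer 2x2 matrices, so equivariance becomes a statement about integer
  polynomials. The maps of the Frobenius sequence are equivariant only modulo \<open>p\<close>, and
  the one onto V(p - 2 - r) is checked on generators of the group. That \<open>p\<close> is odd
  decides a sign at the Weyl element and makes the eigenvalue at \<theta> = pi vanish. The threshold
  23 is the first prime with 2 pi^2 p <= (p - 1)^2, which is what an eigenvalue of at least 1/2
  requires.\<close>

definition gmod_hom ::
    "('g, 'a) monoid_scheme \<Rightarrow> ('k, 'b) ring_scheme \<Rightarrow>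
     ('k, 'v, 'g) gmod \<Rightarrow> ('k, 'w, 'g) gmod \<Rightarrow> ('v \<Rightarrow> 'w) \<Rightarrow> bool" where
  "gmod_hom G R M M' f \<longleftrightarrow>
     (\<forall>v\<in>carrier M. f v \<in> carrier M') \<and>
     (\<forall>v\<in>carrier M. \<forall>w\<in>carrier M. f (v \<oplus>\<^bsub>M\<^esub> w) = f v \<oplus>\<^bsub>M'\<^esub> f w) \<and>
     (\<forall>c\<in>carrier R. \<forall>v\<in>carrier M. f (c \<odot>\<^bsub>M\<^esub> v) = c \<odot>\<^bsub>M'\<^esub> f v) \<and>
     (\<forall>g\<in>carrier G. \<forall>v\<in>carrier M. f (act M g v) = act M' g (f v))"

lemma gmod_homD:
  assumes "gmod_hom G R M M' f"
  shows "v \<in> carrier M \<Longrightarrow> f v \<in> carrier M'"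
    and "v \<in> carrier M \<Longrightarrow> w \<in> carrier M \<Longrightarrow> f (v \<oplus>\<^bsub>M\<^esub> w) = f v \<oplus>\<^bsub>M'\<^esub> f w"
    and "c \<in> carrier R \<Longrightarrow> v \<in> carrier M \<Longrightarrow> f (c \<odot>\<^bsub>M\<^esub> v) = c \<odot>\<^bsub>M'\<^esub> f v"
    and "g \<in> carrier G \<Longrightarrow> v \<in> carrier M \<Longrightarrow> f (act M g v) = act M' g (f v)"
  using assms by (auto simp: gmod_hom_def)

lemma gmod_hom_compose:
  "gmod_hom G R M M' f \<Longrightarrow> gmod_hom G R M' M'' h \<Longrightarrow> gmod_hom G R M M'' (\<lambda>v. h (f v))"
  by (simp add: gmod_hom_def)

lemma gmod_hom_restrict:
  "gmod_hom G R M M' f \<Longrightarrow> N \<subseteq> carrier M \<Longrightarrow> gmod_hom G R (M\<lparr>carrier := N\<rparr>) M' f"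
  by (auto simp: gmod_hom_def subset_iff)

lemma group_moduleD:
  assumes "group_module G R M"
  shows "group G" "module R M" "cring R" "abelian_group M"
proof -
  interpret group_module G R M by fact
  show "group G" "module R M" "cring R" "abelian_group M" by unfold_locales
qed

lemma gmod_hom_zero:
  assumes "group_module G R M" "group_module G R M'" "gmod_hom G R M M' f"
  shows "f \<zero>\<^bsub>M\<^esub> = \<zero>\<^bsub>M'\<^esub>"
proof -
  interpret M: group_module G R M by fact
  interpret M': group_module G R M' by fact
  have "f \<zero>\<^bsub>M\<^esub> \<oplus>\<^bsub>M'\<^esub> f \<zero>\<^bsub>M\<^esub> = f \<zero>\<^bsub>M\<^esub>"
    by (metis M.zero_closed M.M.l_zero gmod_homD(2)[OF assms(3)])
  moreover have "f \<zero>\<^bsub>M\<^esub> \<in> carrier M'" using gmod_homD(1)[OF assms(3)] by blast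
  ultimately show ?thesis by (metis M'.M.add.r_cancel_one)
qed

lemma gmod_hom_neg:
  assumes "group_module G R M" "group_module G R M'" "gmod_hom G R M M' f" "v \<in> carrier M"
  shows "f (\<ominus>\<^bsub>M\<^esub> v) = \<ominus>\<^bsub>M'\<^esub> f v"
proof -
  interpret M: group_module G R M by fact
  interpret M': group_module G R M' by fact
  have c: "f v \<in> carrier M'" "f (\<ominus>\<^bsub>M\<^esub> v) \<in> carrier M'"
    using gmod_homD(1)[OF assms(3)] assms(4) by auto
  have "f (\<ominus>\<^bsub>M\<^esub> v) \<oplus>\<^bsub>M'\<^esub> f v = f (\<ominus>\<^bsub>M\<^esub> v \<oplus>\<^bsub>M\<^esub> v)"
    using gmod_homD(2)[OF assms(3)] assms(4) by simp
  also have "\<dots> = \<zero>\<^bsub>M'\<^esub>"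
    using gmod_hom_zero[OF assms(1-3)] assms(4) by (simp add: M.M.l_neg)
  finally show ?thesis using c by (metis M'.M.minus_equality)
qed

lemma gsubmoduleD:
  assumes "group_module G R M" "gsubmodule G R M N"
  shows "N \<subseteq> carrier M" "\<zero>\<^bsub>M\<^esub> \<in> N"
    and "v \<in> N \<Longrightarrow> w \<in> N \<Longrightarrow> v \<oplus>\<^bsub>M\<^esub> w \<in> N"
    and "c \<in> carrier R \<Longrightarrow> v \<in> N \<Longrightarrow> c \<odot>\<^bsub>M\<^esub> v \<in> N"
    and "v \<in> N \<Longrightarrow> \<ominus>\<^bsub>M\<^esub> v \<in> N"
    and "g \<in> carrier G \<Longrightarrow> v \<in> N \<Longrightarrow> act M g v \<in> N"
    and "v \<in> N \<Longrightarrow> w \<in> N \<Longrightarrow> v \<ominus>\<^bsub>M\<^esub> w \<in> N"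
proof -
  interpret M: group_module G R M by fact
  have s: "submodule N R M" using assms(2) by (simp add: gsubmodule_def)
  note E = M.submoduleE[OF s]
  show "N \<subseteq> carrier M" "v \<in> N \<Longrightarrow> w \<in> N \<Longrightarrow> v \<oplus>\<^bsub>M\<^esub> w \<in> N"
     "c \<in> carrier R \<Longrightarrow> v \<in> N \<Longrightarrow> c \<odot>\<^bsub>M\<^esub> v \<in> N" "v \<in> N \<Longrightarrow> \<ominus>\<^bsub>M\<^esub> v \<in> N"
    using E by auto
  show "\<zero>\<^bsub>M\<^esub> \<in> N" using s unfolding submodule_def subgroup_def by simp
  show "g \<in> carrier G \<Longrightarrow> v \<in> N \<Longrightarrow> act M g v \<in> N"
    using assms(2) by (simp add: gsubmodule_def)
  show "v \<in> N \<Longrightarrow> w \<in> N \<Longrightarrow> v \<ominus>\<^bsub>M\<^esub> w \<in> N"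
    using E by (simp add: a_minus_def)
qed

lemma gsubmoduleI:
  assumes "group_module G R M" "N \<subseteq> carrier M" "\<zero>\<^bsub>M\<^esub> \<in> N"
    and "\<And>v w. v \<in> N \<Longrightarrow> w \<in> N \<Longrightarrow> v \<oplus>\<^bsub>M\<^esub> w \<in> N"
    and "\<And>c v. c \<in> carrier R \<Longrightarrow> v \<in> N \<Longrightarrow> c \<odot>\<^bsub>M\<^esub> v \<in> N"
    and "\<And>g v. g \<in> carrier G \<Longrightarrow> v \<in> N \<Longrightarrow> act M g v \<in> N"
  shows "gsubmodule G R M N"
proof -
  interpret M: group_module G R M by fact
  have "\<ominus>\<^bsub>M\<^esub> v \<in> N" if "v \<in> N" for v
  proof -
    have "(\<ominus>\<^bsub>R\<^esub> \<one>\<^bsub>R\<^esub>) \<odot>\<^bsub>M\<^esub> v \<in> N" using assms(5) that by simp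
    then show ?thesis using that assms(2) by (simp add: M.smult_l_minus subset_iff)
  qed
  then show ?thesis unfolding gsubmodule_def
    using assms by (auto intro!: M.submoduleI)
qed

lemma gsubmodule_carrier: "group_module G R M \<Longrightarrow> gsubmodule G R M (carrier M)"
  by (meson group_module.act_closed group_moduleD(2) gsubmodule_def module.carrier_is_submodule)

lemma gsubmodule_zero:
  assumes "group_module G R M" shows "gsubmodule G R M {\<zero>\<^bsub>M\<^esub>}"
proof -
  interpret M: group_module G R M by fact
  have "act M g \<zero>\<^bsub>M\<^esub> = \<zero>\<^bsub>M\<^esub>" if "g \<in> carrier G" for g
  proof -
    have "act M g \<zero>\<^bsub>M\<^esub> = act M g (\<zero>\<^bsub>R\<^esub> \<odot>\<^bsub>M\<^esub> \<zero>\<^bsub>M\<^esub>)" by simp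
    also have "\<dots> = \<zero>\<^bsub>R\<^esub> \<odot>\<^bsub>M\<^esub> act M g \<zero>\<^bsub>M\<^esub>"
      using that by (intro M.act_smult) auto
    also have "\<dots> = \<zero>\<^bsub>M\<^esub>" using that M.act_closed by simp
    finally show ?thesis .
  qed
  then show ?thesis by (intro gsubmoduleI[OF assms]) auto
qed

text \<open>The laws of a module are equations between elements, so a surjection \<open>f\<close>
  that respects the operations carries them to its image. This is how a quotient, of which so far
  only the operations are known, becomes a module.\<close>

lemma gmod_image:
  assumes "group_module G R M" "f ` carrier M = carrier Q"
    and "\<And>v w. v \<in> carrier M \<Longrightarrow> w \<in> carrier M \<Longrightarrow> f (v \<oplus>\<^bsub>M\<^esub> w) = f v \<oplus>\<^bsub>Q\<^esub> f w"
    and "\<And>c v. c \<in> carrier R \<Longrightarrow> v \<in> carrier M \<Longrightarrow> f (c \<odot>\<^bsub>M\<^esub> v) = c \<odot>\<^bsub>Q\<^esub> f v"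
    and "\<And>g v. g \<in> carrier G \<Longrightarrow> v \<in> carrier M \<Longrightarrow> f (act M g v) = act Q g (f v)"
    and "f \<zero>\<^bsub>M\<^esub> = \<zero>\<^bsub>Q\<^esub>"
  shows "group_module G R Q"
proof -
  interpret M: group_module G R M by fact
  note eqs = assms(3-6)[symmetric]
  have ex: "\<exists>v\<in>carrier M. x = f v" if "x \<in> carrier Q" for x using that assms(2) by blast
  have cl: "f v \<in> carrier Q" if "v \<in> carrier M" for v using that assms(2) by blast
  have neg: "\<exists>y\<in>carrier Q. y \<oplus>\<^bsub>Q\<^esub> f v = f \<zero>\<^bsub>M\<^esub>" if "v \<in> carrier M" for v
    using that by (intro bexI[OF _ cl[of "\<ominus>\<^bsub>M\<^esub> v"]]) (simp_all add: eqs M.M.l_neg)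
  have "abelian_group Q"
    by (rule abelian_groupI) (auto dest!: ex simp: eqs cl neg M.M.a_ac)
  then have "module R Q"
    by (intro moduleI M.R.cring_axioms)
      (auto dest!: ex simp: eqs cl M.smult_l_distr M.smult_r_distr M.smult_assoc1)
  moreover have "group_module_axioms G R Q"
    by (rule group_module_axioms.intro)
      (auto dest!: ex simp: eqs cl M.act_closed M.act_add M.act_smult M.act_one M.act_mult)
  ultimately show ?thesis by (intro group_module.intro M.G.group_axioms)
qed

lemma group_module_sub:
  assumes "group_module G R M" "gsubmodule G R M Y"
  shows "group_module G R (M\<lparr>carrier := Y\<rparr>)"
proof -
  interpret M: group_module G R M by fact
  have "module R (M\<lparr>carrier := Y\<rparr>)"
    using assms(2) by (auto simp: gsubmodule_def intro!: submodule.submodule_is_module M.module_axioms)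
  moreover have "group_module_axioms G R (M\<lparr>carrier := Y\<rparr>)"
    by (rule group_module_axioms.intro)
      (use gsubmoduleD[OF assms] in \<open>auto simp: M.act_add M.act_smult M.act_one M.act_mult subset_iff\<close>)
  ultimately show ?thesis by (intro group_module.intro M.G.group_axioms)
qed

lemma gsubmodule_sub_iff:
  assumes "group_module G R M" "gsubmodule G R M Y"
  shows "gsubmodule G R (M\<lparr>carrier := Y\<rparr>) Z \<longleftrightarrow> gsubmodule G R M Z \<and> Z \<subseteq> Y"
proof
  assume Z: "gsubmodule G R (M\<lparr>carrier := Y\<rparr>) Z"
  note D = gsubmoduleD[OF group_module_sub[OF assms] Z]
  show "gsubmodule G R M Z \<and> Z \<subseteq> Y"
    using D gsubmoduleD(1)[OF assms] by (auto intro!: gsubmoduleI[OF assms(1)])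
next
  assume Z: "gsubmodule G R M Z \<and> Z \<subseteq> Y"
  then show "gsubmodule G R (M\<lparr>carrier := Y\<rparr>) Z"
    using gsubmoduleD[OF assms(1), of Z]
    by (intro gsubmoduleI[OF group_module_sub[OF assms]]) auto
qed

lemma gsubmodule_image:
  assumes "group_module G R M" "group_module G R M'" "gmod_hom G R M M' f" "gsubmodule G R M N"
  shows "gsubmodule G R M' (f ` N)"
proof -
  note D = gsubmoduleD[OF assms(1,4)] and F = gmod_homD[OF assms(3)]
  have "f \<zero>\<^bsub>M\<^esub> = \<zero>\<^bsub>M'\<^esub>" using gmod_hom_zero[OF assms(1-3)] .
  then show ?thesis
    using D(1,2) F
    by (intro gsubmoduleI[OF assms(2)])
      (auto simp: subset_iff F(2-4)[symmetric] D(3-6) intro!: imageI image_eqI[of "\<zero>\<^bsub>M'\<^esub>" f "\<zero>\<^bsub>M\<^esub>"])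
qed

lemma gsubmodule_vimage:
  assumes "group_module G R M" "group_module G R M'" "gmod_hom G R M M' f" "gsubmodule G R M' N"
  shows "gsubmodule G R M {v \<in> carrier M. f v \<in> N}"
proof -
  interpret M: group_module G R M by fact
  note D = gsubmoduleD[OF assms(2,4)] and F = gmod_homD[OF assms(3)]
  have "f \<zero>\<^bsub>M\<^esub> = \<zero>\<^bsub>M'\<^esub>" using gmod_hom_zero[OF assms(1-3)] .
  then show ?thesis
    by (intro gsubmoduleI[OF assms(1)]) (auto simp: D F M.act_closed)
qed

section \<open>Intersections and sums of submodules\<close>

lemma gsubmodule_Int:
  assumes "group_module G R M" "gsubmodule G R M N" "gsubmodule G R M N'"
  shows "gsubmodule G R M (N \<inter> N')"
  using gsubmoduleD[OF assms(1,2)] gsubmoduleD[OF assms(1,3)]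
  by (intro gsubmoduleI[OF assms(1)]) auto

lemma set_add_iff: "x \<in> A <+>\<^bsub>M\<^esub> B \<longleftrightarrow> (\<exists>a\<in>A. \<exists>b\<in>B. x = a \<oplus>\<^bsub>M\<^esub> b)"
  by (auto simp: set_add_def set_mult_def)

lemma gsubmodule_add:
  assumes "group_module G R M" "gsubmodule G R M N" "gsubmodule G R M N'"
  shows "gsubmodule G R M (N <+>\<^bsub>M\<^esub> N')"
proof -
  interpret M: group_module G R M by fact
  note D = gsubmoduleD[OF assms(1,2)] and D' = gsubmoduleD[OF assms(1,3)]
  show ?thesis
  proof (rule gsubmoduleI[OF assms(1)])
    show "N <+>\<^bsub>M\<^esub> N' \<subseteq> carrier M" using D(1) D'(1) by (auto simp: set_add_iff subset_iff)
    show "\<zero>\<^bsub>M\<^esub> \<in> N <+>\<^bsub>M\<^esub> N'" using D(2) D'(2) by (force simp: set_add_iff)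
  next
    fix v w assume "v \<in> N <+>\<^bsub>M\<^esub> N'" "w \<in> N <+>\<^bsub>M\<^esub> N'"
    then obtain a b c d where abcd: "a \<in> N" "b \<in> N'" "c \<in> N" "d \<in> N'"
      and v: "v = a \<oplus>\<^bsub>M\<^esub> b" and w: "w = c \<oplus>\<^bsub>M\<^esub> d" by (auto simp: set_add_iff)
    have "v \<oplus>\<^bsub>M\<^esub> w = (a \<oplus>\<^bsub>M\<^esub> c) \<oplus>\<^bsub>M\<^esub> (b \<oplus>\<^bsub>M\<^esub> d)"
      unfolding v w using abcd D(1) D'(1) by (simp add: M.M.a_ac subset_iff)
    then show "v \<oplus>\<^bsub>M\<^esub> w \<in> N <+>\<^bsub>M\<^esub> N'" using abcd D(3) D'(3) unfolding set_add_iff by blast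
  next
    fix c v assume "c \<in> carrier R" "v \<in> N <+>\<^bsub>M\<^esub> N'"
    then show "c \<odot>\<^bsub>M\<^esub> v \<in> N <+>\<^bsub>M\<^esub> N'"
      using D(1,4) D'(1,4) by (auto simp: set_add_iff M.smult_r_distr subset_iff) blast
  next
    fix g v assume "g \<in> carrier G" "v \<in> N <+>\<^bsub>M\<^esub> N'"
    then show "act M g v \<in> N <+>\<^bsub>M\<^esub> N'"
      using D(1,6) D'(1,6) by (auto simp: set_add_iff M.act_add subset_iff) blast
  qed
qed

lemma subset_set_add:
  assumes "group_module G R M" "gsubmodule G R M N" "gsubmodule G R M N'"
  shows "N \<subseteq> N <+>\<^bsub>M\<^esub> N'" "N' \<subseteq> N <+>\<^bsub>M\<^esub> N'"
proof -
  interpret M: group_module G R M by fact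
  note D = gsubmoduleD[OF assms(1,2)] and D' = gsubmoduleD[OF assms(1,3)]
  show "N \<subseteq> N <+>\<^bsub>M\<^esub> N'"
  proof
    fix x assume x: "x \<in> N"
    have "x = x \<oplus>\<^bsub>M\<^esub> \<zero>\<^bsub>M\<^esub>" using x D(1) by auto
    then show "x \<in> N <+>\<^bsub>M\<^esub> N'" using x D'(2) unfolding set_add_iff by blast
  qed
  show "N' \<subseteq> N <+>\<^bsub>M\<^esub> N'"
  proof
    fix x assume x: "x \<in> N'"
    have "x = \<zero>\<^bsub>M\<^esub> \<oplus>\<^bsub>M\<^esub> x" using x D'(1) by auto
    then show "x \<in> N <+>\<^bsub>M\<^esub> N'" using x D(2) unfolding set_add_iff by blast
  qed
qed

lemma set_add_least:
  assumes "group_module G R M" "gsubmodule G R M T" "N \<subseteq> T" "N' \<subseteq> T"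
  shows "N <+>\<^bsub>M\<^esub> N' \<subseteq> T"
  using gsubmoduleD(3)[OF assms(1,2)] assms(3,4) by (auto simp: set_add_iff subset_iff)

text \<open>If a + b lies in \<open>C\<close> with a in \<open>A\<close>, then b = -a + (a + b) lies
  in \<open>C\<close> as well. The law recovers a submodule between two sums, or between two
  intersections, from its trace on a third one.\<close>

lemma modular_law:
  assumes M: "group_module G R M" and "gsubmodule G R M A" "gsubmodule G R M B" "gsubmodule G R M C" "A \<subseteq> C"
  shows "(A <+>\<^bsub>M\<^esub> B) \<inter> C = A <+>\<^bsub>M\<^esub> (B \<inter> C)"
proof -
  interpret M: group_module G R M by fact
  note A = gsubmoduleD[OF M assms(2)] and B = gsubmoduleD[OF M assms(3)]
    and C = gsubmoduleD[OF M assms(4)]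
  show ?thesis
  proof
    show "A <+>\<^bsub>M\<^esub> (B \<inter> C) \<subseteq> (A <+>\<^bsub>M\<^esub> B) \<inter> C"
    proof
      fix x assume "x \<in> A <+>\<^bsub>M\<^esub> (B \<inter> C)"
      then obtain a b where "a \<in> A" "b \<in> B" "b \<in> C" "x = a \<oplus>\<^bsub>M\<^esub> b" by (auto simp: set_add_iff)
      then show "x \<in> (A <+>\<^bsub>M\<^esub> B) \<inter> C"
        using \<open>A \<subseteq> C\<close> C(3)[of a b] by (auto simp: set_add_iff)
    qed
    show "(A <+>\<^bsub>M\<^esub> B) \<inter> C \<subseteq> A <+>\<^bsub>M\<^esub> (B \<inter> C)"
    proof
      fix x assume "x \<in> (A <+>\<^bsub>M\<^esub> B) \<inter> C"
      then obtain a b where ab: "a \<in> A" "b \<in> B" "x = a \<oplus>\<^bsub>M\<^esub> b" "x \<in> C" by (auto simp: set_add_iff)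
      have "\<ominus>\<^bsub>M\<^esub> a \<oplus>\<^bsub>M\<^esub> x \<in> C" using ab C(3,5) \<open>A \<subseteq> C\<close> by auto
      moreover have "\<ominus>\<^bsub>M\<^esub> a \<oplus>\<^bsub>M\<^esub> x = b" using ab A(1) B(1) M.M.r_neg1 by auto
      ultimately show "x \<in> A <+>\<^bsub>M\<^esub> (B \<inter> C)" using ab by (auto simp: set_add_iff)
    qed
  qed
qed

text \<open>This says \<open>Y / U \<cong> L\<close> without forming the quotient.\<close>

definition gmod_section ::
    "('g, 'a) monoid_scheme \<Rightarrow> ('k, 'b) ring_scheme \<Rightarrow>
     ('k, 'v, 'g) gmod \<Rightarrow> 'v set \<Rightarrow> 'v set \<Rightarrow> ('k, 'w, 'g) gmod \<Rightarrow> bool" where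
  "gmod_section G R M U Y L \<longleftrightarrow>
     (\<exists>q. gmod_hom G R (M\<lparr>carrier := Y\<rparr>) L q \<and> q ` Y = carrier L \<and>
        {v \<in> Y. q v = \<zero>\<^bsub>L\<^esub>} = U)"

section \<open>Quotients and the isomorphism theorems\<close>

lemma quotient_gmod_sel:
  "carrier (quotient_gmod M N) = a_rcosets\<^bsub>M\<^esub> N"
  "\<zero>\<^bsub>quotient_gmod M N\<^esub> = N"
  "A \<oplus>\<^bsub>quotient_gmod M N\<^esub> B = A <+>\<^bsub>M\<^esub> B"
  "c \<odot>\<^bsub>quotient_gmod M N\<^esub> A = (\<Union>v\<in>A. N +>\<^bsub>M\<^esub> (c \<odot>\<^bsub>M\<^esub> v))"
  "act (quotient_gmod M N) g A = (\<Union>v\<in>A. N +>\<^bsub>M\<^esub> act M g v)"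
  by (simp_all add: quotient_gmod_def)

lemma mem_coset_iff: "x \<in> N +>\<^bsub>M\<^esub> y \<longleftrightarrow> (\<exists>h\<in>N. x = h \<oplus>\<^bsub>M\<^esub> y)"
  by (auto simp: a_r_coset_def r_coset_def)

lemma coset_eq_iff:
  assumes "group_module G R M" "gsubmodule G R M N" "y \<in> carrier M" "z \<in> carrier M"
  shows "N +>\<^bsub>M\<^esub> y = N +>\<^bsub>M\<^esub> z \<longleftrightarrow> y \<ominus>\<^bsub>M\<^esub> z \<in> N"
proof -
  interpret M: group_module G R M by fact
  note D = gsubmoduleD[OF assms(1,2)]
  have c: "h \<in> carrier M" if "h \<in> N" for h using that D(1) by auto
  show ?thesis
  proof
    assume "N +>\<^bsub>M\<^esub> y = N +>\<^bsub>M\<^esub> z"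
    moreover have "y \<in> N +>\<^bsub>M\<^esub> y" using D(2) assms(3) by (auto simp: mem_coset_iff intro: bexI[of _ "\<zero>\<^bsub>M\<^esub>"])
    ultimately obtain h where h: "h \<in> N" "y = h \<oplus>\<^bsub>M\<^esub> z" by (auto simp: mem_coset_iff)
    have "y \<ominus>\<^bsub>M\<^esub> z = h" using h c assms by (simp add: a_minus_def M.M.a_assoc M.M.r_neg)
    then show "y \<ominus>\<^bsub>M\<^esub> z \<in> N" using h by simp
  next
    assume d: "y \<ominus>\<^bsub>M\<^esub> z \<in> N"
    have y: "y = (y \<ominus>\<^bsub>M\<^esub> z) \<oplus>\<^bsub>M\<^esub> z" using assms by (simp add: a_minus_def M.M.a_assoc M.M.l_neg)
    have "y \<oplus>\<^bsub>M\<^esub> (z \<oplus>\<^bsub>M\<^esub> \<ominus>\<^bsub>M\<^esub> y) = z"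
      using assms by (metis M.M.a_inv_closed M.M.a_lcomm M.M.r_neg M.M.r_zero)
    then have z: "z = \<ominus>\<^bsub>M\<^esub> (y \<ominus>\<^bsub>M\<^esub> z) \<oplus>\<^bsub>M\<^esub> y" using assms
      by (simp add: a_minus_def M.M.a_assoc M.M.l_neg M.M.minus_add M.M.a_comm)
    have "h \<oplus>\<^bsub>M\<^esub> y = (h \<oplus>\<^bsub>M\<^esub> (y \<ominus>\<^bsub>M\<^esub> z)) \<oplus>\<^bsub>M\<^esub> z" if "h \<in> N" for h
      using y c[OF that] c[OF d] assms by (metis M.M.a_assoc)
    moreover have "h \<oplus>\<^bsub>M\<^esub> z = (h \<oplus>\<^bsub>M\<^esub> \<ominus>\<^bsub>M\<^esub> (y \<ominus>\<^bsub>M\<^esub> z)) \<oplus>\<^bsub>M\<^esub> y" if "h \<in> N" for h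
      using z c[OF that] c[OF D(5)[OF d]] assms by (metis M.M.a_assoc)
    ultimately show "N +>\<^bsub>M\<^esub> y = N +>\<^bsub>M\<^esub> z"
      using D(3)[OF _ d] D(3)[OF _ D(5)[OF d]] unfolding set_eq_iff mem_coset_iff by metis
  qed
qed

lemma quotient_gmod_proj:
  assumes "group_module G R M" "gsubmodule G R M N"
  shows "gmod_hom G R M (quotient_gmod M N) (\<lambda>v. N +>\<^bsub>M\<^esub> v)"
    and "(\<lambda>v. N +>\<^bsub>M\<^esub> v) ` carrier M = carrier (quotient_gmod M N)"
    and "group_module G R (quotient_gmod M N)"
    and "v \<in> carrier M \<Longrightarrow> N +>\<^bsub>M\<^esub> v = N \<longleftrightarrow> v \<in> N"
proof -
  interpret M: group_module G R M by fact
  note D = gsubmoduleD[OF assms(1,2)]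
  let ?Q = "quotient_gmod M N" and ?f = "\<lambda>v. N +>\<^bsub>M\<^esub> v"
  have c: "h \<in> carrier M" if "h \<in> N" for h using that D(1) by auto
  show im: "?f ` carrier M = carrier ?Q"
    by (auto simp: quotient_gmod_sel A_RCOSETS_def RCOSETS_def a_r_coset_def)
  have z: "?f \<zero>\<^bsub>M\<^esub> = N" using c by (auto simp: mem_coset_iff)
  have mz: "\<ominus>\<^bsub>M\<^esub> \<zero>\<^bsub>M\<^esub> = \<zero>\<^bsub>M\<^esub>" by (rule M.M.minus_equality) simp_all
  show "v \<in> carrier M \<Longrightarrow> N +>\<^bsub>M\<^esub> v = N \<longleftrightarrow> v \<in> N"
    using coset_eq_iff[OF assms, of v "\<zero>\<^bsub>M\<^esub>"] z mz by (simp add: a_minus_def)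
  have self: "v \<in> ?f v" if "v \<in> carrier M" for v
    using that D(2) by (auto simp: mem_coset_iff intro!: bexI[of _ "\<zero>\<^bsub>M\<^esub>"])
  have add: "?f (v \<oplus>\<^bsub>M\<^esub> w) = ?f v \<oplus>\<^bsub>?Q\<^esub> ?f w" if "v \<in> carrier M" "w \<in> carrier M" for v w
  proof (intro equalityI subsetI)
    fix x assume "x \<in> ?f (v \<oplus>\<^bsub>M\<^esub> w)"
    then obtain h where h: "h \<in> N" "x = h \<oplus>\<^bsub>M\<^esub> (v \<oplus>\<^bsub>M\<^esub> w)" by (auto simp: mem_coset_iff)
    then have "x = (h \<oplus>\<^bsub>M\<^esub> v) \<oplus>\<^bsub>M\<^esub> w" using c that by (simp add: M.M.a_assoc)
    moreover have "h \<oplus>\<^bsub>M\<^esub> v \<in> ?f v" using h by (auto simp: mem_coset_iff)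
    ultimately show "x \<in> ?f v \<oplus>\<^bsub>?Q\<^esub> ?f w"
      unfolding quotient_gmod_sel set_add_iff by (intro bexI[OF _ self[OF that(2)]] bexI[of _ "h \<oplus>\<^bsub>M\<^esub> v"])
  next
    fix x assume "x \<in> ?f v \<oplus>\<^bsub>?Q\<^esub> ?f w"
    then obtain h k where h: "h \<in> N" "k \<in> N" "x = (h \<oplus>\<^bsub>M\<^esub> v) \<oplus>\<^bsub>M\<^esub> (k \<oplus>\<^bsub>M\<^esub> w)"
      by (auto simp: quotient_gmod_sel set_add_iff mem_coset_iff)
    then have "x = (h \<oplus>\<^bsub>M\<^esub> k) \<oplus>\<^bsub>M\<^esub> (v \<oplus>\<^bsub>M\<^esub> w)" using c that by (simp add: M.M.a_ac)
    then show "x \<in> ?f (v \<oplus>\<^bsub>M\<^esub> w)" using D(3)[OF h(1,2)] unfolding mem_coset_iff by blast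
  qed
  have minus_add: "h \<oplus>\<^bsub>M\<^esub> v \<ominus>\<^bsub>M\<^esub> v = h" if "h \<in> carrier M" "v \<in> carrier M" for h v
    using that by (simp add: a_minus_def M.M.a_assoc M.M.r_neg)
  \<comment> \<open>Scalars and group elements act on a coset by a union over its representatives.
    An additive \<open>T\<close> that preserves \<open>N\<close> sends all representatives into one
    coset, so the union collapses; the two operations below are instances.\<close>
  have union: "(\<Union>u\<in>?f v. N +>\<^bsub>M\<^esub> T u) = ?f (T v)"
    if v: "v \<in> carrier M" and T: "\<And>u. u \<in> carrier M \<Longrightarrow> T u \<in> carrier M" "\<And>h. h \<in> N \<Longrightarrow> T h \<in> N"
      "\<And>u w. u \<in> carrier M \<Longrightarrow> w \<in> carrier M \<Longrightarrow> T (u \<oplus>\<^bsub>M\<^esub> w) = T u \<oplus>\<^bsub>M\<^esub> T w" for v T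
  proof -
    have "?f (T u) = ?f (T v)" if u: "u \<in> ?f v" for u
    proof -
      obtain h where h: "h \<in> N" "u = h \<oplus>\<^bsub>M\<^esub> v" using u by (auto simp: mem_coset_iff)
      then have "T u \<ominus>\<^bsub>M\<^esub> T v = T h" using T(1,3) v c by (simp add: minus_add)
      then show ?thesis using h T(1,2) v c by (simp add: coset_eq_iff[OF assms])
    qed
    then have "(\<Union>u\<in>?f v. ?f (T u)) = (\<Union>u\<in>?f v. ?f (T v))" by (intro SUP_cong refl)
    then show ?thesis using self[OF v] by (metis SUP_constant empty_iff)
  qed
  have smult: "?f (k \<odot>\<^bsub>M\<^esub> v) = k \<odot>\<^bsub>?Q\<^esub> ?f v" if "k \<in> carrier R" "v \<in> carrier M" for k v
    unfolding quotient_gmod_sel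
    by (rule union[of v "\<lambda>u. k \<odot>\<^bsub>M\<^esub> u", symmetric]) (use that D(4) in \<open>auto simp: M.smult_r_distr\<close>)
  have act: "?f (act M g v) = act ?Q g (?f v)" if "g \<in> carrier G" "v \<in> carrier M" for g v
    unfolding quotient_gmod_sel
    by (rule union[of v "act M g", symmetric]) (use that D(6) in \<open>auto simp: M.act_add M.act_closed\<close>)
  show "gmod_hom G R M ?Q ?f"
    unfolding gmod_hom_def im[symmetric] using add smult act by simp
  show "group_module G R ?Q"
  proof (rule gmod_image[OF assms(1) im add smult act])
    show "?f \<zero>\<^bsub>M\<^esub> = \<zero>\<^bsub>?Q\<^esub>" by (simp add: z quotient_gmod_sel)
  qed
qed

lemma isomorphic_gmodE:
  assumes "isomorphic_gmod G R M M'"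
  obtains f where "gmod_hom G R M M' f" "bij_betw f (carrier M) (carrier M')"
proof -
  obtain f where "f \<in> iso (add_monoid M) (add_monoid M')"
    "\<forall>c\<in>carrier R. \<forall>v\<in>carrier M. f (c \<odot>\<^bsub>M\<^esub> v) = c \<odot>\<^bsub>M'\<^esub> f v"
    "\<forall>g\<in>carrier G. \<forall>v\<in>carrier M. f (act M g v) = act M' g (f v)"
    using assms by (auto simp: isomorphic_gmod_def)
  then show ?thesis
    by (intro that[of f]) (auto simp: iso_def gmod_hom_def hom_def)
qed

lemma isomorphic_gmodI:
  assumes "gmod_hom G R M M' f" "bij_betw f (carrier M) (carrier M')"
  shows "isomorphic_gmod G R M M'"
  unfolding isomorphic_gmod_def
  using assms by (intro bexI[of _ f]) (auto simp: iso_def gmod_hom_def hom_def)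

lemma isomorphic_gmod_sym:
  assumes "group_module G R M" "isomorphic_gmod G R M M'"
  shows "isomorphic_gmod G R M' M"
proof -
  interpret M: group_module G R M by fact
  obtain f where f: "gmod_hom G R M M' f" "bij_betw f (carrier M) (carrier M')"
    using isomorphic_gmodE[OF assms(2)] .
  let ?h = "the_inv_into (carrier M) f"
  have b: "bij_betw ?h (carrier M') (carrier M)" using f(2) by (rule bij_betw_the_inv_into)
  have hf: "?h (f v) = v" if "v \<in> carrier M" for v
    using f(2) that by (auto simp: bij_betw_def the_inv_into_f_f)
  have ex: "\<exists>v\<in>carrier M. x = f v" if "x \<in> carrier M'" for x
    using that f(2) by (auto simp: bij_betw_def)
  have "gmod_hom G R M' M ?h"
    unfolding gmod_hom_def
    by (auto dest!: ex simp: hf gmod_homD(2-4)[OF f(1), symmetric] M.act_closed)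
  then show ?thesis using b by (rule isomorphic_gmodI)
qed

lemma isomorphic_gmod_trans:
  assumes "isomorphic_gmod G R M M'" "isomorphic_gmod G R M' M''"
  shows "isomorphic_gmod G R M M''"
proof -
  obtain f h where "gmod_hom G R M M' f" "bij_betw f (carrier M) (carrier M')"
    "gmod_hom G R M' M'' h" "bij_betw h (carrier M') (carrier M'')"
    using assms by (metis isomorphic_gmodE)
  then show ?thesis
    using bij_betw_trans[of f _ _ h] gmod_hom_compose[of G R M M' f M'' h]
    by (intro isomorphic_gmodI[of _ _ _ _ "\<lambda>v. h (f v)"]) (auto simp: comp_def)
qed

lemma irreducible_gmod_iso:
  assumes "irreducible_gmod G R L" "group_module G R M" "isomorphic_gmod G R M L"
  shows "irreducible_gmod G R M"
proof -
  have L: "group_module G R L" using assms(1) by (simp add: irreducible_gmod_def)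
  interpret M: group_module G R M by fact
  interpret L: group_module G R L by fact
  obtain f where f: "gmod_hom G R M L f" "bij_betw f (carrier M) (carrier L)"
    using isomorphic_gmodE[OF assms(3)] .
  have inj: "inj_on f (carrier M)" and im: "f ` carrier M = carrier L"
    using f(2) by (auto simp: bij_betw_def)
  have z: "f \<zero>\<^bsub>M\<^esub> = \<zero>\<^bsub>L\<^esub>" using gmod_hom_zero[OF assms(2) L f(1)] .
  have "N = {\<zero>\<^bsub>M\<^esub>} \<or> N = carrier M" if N: "gsubmodule G R M N" for N
  proof -
    have "N \<subseteq> carrier M" "\<zero>\<^bsub>M\<^esub> \<in> N" using gsubmoduleD[OF assms(2) N] by auto
    moreover have "f ` N = f ` {\<zero>\<^bsub>M\<^esub>} \<or> f ` N = f ` carrier M"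
      using gsubmodule_image[OF assms(2) L f(1) N] assms(1) z im by (auto simp: irreducible_gmod_def)
    ultimately show ?thesis using inj by (metis M.zero_closed empty_subsetI inj_on_image_eq_iff insert_subset order_refl)
  qed
  moreover have "carrier M \<noteq> {\<zero>\<^bsub>M\<^esub>}" using assms(1) im z by (auto simp: irreducible_gmod_def)
  ultimately show ?thesis using assms(2) by (simp add: irreducible_gmod_def)
qed

text \<open>The first isomorphism theorem. It allows all later arguments to work with a surjection
  on \<open>Y\<close> with kernel \<open>U\<close> instead of with sets of vectors.\<close>

lemma section_iff_isomorphic:
  assumes M: "group_module G R M" and Y: "gsubmodule G R M Y" and U: "gsubmodule G R M U" "U \<subseteq> Y"
    and L: "group_module G R L"
  shows "gmod_section G R M U Y L \<longleftrightarrow> isomorphic_gmod G R (quotient_gmod (M\<lparr>carrier := Y\<rparr>) U) L"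
proof -
  let ?Y = "M\<lparr>carrier := Y\<rparr>"
  let ?Q = "quotient_gmod ?Y U" and ?f = "\<lambda>v. U +>\<^bsub>?Y\<^esub> v"
  have gY: "group_module G R ?Y" using group_module_sub[OF M Y] .
  interpret Y: group_module G R ?Y by fact
  interpret L: group_module G R L by fact
  have sU: "gsubmodule G R ?Y U" using U gsubmodule_sub_iff[OF M Y] by simp
  note P = quotient_gmod_proj[OF gY sU]
  show ?thesis
  proof
    assume "isomorphic_gmod G R ?Q L"
    then obtain f where f: "gmod_hom G R ?Q L f" "bij_betw f (carrier ?Q) (carrier L)"
      by (rule isomorphic_gmodE)
    have "f (?f v) = \<zero>\<^bsub>L\<^esub> \<longleftrightarrow> v \<in> U" if "v \<in> Y" for v
    proof -
      have "f U = \<zero>\<^bsub>L\<^esub>" using gmod_hom_zero[OF P(3) L f(1)] by (simp add: quotient_gmod_sel)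
      moreover have "U \<in> carrier ?Q" "?f v \<in> carrier ?Q"
        using gsubmoduleD(2)[OF P(3) gsubmodule_zero[OF P(3)]] P(2) that
          gsubmoduleD(2)[OF P(3) gsubmodule_carrier[OF P(3)]]
        by (auto simp: quotient_gmod_sel(2))
      ultimately have "f (?f v) = \<zero>\<^bsub>L\<^esub> \<longleftrightarrow> ?f v = U" using f(2) by (metis bij_betw_def inj_on_def)
      then show ?thesis using P(4)[of v] that by simp
    qed
    then have "{v \<in> Y. f (?f v) = \<zero>\<^bsub>L\<^esub>} = U" using U(2) by auto
    moreover have "(\<lambda>v. f (?f v)) ` Y = carrier L"
      using f(2) unfolding bij_betw_def P(2)[symmetric] by (simp add: image_image)
    ultimately show "gmod_section G R M U Y L"
      unfolding gmod_section_def using gmod_hom_compose[OF P(1) f(1)] by auto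
  next
    assume "gmod_section G R M U Y L"
    then obtain q where q: "gmod_hom G R ?Y L q" "q ` Y = carrier L" "{v \<in> Y. q v = \<zero>\<^bsub>L\<^esub>} = U"
      unfolding gmod_section_def by blast
    have ker: "?f v = ?f w \<longleftrightarrow> q v = q w" if "v \<in> Y" "w \<in> Y" for v w
    proof -
      have qc: "q v \<in> carrier L" "q w \<in> carrier L" using that q(2) by auto
      have "?f v = ?f w \<longleftrightarrow> v \<ominus>\<^bsub>?Y\<^esub> w \<in> U" using coset_eq_iff[OF gY sU] that by simp
      also have "\<dots> \<longleftrightarrow> q (v \<ominus>\<^bsub>?Y\<^esub> w) = \<zero>\<^bsub>L\<^esub>"
        using q(3) that Y.M.minus_closed[of v w] by auto
      also have "q (v \<ominus>\<^bsub>?Y\<^esub> w) = q v \<ominus>\<^bsub>L\<^esub> q w"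
        using that gmod_homD(2)[OF q(1), of v "\<ominus>\<^bsub>?Y\<^esub> w"] gmod_hom_neg[OF gY L q(1), of w]
          Y.M.a_inv_closed[of w] by (simp add: a_minus_def)
      also have "\<dots> = \<zero>\<^bsub>L\<^esub> \<longleftrightarrow> q v = q w"
        using qc by (metis L.M.a_inv_closed L.M.minus_equality L.M.minus_minus L.M.r_neg a_minus_def)
      finally show ?thesis .
    qed
    \<comment> \<open>The induced map evaluates \<open>q\<close> at an arbitrary representative; by
      \<open>ker\<close> the choice does not matter.\<close>
    define h where "h A = q (SOME v. v \<in> Y \<and> ?f v = A)" for A
    have h: "h (?f v) = q v" if "v \<in> Y" for v
    proof -
      have "(SOME w. w \<in> Y \<and> ?f w = ?f v) \<in> Y \<and> ?f (SOME w. w \<in> Y \<and> ?f w = ?f v) = ?f v"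
        by (rule someI[of _ v]) (use that in auto)
      then show ?thesis unfolding h_def using ker that by blast
    qed
    have cQ: "carrier ?Q = ?f ` Y" using P(2) by simp
    have Ycl: "v \<oplus>\<^bsub>M\<^esub> w \<in> Y" "c \<in> carrier R \<Longrightarrow> c \<odot>\<^bsub>M\<^esub> v \<in> Y" "g \<in> carrier G \<Longrightarrow> act M g v \<in> Y"
      if "v \<in> Y" "w \<in> Y" for v w c g using gsubmoduleD[OF M Y] that by auto
    have hom: "h (?f v \<oplus>\<^bsub>?Q\<^esub> ?f w) = h (?f v) \<oplus>\<^bsub>L\<^esub> h (?f w)"
      "c \<in> carrier R \<Longrightarrow> h (c \<odot>\<^bsub>?Q\<^esub> ?f v) = c \<odot>\<^bsub>L\<^esub> h (?f v)"
      "g \<in> carrier G \<Longrightarrow> h (act ?Q g (?f v)) = act L g (h (?f v))"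
      if "v \<in> Y" "w \<in> Y" for v w c g
      using gmod_homD(2)[OF P(1), of v w, symmetric] gmod_homD(3)[OF P(1), of c v, symmetric]
        gmod_homD(4)[OF P(1), of g v, symmetric]
        gmod_homD(2)[OF q(1), of v w] gmod_homD(3)[OF q(1), of c v] gmod_homD(4)[OF q(1), of g v]
        that Ycl[OF that] h by simp_all
    have "h (?f v) \<in> carrier L" if "v \<in> Y" for v
      using that gmod_homD(1)[OF q(1)] by (simp add: h)
    then have "gmod_hom G R ?Q L h"
      unfolding gmod_hom_def cQ using hom by blast
    moreover have "inj_on h (carrier ?Q)" unfolding cQ inj_on_def using ker h by simp
    moreover have "h ` carrier ?Q = carrier L" unfolding cQ q(2)[symmetric] by (auto simp: h image_image)
    ultimately show "isomorphic_gmod G R ?Q L" by (intro isomorphic_gmodI) (auto simp: bij_betw_def)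
  qed
qed

text \<open>The second isomorphism theorem P / (P \<inter> Q) = (P + Q) / Q, stated for an arbitrary
  target \<open>L\<close>. From right to left a surjection is restricted to \<open>P\<close>; from
  left to right it is extended to \<open>P + Q\<close> by ignoring the \<open>Q\<close>
  component.\<close>

lemma section_Int_iff_add:
  assumes M: "group_module G R M" and P: "gsubmodule G R M P" and Q: "gsubmodule G R M Q"
    and L: "group_module G R L"
  shows "gmod_section G R M (P \<inter> Q) P L \<longleftrightarrow> gmod_section G R M Q (P <+>\<^bsub>M\<^esub> Q) L"
proof
  interpret M: group_module G R M by fact
  interpret L: group_module G R L by fact
  note DP = gsubmoduleD[OF M P] and DQ = gsubmoduleD[OF M Q]
  let ?S = "P <+>\<^bsub>M\<^esub> Q"
  have PS: "P \<subseteq> ?S" "Q \<subseteq> ?S" using subset_set_add[OF M P Q] by auto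
  have memS: "a \<oplus>\<^bsub>M\<^esub> b \<in> ?S" if "a \<in> P" "b \<in> Q" for a b using that by (auto simp: set_add_iff)
  have mem: "v \<in> P \<Longrightarrow> v \<in> carrier M" "v \<in> Q \<Longrightarrow> v \<in> carrier M" for v
    using DP(1) DQ(1) by auto
  {
    assume "gmod_section G R M Q ?S L"
    then obtain q where q: "gmod_hom G R (M\<lparr>carrier := ?S\<rparr>) L q" "q ` ?S = carrier L"
      "{v \<in> ?S. q v = \<zero>\<^bsub>L\<^esub>} = Q" unfolding gmod_section_def by blast
    have "gmod_hom G R (M\<lparr>carrier := P\<rparr>) L q"
      using gmod_hom_restrict[OF q(1), of P] PS by simp
    moreover have "{v \<in> P. q v = \<zero>\<^bsub>L\<^esub>} = P \<inter> Q" using q(3) PS by blast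
    moreover have "q ` P = carrier L"
    proof
      show "q ` P \<subseteq> carrier L" using q(2) PS by auto
      show "carrier L \<subseteq> q ` P"
      proof
        fix l assume l: "l \<in> carrier L"
        then have "l \<in> q ` ?S" by (simp only: q(2))
        then obtain s where s: "l = q s" "s \<in> ?S" by (rule imageE)
        from s(2) obtain a b where ab: "a \<in> P" "b \<in> Q" "s = a \<oplus>\<^bsub>M\<^esub> b" by (auto simp: set_add_iff)
        have "q (a \<oplus>\<^bsub>M\<^esub> b) = q a \<oplus>\<^bsub>L\<^esub> q b"
          using gmod_homD(2)[OF q(1), of a b] ab PS by auto
        also have "q b = \<zero>\<^bsub>L\<^esub>" using q(3) ab by blast
        also have "q a \<oplus>\<^bsub>L\<^esub> \<zero>\<^bsub>L\<^esub> = q a" using q(2) ab PS by (intro L.M.r_zero) auto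
        finally have "l = q a" using ab s(1) by simp
        then show "l \<in> q ` P" using ab(1) by (rule image_eqI)
      qed
    qed
    ultimately show "gmod_section G R M (P \<inter> Q) P L"
      unfolding gmod_section_def by blast
  }
  {
    assume "gmod_section G R M (P \<inter> Q) P L"
    then obtain q where q: "gmod_hom G R (M\<lparr>carrier := P\<rparr>) L q" "q ` P = carrier L"
      "{v \<in> P. q v = \<zero>\<^bsub>L\<^esub>} = P \<inter> Q" unfolding gmod_section_def by blast
    have qc: "q a \<in> carrier L" if "a \<in> P" for a using that q(2) by auto
    \<comment> \<open>Two decompositions of one vector differ by -a' + a = b' - b, which lies in
      \<open>P \<inter> Q\<close>, where \<open>q\<close> vanishes.\<close>
    have well: "q a = q a'" if "a \<in> P" "a' \<in> P" "b \<in> Q" "b' \<in> Q" "a \<oplus>\<^bsub>M\<^esub> b = a' \<oplus>\<^bsub>M\<^esub> b'" for a b a' b'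
    proof -
      let ?d = "\<ominus>\<^bsub>M\<^esub> a' \<oplus>\<^bsub>M\<^esub> a"
      have "?d \<oplus>\<^bsub>M\<^esub> b = \<ominus>\<^bsub>M\<^esub> a' \<oplus>\<^bsub>M\<^esub> (a' \<oplus>\<^bsub>M\<^esub> b')"
        using that mem by (simp add: M.M.a_assoc)
      then have db: "?d \<oplus>\<^bsub>M\<^esub> b = b'" using that mem by (simp add: M.M.r_neg1)
      have "?d = (?d \<oplus>\<^bsub>M\<^esub> b) \<ominus>\<^bsub>M\<^esub> b"
        using that(1-4) mem by (simp add: a_minus_def M.M.a_assoc M.M.r_neg)
      then have "?d = b' \<ominus>\<^bsub>M\<^esub> b" unfolding db .
      then have "?d \<in> P \<inter> Q"
        using that DP(3)[OF DP(5)[of a'], of a] DQ(7)[of b' b] by simp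
      then have "q ?d = \<zero>\<^bsub>L\<^esub>" using q(3) by blast
      have "a = a' \<oplus>\<^bsub>M\<^esub> ?d" using that mem by (simp add: M.M.r_neg2)
      then have "q a = q a' \<oplus>\<^bsub>L\<^esub> q ?d"
        using gmod_homD(2)[OF q(1), of a' ?d] \<open>?d \<in> P \<inter> Q\<close> that by simp
      then show ?thesis using \<open>q ?d = \<zero>\<^bsub>L\<^esub>\<close> qc that by simp
    qed
    define h where "h s = q (SOME a. a \<in> P \<and> (\<exists>b\<in>Q. s = a \<oplus>\<^bsub>M\<^esub> b))" for s
    have h: "h (a \<oplus>\<^bsub>M\<^esub> b) = q a" if "a \<in> P" "b \<in> Q" for a b
    proof -
      let ?a = "SOME a'. a' \<in> P \<and> (\<exists>b'\<in>Q. a \<oplus>\<^bsub>M\<^esub> b = a' \<oplus>\<^bsub>M\<^esub> b')"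
      have "?a \<in> P \<and> (\<exists>b'\<in>Q. a \<oplus>\<^bsub>M\<^esub> b = ?a \<oplus>\<^bsub>M\<^esub> b')"
        by (rule someI[of _ a]) (use that in blast)
      then obtain b' where "?a \<in> P" "b' \<in> Q" "a \<oplus>\<^bsub>M\<^esub> b = ?a \<oplus>\<^bsub>M\<^esub> b'" by blast
      then show ?thesis unfolding h_def using well[of ?a a b' b] that by simp
    qed
    have "h (s \<oplus>\<^bsub>M\<^esub> t) = h s \<oplus>\<^bsub>L\<^esub> h t" if st: "s \<in> ?S" "t \<in> ?S" for s t
    proof -
      obtain a b c d where e: "a \<in> P" "b \<in> Q" "c \<in> P" "d \<in> Q" "s = a \<oplus>\<^bsub>M\<^esub> b" "t = c \<oplus>\<^bsub>M\<^esub> d"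
        using st by (auto simp: set_add_iff)
      have "s \<oplus>\<^bsub>M\<^esub> t = (a \<oplus>\<^bsub>M\<^esub> c) \<oplus>\<^bsub>M\<^esub> (b \<oplus>\<^bsub>M\<^esub> d)" using e mem by (simp add: M.M.a_ac)
      then show ?thesis
        using h[OF DP(3) DQ(3), of a c b d] h[of a b] h[of c d] e gmod_homD(2)[OF q(1), of a c] by simp
    qed
    moreover have "h (k \<odot>\<^bsub>M\<^esub> s) = k \<odot>\<^bsub>L\<^esub> h s" if k: "k \<in> carrier R" and st: "s \<in> ?S" for k s
    proof -
      obtain a b where e: "a \<in> P" "b \<in> Q" "s = a \<oplus>\<^bsub>M\<^esub> b" using st by (auto simp: set_add_iff)
      then show ?thesis using h[OF DP(4) DQ(4), OF k _ k, of a b] h[of a b] mem k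
          gmod_homD(3)[OF q(1), of k a] by (simp add: M.smult_r_distr)
    qed
    moreover have "h (act M g s) = act L g (h s)" if k: "g \<in> carrier G" and st: "s \<in> ?S" for g s
    proof -
      obtain a b where e: "a \<in> P" "b \<in> Q" "s = a \<oplus>\<^bsub>M\<^esub> b" using st by (auto simp: set_add_iff)
      then show ?thesis using h[OF DP(6) DQ(6), OF k _ k, of a b] h[of a b] mem k
          gmod_homD(4)[OF q(1), of g a] by (simp add: M.act_add)
    qed
    moreover have hc: "h s \<in> carrier L" if st: "s \<in> ?S" for s
      using st qc h by (auto simp: set_add_iff)
    ultimately have "gmod_hom G R (M\<lparr>carrier := ?S\<rparr>) L h" by (simp add: gmod_hom_def)
    moreover have "h ` ?S = carrier L"
    proof
      show "h ` ?S \<subseteq> carrier L" using hc by auto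
      show "carrier L \<subseteq> h ` ?S"
      proof
        fix l assume "l \<in> carrier L"
        then have "l \<in> q ` P" by (simp only: q(2))
        then obtain a where a: "l = q a" "a \<in> P" by (rule imageE)
        then have "l = h (a \<oplus>\<^bsub>M\<^esub> \<zero>\<^bsub>M\<^esub>)" using h[OF a(2) DQ(2)] by simp
        then show "l \<in> h ` ?S" using memS[OF a(2) DQ(2)] by (rule image_eqI)
      qed
    qed
    moreover have "{v \<in> ?S. h v = \<zero>\<^bsub>L\<^esub>} = Q"
    proof
      show "Q \<subseteq> {v \<in> ?S. h v = \<zero>\<^bsub>L\<^esub>}"
      proof
        fix b assume b: "b \<in> Q"
        have "h (\<zero>\<^bsub>M\<^esub> \<oplus>\<^bsub>M\<^esub> b) = q \<zero>\<^bsub>M\<^esub>" using h DP(2) b by blast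
        moreover have "q \<zero>\<^bsub>M\<^esub> = \<zero>\<^bsub>L\<^esub>" using q(3) DP(2) DQ(2) by blast
        ultimately show "b \<in> {v \<in> ?S. h v = \<zero>\<^bsub>L\<^esub>}" using b mem PS(2) by auto
      qed
      show "{v \<in> ?S. h v = \<zero>\<^bsub>L\<^esub>} \<subseteq> Q"
      proof
        fix v assume "v \<in> {v \<in> ?S. h v = \<zero>\<^bsub>L\<^esub>}"
        then obtain a b where e: "a \<in> P" "b \<in> Q" "v = a \<oplus>\<^bsub>M\<^esub> b" "h v = \<zero>\<^bsub>L\<^esub>" by (auto simp: set_add_iff)
        then have "a \<in> P \<inter> Q" using q(3) h by auto
        then show "v \<in> Q" using e DQ(3) by auto
      qed
    qed
    ultimately show "gmod_section G R M Q ?S L" unfolding gmod_section_def by blast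
  }
qed

section \<open>Chains and the Jordan--Hoelder theorem\<close>

definition gmod_step ::
    "('g, 'a) monoid_scheme \<Rightarrow> ('k, 'b) ring_scheme \<Rightarrow> ('k, 'v, 'g) gmod \<Rightarrow> 'v set \<Rightarrow> 'v set \<Rightarrow> bool" where
  "gmod_step G R M U Y \<longleftrightarrow> gsubmodule G R M U \<and> gsubmodule G R M Y \<and> U \<subseteq> Y \<and>
     (\<forall>T. gsubmodule G R M T \<and> U \<subseteq> T \<and> T \<subseteq> Y \<longrightarrow> T = U \<or> T = Y)"

text \<open>The test \<open>U \<noteq> Y\<close> makes a stationary step weightless for every
  \<open>L\<close>, including the zero module, to which a trivial section would be
  isomorphic.\<close>

definition section_weight ::
    "('g, 'a) monoid_scheme \<Rightarrow> ('k, 'b) ring_scheme \<Rightarrow> ('k, 'v, 'g) gmod \<Rightarrow> ('k, 'w, 'g) gmod \<Rightarrow>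
     'v set \<Rightarrow> 'v set \<Rightarrow> nat" where
  "section_weight G R M L U Y = (if U \<noteq> Y \<and> gmod_section G R M U Y L then 1 else 0)"

lemma section_weight_refl [simp]: "section_weight G R M L U U = 0"
  by (simp add: section_weight_def)

lemma set_add_comm:
  assumes "group_module G R M" "A \<subseteq> carrier M" "B \<subseteq> carrier M"
  shows "A <+>\<^bsub>M\<^esub> B = B <+>\<^bsub>M\<^esub> A"
proof -
  interpret M: group_module G R M by fact
  have "A' <+>\<^bsub>M\<^esub> B' \<subseteq> B' <+>\<^bsub>M\<^esub> A'" if "A' \<subseteq> carrier M" "B' \<subseteq> carrier M" for A' B'
  proof
    fix x assume "x \<in> A' <+>\<^bsub>M\<^esub> B'"
    then obtain a b where ab: "a \<in> A'" "b \<in> B'" "x = a \<oplus>\<^bsub>M\<^esub> b" by (auto simp: set_add_iff)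
    then have "x = b \<oplus>\<^bsub>M\<^esub> a" using that by (metis M.M.a_comm subsetD)
    then show "x \<in> B' <+>\<^bsub>M\<^esub> A'" unfolding set_add_iff using ab by blast
  qed
  then show ?thesis using assms by blast
qed

text \<open>The submodule U + (Y \<inter> Z) lies between \<open>U\<close> and \<open>Y\<close>,
  hence equals one of them. If it is \<open>U\<close>, then intersecting with \<open>Z\<close> makes
  the step stationary and adding \<open>Z\<close> preserves it; if it is \<open>Y\<close>, the roles
  are exchanged. The second isomorphism theorem identifies the surviving section with the original
  one, so the weight is never lost or doubled.\<close>

lemma gmod_step_split:
  assumes M: "group_module G R M" and L: "group_module G R L"
    and st: "gmod_step G R M U Y" and Z: "gsubmodule G R M Z"
  shows "gmod_step G R M (U \<inter> Z) (Y \<inter> Z)"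
    and "gmod_step G R M (U <+>\<^bsub>M\<^esub> Z) (Y <+>\<^bsub>M\<^esub> Z)"
    and "section_weight G R M L U Y =
      section_weight G R M L (U \<inter> Z) (Y \<inter> Z) + section_weight G R M L (U <+>\<^bsub>M\<^esub> Z) (Y <+>\<^bsub>M\<^esub> Z)"
proof -
  interpret M: group_module G R M by fact
  have U: "gsubmodule G R M U" and Y: "gsubmodule G R M Y" and UY: "U \<subseteq> Y"
    and cov: "\<And>T. gsubmodule G R M T \<Longrightarrow> U \<subseteq> T \<Longrightarrow> T \<subseteq> Y \<Longrightarrow> T = U \<or> T = Y"
    using st by (auto simp: gmod_step_def)
  note sub_add = subset_set_add[OF M] and least = set_add_least[OF M]
  note UZ = gsubmodule_Int[OF M U Z] and YZ = gsubmodule_Int[OF M Y Z]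
    and UaZ = gsubmodule_add[OF M U Z] and YaZ = gsubmodule_add[OF M Y Z]
  have mono: "U <+>\<^bsub>M\<^esub> Z \<subseteq> Y <+>\<^bsub>M\<^esub> Z"
    using sub_add[OF Y Z] UY by (intro least[OF YaZ]) auto
  have "gmod_step G R M (U \<inter> Z) (Y \<inter> Z) \<and> gmod_step G R M (U <+>\<^bsub>M\<^esub> Z) (Y <+>\<^bsub>M\<^esub> Z) \<and>
    section_weight G R M L U Y =
      section_weight G R M L (U \<inter> Z) (Y \<inter> Z) + section_weight G R M L (U <+>\<^bsub>M\<^esub> Z) (Y <+>\<^bsub>M\<^esub> Z)"
  proof (cases "U <+>\<^bsub>M\<^esub> (Y \<inter> Z) = U")
    case True
    have int: "Y \<inter> Z = U \<inter> Z" using True sub_add(2)[OF U YZ] UY by blast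
    have "(U <+>\<^bsub>M\<^esub> Z) \<inter> Y = U <+>\<^bsub>M\<^esub> (Z \<inter> Y)" using modular_law[OF M U Z Y UY] .
    also have "Z \<inter> Y = Y \<inter> Z" by blast
    finally have ml: "(U <+>\<^bsub>M\<^esub> Z) \<inter> Y = U" using True by simp
    have sum: "Y <+>\<^bsub>M\<^esub> (U <+>\<^bsub>M\<^esub> Z) = Y <+>\<^bsub>M\<^esub> Z"
    proof
      show "Y <+>\<^bsub>M\<^esub> (U <+>\<^bsub>M\<^esub> Z) \<subseteq> Y <+>\<^bsub>M\<^esub> Z"
        by (rule least[OF YaZ sub_add(1)[OF Y Z] mono])
      show "Y <+>\<^bsub>M\<^esub> Z \<subseteq> Y <+>\<^bsub>M\<^esub> (U <+>\<^bsub>M\<^esub> Z)"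
        using sub_add[OF Y UaZ] sub_add[OF U Z] by (intro least[OF gsubmodule_add[OF M Y UaZ]]) auto
    qed
    have sec: "gmod_section G R M U Y L \<longleftrightarrow> gmod_section G R M (U <+>\<^bsub>M\<^esub> Z) (Y <+>\<^bsub>M\<^esub> Z) L"
      using section_Int_iff_add[OF M Y UaZ L] ml sum by (simp add: Int_commute)
    have neq: "U = Y \<longleftrightarrow> U <+>\<^bsub>M\<^esub> Z = Y <+>\<^bsub>M\<^esub> Z"
    proof
      assume "U <+>\<^bsub>M\<^esub> Z = Y <+>\<^bsub>M\<^esub> Z"
      then have "Y \<subseteq> U <+>\<^bsub>M\<^esub> Z" using sub_add(1)[OF Y Z] by simp
      then show "U = Y" using ml by blast
    qed simp
    \<comment> \<open>Such a \<open>T\<close> is determined by its trace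
      \<open>T \<inter> Y\<close>, which is \<open>U\<close> or \<open>Y\<close> because nothing
      lies strictly between them; the modular law reconstructs \<open>T\<close> from it.\<close>
    have "T = U <+>\<^bsub>M\<^esub> Z \<or> T = Y <+>\<^bsub>M\<^esub> Z"
      if T: "gsubmodule G R M T" "U <+>\<^bsub>M\<^esub> Z \<subseteq> T" "T \<subseteq> Y <+>\<^bsub>M\<^esub> Z" for T
    proof -
      have "U \<subseteq> T \<inter> Y" using T(2) sub_add(1)[OF U Z] UY by blast
      then consider "T \<inter> Y = U" | "T \<inter> Y = Y" using cov[OF gsubmodule_Int[OF M T(1) Y]] by blast
      then show ?thesis
      proof cases
        case 1
        have "T = (Y <+>\<^bsub>M\<^esub> (U <+>\<^bsub>M\<^esub> Z)) \<inter> T" using T(3) sum by blast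
        also have "Y <+>\<^bsub>M\<^esub> (U <+>\<^bsub>M\<^esub> Z) = (U <+>\<^bsub>M\<^esub> Z) <+>\<^bsub>M\<^esub> Y"
          by (intro set_add_comm[OF M] gsubmoduleD(1)[OF M] Y UaZ)
        also have "\<dots> \<inter> T = (U <+>\<^bsub>M\<^esub> Z) <+>\<^bsub>M\<^esub> (Y \<inter> T)" using modular_law[OF M UaZ Y T(1,2)] .
        also have "\<dots> \<subseteq> U <+>\<^bsub>M\<^esub> Z"
          by (rule least[OF UaZ order_refl]) (use 1 sub_add(1)[OF U Z] in blast)
        finally show ?thesis using T(2) by blast
      next
        case 2
        have "Z \<subseteq> T" using T(2) sub_add(2)[OF U Z] by (rule subset_trans[rotated])
        moreover have "Y \<subseteq> T" using 2 by blast
        ultimately have "Y <+>\<^bsub>M\<^esub> Z \<subseteq> T" by (intro least[OF T(1)])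
        then show ?thesis using T(3) by blast
      qed
    qed
    then have "gmod_step G R M (U <+>\<^bsub>M\<^esub> Z) (Y <+>\<^bsub>M\<^esub> Z)"
      unfolding gmod_step_def using UaZ YaZ mono by blast
    moreover have "gmod_step G R M (U \<inter> Z) (Y \<inter> Z)"
      unfolding gmod_step_def int using UZ by blast
    ultimately show ?thesis using sec neq int by (simp add: section_weight_def)
  next
    case False
    have subY: "U <+>\<^bsub>M\<^esub> (Y \<inter> Z) \<subseteq> Y" using UY by (intro least[OF Y]) auto
    then have Yeq: "U <+>\<^bsub>M\<^esub> (Y \<inter> Z) = Y"
      using cov[OF gsubmodule_add[OF M U YZ] sub_add(1)[OF U YZ]] False by blast
    have "Y \<subseteq> U <+>\<^bsub>M\<^esub> Z"
      using sub_add[OF U Z] by (subst Yeq[symmetric], intro least[OF UaZ]) auto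
    then have "Y <+>\<^bsub>M\<^esub> Z \<subseteq> U <+>\<^bsub>M\<^esub> Z" using sub_add[OF U Z] by (intro least[OF UaZ]) auto
    then have sum: "U <+>\<^bsub>M\<^esub> Z = Y <+>\<^bsub>M\<^esub> Z" using mono by blast
    have int: "(Y \<inter> Z) \<inter> U = U \<inter> Z" using UY by blast
    have comm: "(Y \<inter> Z) <+>\<^bsub>M\<^esub> U = Y"
      using Yeq set_add_comm[OF M gsubmoduleD(1)[OF M U] gsubmoduleD(1)[OF M YZ]] by simp
    have sec: "gmod_section G R M U Y L \<longleftrightarrow> gmod_section G R M (U \<inter> Z) (Y \<inter> Z) L"
      using section_Int_iff_add[OF M YZ U L] unfolding int comm by simp
    have "U \<noteq> Y" using False Yeq by auto
    moreover have "U \<inter> Z \<noteq> Y \<inter> Z"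
    proof
      assume "U \<inter> Z = Y \<inter> Z"
      then have "U <+>\<^bsub>M\<^esub> (Y \<inter> Z) \<subseteq> U" by (intro least[OF U]) auto
      then show False using Yeq \<open>U \<noteq> Y\<close> UY by blast
    qed
    \<comment> \<open>Dually, such a \<open>T\<close> is determined by U + T.\<close>
    moreover have "T = U \<inter> Z \<or> T = Y \<inter> Z"
      if T: "gsubmodule G R M T" "U \<inter> Z \<subseteq> T" "T \<subseteq> Y \<inter> Z" for T
    proof -
      have "U <+>\<^bsub>M\<^esub> T \<subseteq> Y" using UY T(3) by (intro least[OF Y]) auto
      then consider "U <+>\<^bsub>M\<^esub> T = U" | "U <+>\<^bsub>M\<^esub> T = Y"
        using cov[OF gsubmodule_add[OF M U T(1)] sub_add(1)[OF U T(1)]] by blast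
      then show ?thesis
      proof cases
        case 1
        then have "T \<subseteq> U" using sub_add(2)[OF U T(1)] by simp
        then show ?thesis using T by blast
      next
        case 2
        have "T <+>\<^bsub>M\<^esub> U = Y"
          using 2 set_add_comm[OF M gsubmoduleD(1)[OF M U] gsubmoduleD(1)[OF M T(1)]] by simp
        then have "Y \<inter> Z = (T <+>\<^bsub>M\<^esub> U) \<inter> (Y \<inter> Z)" by blast
        also have "\<dots> = T <+>\<^bsub>M\<^esub> (U \<inter> (Y \<inter> Z))" using modular_law[OF M T(1) U YZ T(3)] .
        also have "\<dots> \<subseteq> T" using T(2) by (intro least[OF T(1)]) auto
        finally show ?thesis using T(3) by blast
      qed
    qed
    ultimately have "gmod_step G R M (U \<inter> Z) (Y \<inter> Z)"
      unfolding gmod_step_def using UZ YZ UY by blast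
    moreover have "gmod_step G R M (U <+>\<^bsub>M\<^esub> Z) (Y <+>\<^bsub>M\<^esub> Z)"
      unfolding gmod_step_def sum using YaZ by blast
    ultimately show ?thesis using sec sum \<open>U \<noteq> Y\<close> \<open>U \<inter> Z \<noteq> Y \<inter> Z\<close> by (simp add: section_weight_def)
  qed
  note conj = this
  show "gmod_step G R M (U \<inter> Z) (Y \<inter> Z)"
    using conj by (rule conjunct1)
  show "gmod_step G R M (U <+>\<^bsub>M\<^esub> Z) (Y <+>\<^bsub>M\<^esub> Z)"
    using conj[THEN conjunct2] by (rule conjunct1)
  show "section_weight G R M L U Y =
      section_weight G R M L (U \<inter> Z) (Y \<inter> Z) + section_weight G R M L (U <+>\<^bsub>M\<^esub> Z) (Y <+>\<^bsub>M\<^esub> Z)"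
    using conj[THEN conjunct2] by (rule conjunct2)
qed

text \<open>Chains may be stationary here, so that intersecting a chain with a submodule, or adding
  a submodule to it, gives again a chain.\<close>

theorem jordan_hoelder:
  assumes M: "group_module G R M" and L: "group_module G R L"
    and "\<And>i. i < n \<Longrightarrow> gmod_step G R M (N i) (N (Suc i))"
    and "\<And>i. i < m \<Longrightarrow> gmod_step G R M (N' i) (N' (Suc i))"
    and "gsubmodule G R M (N 0)" "N 0 = N' 0" "N n = N' m"
  shows "(\<Sum>i<n. section_weight G R M L (N i) (N (Suc i))) =
    (\<Sum>i<m. section_weight G R M L (N' i) (N' (Suc i)))"
  using assms(3-7)
proof (induction m arbitrary: N n)
  case 0
  have up: "N 0 \<subseteq> N i" if "i \<le> n" for i
    using that by (induction i) (use 0(1) in \<open>auto simp: gmod_step_def less_eq_Suc_le\<close>)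
  have down: "N i \<subseteq> N n" if "i \<le> n" for i
    using that by (induction rule: inc_induct) (use 0(1) in \<open>auto simp: gmod_step_def\<close>)
  have const: "N i = N 0" if "i \<le> n" for i using up[OF that] down[OF that] 0 by simp
  have "section_weight G R M L (N i) (N (Suc i)) = 0" if "i < n" for i
    using const[of i] const[of "Suc i"] that by (simp add: section_weight_def)
  then show ?case by (simp add: sum.neutral)
next
  case (Suc m)
  let ?w = "section_weight G R M L"
  \<comment> \<open>The first chain is cut at the penultimate member of the second. Its
    intersections with \<open>Z\<close> end at \<open>Z\<close>, so the induction hypothesis
    compares them with the second chain without its last step; its sums with \<open>Z\<close> must
    account for that last step.\<close>
  define Z where "Z = N' m"
  have last: "gmod_step G R M Z (N n)" using Suc.prems(2)[of m] Suc.prems(5) by (simp add: Z_def)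
  then have Z: "gsubmodule G R M Z" and Zn: "Z \<subseteq> N n" by (auto simp: gmod_step_def)
  have sub: "gsubmodule G R M (N i)" if "i \<le> n" for i
    using that Suc.prems(1,3) by (cases i) (auto simp: gmod_step_def)
  have N'0: "N' 0 \<subseteq> N' i" if "i \<le> Suc m" for i
    using that by (induction i) (use Suc.prems(2) in \<open>auto simp: gmod_step_def less_eq_Suc_le\<close>)
  have 0: "N 0 \<subseteq> Z" using N'0[of m] Suc.prems(4) by (simp add: Z_def)
  note split = gmod_step_split[OF M L Suc.prems(1) Z]
  have int: "(\<Sum>i<n. ?w (N i \<inter> Z) (N (Suc i) \<inter> Z)) = (\<Sum>i<m. ?w (N' i) (N' (Suc i)))"
    by (rule Suc.IH[of n "\<lambda>i. N i \<inter> Z"])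
      (use split(1) Suc.prems(2) Suc.prems(3,4) 0 Zn Z in
        \<open>auto simp: Z_def Int_absorb1 Int_absorb2 intro: gsubmodule_Int[OF M]\<close>)
  \<comment> \<open>The sums run from \<open>Z\<close> to \<open>N n\<close>, which is a single
    step, so this chain jumps at most once and the weights up to \<open>j\<close> are that of the
    one section reached so far.\<close>
  have part: "(\<Sum>i<j. ?w (N i <+>\<^bsub>M\<^esub> Z) (N (Suc i) <+>\<^bsub>M\<^esub> Z)) = ?w Z (N j <+>\<^bsub>M\<^esub> Z) \<and>
      (N j <+>\<^bsub>M\<^esub> Z = Z \<or> N j <+>\<^bsub>M\<^esub> Z = N n)" if "j \<le> n" for j
    using that
  proof (induction j)
    case 0
    have "N 0 <+>\<^bsub>M\<^esub> Z = Z"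
      using subset_set_add(2)[OF M sub[of 0] Z] set_add_least[OF M Z \<open>N 0 \<subseteq> Z\<close>] by auto
    then show ?case by simp
  next
    case (Suc j)
    have st: "gmod_step G R M (N j <+>\<^bsub>M\<^esub> Z) (N (Suc j) <+>\<^bsub>M\<^esub> Z)" using split(2) Suc.prems by auto
    then have m1: "N j <+>\<^bsub>M\<^esub> Z \<subseteq> N (Suc j) <+>\<^bsub>M\<^esub> Z" "gsubmodule G R M (N (Suc j) <+>\<^bsub>M\<^esub> Z)"
      by (auto simp: gmod_step_def)
    have "N (Suc j) \<subseteq> N n"
      using Suc.prems by (induction rule: inc_induct) (use \<open>\<And>i. i < n \<Longrightarrow> gmod_step G R M (N i) (N (Suc i))\<close> in \<open>auto simp: gmod_step_def\<close>)
    then have m2: "N (Suc j) <+>\<^bsub>M\<^esub> Z \<subseteq> N n" by (intro set_add_least[OF M sub] Zn) auto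
    have "Z \<subseteq> N (Suc j) <+>\<^bsub>M\<^esub> Z" using subset_set_add(2)[OF M sub Z] Suc.prems by auto
    then have "N (Suc j) <+>\<^bsub>M\<^esub> Z = Z \<or> N (Suc j) <+>\<^bsub>M\<^esub> Z = N n"
      using last m1(2) m2 by (auto simp: gmod_step_def)
    then show ?case using Suc.IH Suc.prems m1(1) m2 Zn by auto
  qed
  have top: "(\<Sum>i<n. ?w (N i <+>\<^bsub>M\<^esub> Z) (N (Suc i) <+>\<^bsub>M\<^esub> Z)) = ?w Z (N n)"
  proof -
    have "N n <+>\<^bsub>M\<^esub> Z = N n"
      using subset_set_add(1)[OF M sub[OF order_refl] Z] set_add_least[OF M sub[OF order_refl] order_refl Zn]
      by (intro equalityI)
    then show ?thesis using part[OF order_refl] by (simp only:)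
  qed
  have "(\<Sum>i<n. ?w (N i) (N (Suc i))) = (\<Sum>i<n. ?w (N i \<inter> Z) (N (Suc i) \<inter> Z) +
      ?w (N i <+>\<^bsub>M\<^esub> Z) (N (Suc i) <+>\<^bsub>M\<^esub> Z))"
    by (rule sum.cong[OF refl], rule split(3)) simp
  also have "\<dots> = (\<Sum>i<n. ?w (N i \<inter> Z) (N (Suc i) \<inter> Z)) +
      (\<Sum>i<n. ?w (N i <+>\<^bsub>M\<^esub> Z) (N (Suc i) <+>\<^bsub>M\<^esub> Z))"
    by (rule sum.distrib)
  also have "\<dots> = (\<Sum>i<m. ?w (N' i) (N' (Suc i))) + ?w (N' m) (N' (Suc m))"
    unfolding int top by (simp only: Suc.prems(5) Z_def)
  also have "\<dots> = (\<Sum>i<Suc m. ?w (N' i) (N' (Suc i)))"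
    by (rule sum.lessThan_Suc[symmetric])
  finally show ?case .
qed

text \<open>An intermediate \<open>T\<close> has an image in the quotient that is zero or
  everything. In the second case every coset of \<open>U\<close> meets \<open>T\<close>, and since
  \<open>T\<close> contains \<open>U\<close> it is all of \<open>Y\<close>.\<close>

lemma cover_if_irreducible:
  assumes M: "group_module G R M" and U: "gsubmodule G R M U" and Y: "gsubmodule G R M Y" and "U \<subseteq> Y"
    and irr: "irreducible_gmod G R (quotient_gmod (M\<lparr>carrier := Y\<rparr>) U)"
  shows "gmod_step G R M U Y" "U \<noteq> Y"
proof -
  let ?Y = "M\<lparr>carrier := Y\<rparr>"
  let ?Q = "quotient_gmod ?Y U" and ?f = "\<lambda>v. U +>\<^bsub>?Y\<^esub> v"
  have gY: "group_module G R ?Y" using group_module_sub[OF M Y] .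
  have sU: "gsubmodule G R ?Y U" using U \<open>U \<subseteq> Y\<close> gsubmodule_sub_iff[OF M Y] by simp
  note P = quotient_gmod_proj[OF gY sU]
  have im: "?f ` Y = carrier ?Q" using P(2) by simp
  have ker: "?f v = U \<longleftrightarrow> v \<in> U" if "v \<in> Y" for v using P(4) that by simp
  have zQ: "\<zero>\<^bsub>?Q\<^esub> = U" by (simp add: quotient_gmod_sel)
  have "T = U \<or> T = Y" if T: "gsubmodule G R M T" "U \<subseteq> T" "T \<subseteq> Y" for T
  proof -
    have "gsubmodule G R ?Y T" using T gsubmodule_sub_iff[OF M Y] by simp
    then have "gsubmodule G R ?Q (?f ` T)" by (rule gsubmodule_image[OF gY P(3,1)])
    then consider "?f ` T = {U}" | "?f ` T = ?f ` Y"
      using irr im zQ unfolding irreducible_gmod_def by auto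
    then show ?thesis
    proof cases
      case 1
      then have "?f v = U" if "v \<in> T" for v using that by blast
      then show ?thesis using ker T by blast
    next
      case 2
      have "y \<in> T" if "y \<in> Y" for y
      proof -
        have "?f y \<in> ?f ` T" using that 2 by blast
        then obtain t where t: "t \<in> T" "?f y = ?f t" by blast
        then have "y \<ominus>\<^bsub>?Y\<^esub> t \<in> U" using coset_eq_iff[OF gY sU, of y t] that T by auto
        moreover have "y \<ominus>\<^bsub>?Y\<^esub> t \<oplus>\<^bsub>M\<^esub> t = y"
        proof -
          interpret Y: group_module G R ?Y by fact
          have "(y \<ominus>\<^bsub>?Y\<^esub> t) \<oplus>\<^bsub>?Y\<^esub> t = y"
            using t that T Y.M.a_inv_closed[of t] Y.M.l_neg[of t] Y.M.a_assoc[of y "\<ominus>\<^bsub>?Y\<^esub> t" t]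
              Y.M.r_zero[of y] by (auto simp: a_minus_def)
          then show ?thesis by simp
        qed
        ultimately show ?thesis using gsubmoduleD(3)[OF M T(1), of "y \<ominus>\<^bsub>?Y\<^esub> t" t] t T by auto
      qed
      then show ?thesis using T by blast
    qed
  qed
  then show "gmod_step G R M U Y" unfolding gmod_step_def using assms by blast
  show "U \<noteq> Y"
  proof
    assume "U = Y"
    then have "?f v = U" if "v \<in> Y" for v using that ker by simp
    then have "carrier ?Q \<subseteq> {U}" unfolding im[symmetric] by auto
    moreover have "U \<in> carrier ?Q"
      using gsubmoduleD(2)[OF P(3) gsubmodule_carrier[OF P(3)]] zQ by simp
    ultimately have "carrier ?Q = {\<zero>\<^bsub>?Q\<^esub>}" unfolding zQ by blast
    then show False using irr unfolding irreducible_gmod_def by blast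
  qed
qed

section \<open>Composition multiplicities\<close>

lemma group_module_section:
  assumes "group_module G R M" "gsubmodule G R M U" "gsubmodule G R M Y" "U \<subseteq> Y"
  shows "group_module G R (quotient_gmod (M\<lparr>carrier := Y\<rparr>) U)"
  using quotient_gmod_proj(3)[OF group_module_sub[OF assms(1,3)]] gsubmodule_sub_iff[OF assms(1,3)] assms
  by simp

text \<open>The factors of a composition series are nonzero, so no step is stationary and the
  weights count exactly the factors isomorphic to \<open>L\<close>.\<close>

lemma sum_section_weight_composition_series:
  assumes L: "group_module G R L" and C: "composition_series G R M n N"
  shows "i < n \<Longrightarrow> gmod_step G R M (N i) (N (Suc i))"
    and "card {i. i < n \<and> isomorphic_gmod G R (series_factor M N i) L} =
      (\<Sum>i<n. section_weight G R M L (N i) (N (Suc i)))"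
proof -
  have M: "group_module G R M" and sub: "\<And>i. i \<le> n \<Longrightarrow> gsubmodule G R M (N i)"
    and inc: "\<And>i. i < n \<Longrightarrow> N i \<subseteq> N (Suc i)"
    and irr: "\<And>i. i < n \<Longrightarrow> irreducible_gmod G R (series_factor M N i)"
    using C by (auto simp: composition_series_def)
  note cov = cover_if_irreducible[OF M sub sub inc irr[unfolded series_factor_def]]
  show "i < n \<Longrightarrow> gmod_step G R M (N i) (N (Suc i))" by (rule cov(1)) simp_all
  have "section_weight G R M L (N i) (N (Suc i)) =
      (if isomorphic_gmod G R (series_factor M N i) L then 1 else 0)" if "i < n" for i
    using cov(2)[of i] section_iff_isomorphic[OF M sub sub inc L, of i] that
    by (auto simp: section_weight_def series_factor_def)
  then have "(\<Sum>i<n. section_weight G R M L (N i) (N (Suc i))) =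
      (\<Sum>i<n. if isomorphic_gmod G R (series_factor M N i) L then 1 else 0)"
    by (intro sum.cong) simp_all
  also have "\<dots> = card {i. i < n \<and> isomorphic_gmod G R (series_factor M N i) L}"
    by (simp add: sum.If_cases lessThan_def Collect_conj_eq)
  finally show "card {i. i < n \<and> isomorphic_gmod G R (series_factor M N i) L} =
      (\<Sum>i<n. section_weight G R M L (N i) (N (Suc i)))" by simp
qed

text \<open>Jordan--Hoelder supplies the uniqueness demanded by the definite description in
  \<open>comp_mult\<close>.\<close>

lemma comp_mult_eq:
  assumes L: "group_module G R L" and C: "composition_series G R M n N"
  shows "comp_mult G R M L = card {i. i < n \<and> isomorphic_gmod G R (series_factor M N i) L}"
  unfolding comp_mult_def
proof (rule the_equality)
  show "\<exists>n' N'. composition_series G R M n' N' \<and>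
    card {i. i < n \<and> isomorphic_gmod G R (series_factor M N i) L} =
    card {i. i < n' \<and> isomorphic_gmod G R (series_factor M N' i) L}" using C by blast
next
  fix m assume "\<exists>n' N'. composition_series G R M n' N' \<and>
    m = card {i. i < n' \<and> isomorphic_gmod G R (series_factor M N' i) L}"
  then obtain n' N' where C': "composition_series G R M n' N'"
    and m: "m = card {i. i < n' \<and> isomorphic_gmod G R (series_factor M N' i) L}" by blast
  have M: "group_module G R M" using C by (simp add: composition_series_def)
  show "m = card {i. i < n \<and> isomorphic_gmod G R (series_factor M N i) L}"
    unfolding m sum_section_weight_composition_series(2)[OF L C]
      sum_section_weight_composition_series(2)[OF L C']
    by (rule jordan_hoelder[OF M L]) (use C C' sum_section_weight_composition_series(1)[OF L] in
        \<open>auto simp: composition_series_def gsubmodule_zero\<close>)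
qed

text \<open>The factors are named by indices into a family \<open>V\<close>, so that extensions
  concatenate lists. Irreducibility of the family is not part of the notion; it enters only when the
  list is read as a list of composition factors.\<close>

definition has_factors ::
    "('g, 'a) monoid_scheme \<Rightarrow> ('k, 'b) ring_scheme \<Rightarrow> ('i \<Rightarrow> ('k, 'w, 'g) gmod) \<Rightarrow>
     ('k, 'v, 'g) gmod \<Rightarrow> 'i list \<Rightarrow> bool" where
  "has_factors G R V M bs \<longleftrightarrow> group_module G R M \<and>
     (\<exists>N. N 0 = {\<zero>\<^bsub>M\<^esub>} \<and> N (length bs) = carrier M \<and>
        (\<forall>i\<le>length bs. gsubmodule G R M (N i)) \<and>
        (\<forall>i<length bs. N i \<subseteq> N (Suc i) \<and> gmod_section G R M (N i) (N (Suc i)) (V (bs ! i))))"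

theorem comp_mult_has_factors:
  assumes irr: "\<And>b. b \<in> I \<Longrightarrow> irreducible_gmod G R (V b)"
    and noniso: "\<And>b b'. b \<in> I \<Longrightarrow> b' \<in> I \<Longrightarrow> isomorphic_gmod G R (V b) (V b') \<Longrightarrow> b = b'"
    and F: "has_factors G R V M bs" and bs: "set bs \<subseteq> I" and b: "b \<in> I"
  shows "comp_mult G R M (V b) = count_list bs b"
proof -
  obtain N where M: "group_module G R M" and N: "N 0 = {\<zero>\<^bsub>M\<^esub>}" "N (length bs) = carrier M"
    and sub: "\<And>i. i \<le> length bs \<Longrightarrow> gsubmodule G R M (N i)"
    and inc: "\<And>i. i < length bs \<Longrightarrow> N i \<subseteq> N (Suc i)"
    and sec: "\<And>i. i < length bs \<Longrightarrow> gmod_section G R M (N i) (N (Suc i)) (V (bs ! i))"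
    using F unfolding has_factors_def by blast
  have gV: "group_module G R (V c)" if "c \<in> I" for c using irr[OF that] by (simp add: irreducible_gmod_def)
  have I: "bs ! i \<in> I" if "i < length bs" for i using that bs by auto
  have gf: "group_module G R (series_factor M N i)" if "i < length bs" for i
    unfolding series_factor_def using that by (intro group_module_section[OF M sub sub inc]) auto
  have iso: "isomorphic_gmod G R (series_factor M N i) (V (bs ! i))" if "i < length bs" for i
    using section_iff_isomorphic[OF M sub sub inc gV[OF I], of i i] sec[OF that] that
    by (simp add: series_factor_def)
  have "irreducible_gmod G R (series_factor M N i)" if "i < length bs" for i
    using irreducible_gmod_iso[OF irr[OF I] gf iso] that by blast
  then have C: "composition_series G R M (length bs) N"
    unfolding composition_series_def using M N sub inc by blast
  have iff: "isomorphic_gmod G R (series_factor M N i) (V b) \<longleftrightarrow> bs ! i = b" if "i < length bs" for i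
  proof
    assume "isomorphic_gmod G R (series_factor M N i) (V b)"
    then have "isomorphic_gmod G R (V (bs ! i)) (V b)"
      using isomorphic_gmod_trans isomorphic_gmod_sym[OF gf iso] that by blast
    then show "bs ! i = b" using noniso I[OF that] b by blast
  qed (use iso[OF that] in simp)
  have "comp_mult G R M (V b) = card {i. i < length bs \<and> bs ! i = b}"
    unfolding comp_mult_eq[OF gV[OF b] C] using iff by (intro arg_cong[where f = card]) auto
  also have "\<dots> = count_list bs b"
    by (simp add: count_list_eq_length_filter length_filter_conv_card eq_commute)
  finally show ?thesis .
qed

lemma has_factors_self:
  assumes "group_module G R (V b)" shows "has_factors G R V (V b) [b]"
proof -
  let ?N = "\<lambda>i::nat. if i = 0 then {\<zero>\<^bsub>V b\<^esub>} else carrier (V b)"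
  interpret group_module G R "V b" by fact
  have "gmod_section G R (V b) {\<zero>\<^bsub>V b\<^esub>} (carrier (V b)) (V b)"
    unfolding gmod_section_def gmod_hom_def by (intro exI[of _ "\<lambda>v. v"]) auto
  then show ?thesis unfolding has_factors_def
    using assms gsubmodule_zero[OF assms] gsubmodule_carrier[OF assms]
    by (intro conjI exI[of _ ?N]) auto
qed

lemma section_image:
  assumes A: "group_module G R A" and M: "group_module G R M" and f: "gmod_hom G R A M f" "inj_on f (carrier A)"
    and Y: "gsubmodule G R A Y" and sec: "gmod_section G R A U Y L"
  shows "gmod_section G R M (f ` U) (f ` Y) L"
proof -
  obtain q where q: "gmod_hom G R (A\<lparr>carrier := Y\<rparr>) L q" "q ` Y = carrier L" "{v \<in> Y. q v = \<zero>\<^bsub>L\<^esub>} = U"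
    using sec unfolding gmod_section_def by blast
  note D = gsubmoduleD[OF A Y]
  define h where "h x = q (the_inv_into (carrier A) f x)" for x
  have h: "h (f v) = q v" if "v \<in> Y" for v
    using that D(1) f(2) by (auto simp: h_def the_inv_into_f_f)
  have "h (f v \<oplus>\<^bsub>M\<^esub> f w) = h (f v) \<oplus>\<^bsub>L\<^esub> h (f w)" if "v \<in> Y" "w \<in> Y" for v w
  proof -
    have "f v \<oplus>\<^bsub>M\<^esub> f w = f (v \<oplus>\<^bsub>A\<^esub> w)"
      using gmod_homD(2)[OF f(1), of v w] that subsetD[OF D(1)] by simp
    then show ?thesis using h D(3) that gmod_homD(2)[OF q(1), of v w] by simp
  qed
  moreover have "h (c \<odot>\<^bsub>M\<^esub> f v) = c \<odot>\<^bsub>L\<^esub> h (f v)" if "c \<in> carrier R" "v \<in> Y" for c v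
  proof -
    have "c \<odot>\<^bsub>M\<^esub> f v = f (c \<odot>\<^bsub>A\<^esub> v)"
      using gmod_homD(3)[OF f(1), of c v] that subsetD[OF D(1)] by simp
    then show ?thesis using h D(4) that gmod_homD(3)[OF q(1), of c v] by simp
  qed
  moreover have "h (act M g (f v)) = act L g (h (f v))" if "g \<in> carrier G" "v \<in> Y" for g v
  proof -
    have "act M g (f v) = f (act A g v)"
      using gmod_homD(4)[OF f(1), of g v] that subsetD[OF D(1)] by simp
    then show ?thesis using h D(6) that gmod_homD(4)[OF q(1), of g v] by simp
  qed
  moreover have "h (f v) \<in> carrier L" if "v \<in> Y" for v using h that q(2) by auto
  ultimately have "gmod_hom G R (M\<lparr>carrier := f ` Y\<rparr>) L h" by (simp add: gmod_hom_def)
  moreover have "h ` f ` Y = carrier L" unfolding q(2)[symmetric] image_image using h by (intro image_cong) auto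
  moreover have "{v \<in> f ` Y. h v = \<zero>\<^bsub>L\<^esub>} = f ` U" using h q(3) by auto
  ultimately show ?thesis unfolding gmod_section_def by blast
qed

lemma section_vimage:
  assumes M: "group_module G R M" and B: "group_module G R B" and h: "gmod_hom G R M B h" "h ` carrier M = carrier B"
    and Y: "gsubmodule G R B Y" and sec: "gmod_section G R B U Y L"
  shows "gmod_section G R M {v \<in> carrier M. h v \<in> U} {v \<in> carrier M. h v \<in> Y} L"
proof -
  obtain q where q: "gmod_hom G R (B\<lparr>carrier := Y\<rparr>) L q" "q ` Y = carrier L" "{v \<in> Y. q v = \<zero>\<^bsub>L\<^esub>} = U"
    using sec unfolding gmod_section_def by blast
  let ?Y = "{v \<in> carrier M. h v \<in> Y}"
  have "gmod_hom G R (M\<lparr>carrier := ?Y\<rparr>) (B\<lparr>carrier := Y\<rparr>) h"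
    using gmod_homD[OF h(1)] by (simp add: gmod_hom_def)
  then have "gmod_hom G R (M\<lparr>carrier := ?Y\<rparr>) L (\<lambda>v. q (h v))"
    using q(1) by (rule gmod_hom_compose)
  moreover have "(\<lambda>v. q (h v)) ` ?Y = carrier L"
  proof -
    have "y \<in> h ` ?Y" if "y \<in> Y" for y
    proof -
      have "y \<in> h ` carrier M" unfolding h(2) using that gsubmoduleD(1)[OF B Y] by auto
      then show ?thesis using that by auto
    qed
    then have "h ` ?Y = Y" by blast
    then show ?thesis using q(2) by (metis image_image)
  qed
  moreover have "{v \<in> ?Y. q (h v) = \<zero>\<^bsub>L\<^esub>} = {v \<in> carrier M. h v \<in> U}" using q(3) by auto
  ultimately show ?thesis unfolding gmod_section_def by blast
qed

text \<open>The chain of \<open>A\<close> is pushed forward along \<open>f\<close> and the chain of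
  \<open>B\<close> is pulled back along \<open>h\<close>. The two fit together because the preimage
  of zero under \<open>h\<close> is the image of \<open>f\<close>.\<close>

theorem has_factors_exact:
  assumes A: "has_factors G R V A as" and B: "has_factors G R V B bs" and M: "group_module G R M"
    and f: "gmod_hom G R A M f" "inj_on f (carrier A)"
    and h: "gmod_hom G R M B h" "h ` carrier M = carrier B"
    and exact: "\<And>v. v \<in> carrier M \<Longrightarrow> h v = \<zero>\<^bsub>B\<^esub> \<longleftrightarrow> v \<in> f ` carrier A"
  shows "has_factors G R V M (as @ bs)"
proof -
  let ?n = "length as"
  obtain N where gA: "group_module G R A" and N: "N 0 = {\<zero>\<^bsub>A\<^esub>}" "N ?n = carrier A"
    and subN: "\<And>i. i \<le> ?n \<Longrightarrow> gsubmodule G R A (N i)"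
    and incN: "\<And>i. i < ?n \<Longrightarrow> N i \<subseteq> N (Suc i)"
    and secN: "\<And>i. i < ?n \<Longrightarrow> gmod_section G R A (N i) (N (Suc i)) (V (as ! i))"
    using A unfolding has_factors_def by blast
  obtain P where gB: "group_module G R B" and P: "P 0 = {\<zero>\<^bsub>B\<^esub>}" "P (length bs) = carrier B"
    and subP: "\<And>i. i \<le> length bs \<Longrightarrow> gsubmodule G R B (P i)"
    and incP: "\<And>i. i < length bs \<Longrightarrow> P i \<subseteq> P (Suc i)"
    and secP: "\<And>i. i < length bs \<Longrightarrow> gmod_section G R B (P i) (P (Suc i)) (V (bs ! i))"
    using B unfolding has_factors_def by blast
  let ?P = "\<lambda>i. {v \<in> carrier M. h v \<in> P i}"
  \<comment> \<open>At the index \<open>length as\<close> both descriptions apply and agree by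
    \<open>P0\<close>, so the second branch may be used from there on.\<close>
  define T where "T i = (if i \<le> ?n then f ` N i else ?P (i - ?n))" for i
  have fA: "f ` carrier A \<subseteq> carrier M" using gmod_homD(1)[OF f(1)] by auto
  have P0: "?P 0 = f ` N ?n" unfolding P(1) N(2) using exact fA by auto
  have T2: "T (?n + j) = ?P j" for j using P0 by (cases j) (simp_all add: T_def)
  have T1: "T i = f ` N i" if "i \<le> ?n" for i using that by (simp add: T_def)
  have "T 0 = {\<zero>\<^bsub>M\<^esub>}" using T1[of 0] N(1) gmod_hom_zero[OF gA M f(1)] by simp
  moreover have "T (length (as @ bs)) = carrier M"
    using T2[of "length bs"] P(2) gmod_homD(1)[OF h(1)] by auto
  moreover have "gsubmodule G R M (T i)" if "i \<le> length (as @ bs)" for i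
  proof (cases "i \<le> ?n")
    case True
    then show ?thesis unfolding T1[OF True] by (intro gsubmodule_image[OF gA M f(1)] subN)
  next
    case False
    then obtain j where j: "i = ?n + j" by (metis le_Suc_ex nat_le_linear)
    then show ?thesis unfolding j T2 using that by (intro gsubmodule_vimage[OF M gB h(1)] subP) (simp add: j)
  qed
  moreover have "T i \<subseteq> T (Suc i) \<and> gmod_section G R M (T i) (T (Suc i)) (V ((as @ bs) ! i))"
    if "i < length (as @ bs)" for i
  proof (cases "i < ?n")
    case True
    then show ?thesis
      using T1[of i] T1[of "Suc i"] incN[OF True] section_image[OF gA M f subN secN, of i]
      by (auto simp: nth_append)
  next
    case False
    then obtain j where j: "i = ?n + j" by (metis le_Suc_ex not_less)
    then have "j < length bs" using that by simp
    then show ?thesis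
      using T2[of j] T2[of "Suc j"] incP[of j] section_vimage[OF M gB h subP secP, of j]
      by (auto simp: nth_append j)
  qed
  ultimately show ?thesis unfolding has_factors_def using M by blast
qed

section \<open>Representations defined over the integers\<close>

locale prime_subfield = field R for R :: "'k ring" (structure) +
  fixes F :: "'k set" and p :: nat
  assumes subfield_F: "subfield F R" and card_F: "card F = p" and prime_p: "prime p"
begin

definition emb :: "int \<Rightarrow> 'k" where "emb k = [k] \<cdot> \<one>"

lemma emb_closed [simp, intro]: "emb k \<in> carrier R"
  by (simp add: emb_def)

lemma emb_0 [simp]: "emb 0 = \<zero>" and emb_1 [simp]: "emb 1 = \<one>"
  and emb_add: "emb (k + l) = emb k \<oplus> emb l" and emb_minus: "emb (- k) = \<ominus> emb k"
  and emb_mult: "emb (k * l) = emb k \<otimes> emb l"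
proof -
  show "emb 0 = \<zero>" by (simp add: emb_def add_pow_def int_pow_def)
  show "emb 1 = \<one>" by (simp add: emb_def add.int_pow_1)
  show "emb (k + l) = emb k \<oplus> emb l" by (simp add: emb_def add.int_pow_mult)
  show "emb (- k) = \<ominus> emb k" by (simp add: emb_def add.int_pow_neg)
  have "[l] \<cdot> \<one> \<in> carrier R" by simp
  then have "[k] \<cdot> \<one> \<otimes> [l] \<cdot> \<one> = [k] \<cdot> ([l] \<cdot> \<one>)"
    using add_pow_ldistr_int[of \<one> "[l] \<cdot> \<one>" k] by (simp only: one_closed l_one)
  then show "emb (k * l) = emb k \<otimes> emb l"
    by (simp add: emb_def add.int_pow_pow mult.commute)
qed

lemma emb_diff: "emb (k - l) = emb k \<ominus> emb l"
  using emb_add[of k "- l"] by (simp add: emb_minus a_minus_def)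

lemma subring_F: "subring F R"
  using subfield_F by (simp add: subfield_def subdomain_def subcring_def)

lemma emb_in_F: "emb k \<in> F"
proof -
  note F = subringE[OF subring_F]
  have nat: "emb (int n) \<in> F" for n
  proof (induction n)
    case (Suc n)
    have "emb (int (Suc n)) = \<one> \<oplus> emb (int n)" by (simp add: emb_add)
    then show ?case using F(7)[OF F(3) Suc] by simp
  qed (simp add: F(2))
  show ?thesis
  proof (cases k rule: int_cases2)
    case (nonpos n)
    then show ?thesis using F(5)[OF nat[of n]] by (simp add: emb_minus)
  qed (use nat in simp)
qed

text \<open>Lagrange's theorem in the additive group of \<open>F\<close>, which has order
  \<open>p\<close>.\<close>

lemma emb_p: "emb (int p) = \<zero>"
proof -
  have fin: "finite F" using card_F prime_p by (metis card.infinite not_prime_0)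
  have "group ((add_monoid R)\<lparr>carrier := F\<rparr>)"
    using subgroup.subgroup_is_group[OF subring.axioms(1)[OF subring_F] add.group_axioms] .
  then interpret FG: group "(add_monoid R)\<lparr>carrier := F\<rparr>" .
  have one: "\<one> \<in> F" using subringE(3)[OF subring_F] .
  have "\<one> [^]\<^bsub>(add_monoid R)\<lparr>carrier := F\<rparr>\<^esub> Coset.order ((add_monoid R)\<lparr>carrier := F\<rparr>) = \<zero>"
    using FG.pow_order_eq_1[of \<one>] one by simp
  moreover have "Coset.order ((add_monoid R)\<lparr>carrier := F\<rparr>) = p" by (simp add: Coset.order_def card_F)
  moreover have "x [^]\<^bsub>(add_monoid R)\<lparr>carrier := F\<rparr>\<^esub> (n::nat) = [n] \<cdot> x" for x n
    by (induction n) (simp_all add: add_pow_def nat_pow_def)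
  ultimately have "[p] \<cdot> \<one> = \<zero>" by simp
  then show ?thesis by (simp add: emb_def add_pow_int_ge)
qed

lemma emb_eq_0_iff: "emb k = \<zero> \<longleftrightarrow> int p dvd k"
proof
  assume "int p dvd k"
  then show "emb k = \<zero>" by (auto simp: emb_mult emb_p)
next
  assume k: "emb k = \<zero>"
  show "int p dvd k"
  proof (rule ccontr)
    assume "\<not> int p dvd k"
    then have "coprime (int p) k" using prime_p by (simp add: prime_imp_coprime)
    then obtain u v where "u * int p + v * k = 1" using bezout_int[of "int p" k] by auto
    then have "emb (u * int p + v * k) = \<one>" by simp
    then show False by (simp add: emb_add emb_mult emb_p k)
  qed
qed

lemma emb_eq_iff: "emb k = emb l \<longleftrightarrow> [k = l] (mod int p)"
proof -
  have "emb k = emb l \<longleftrightarrow> emb (k - l) = \<zero>"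
    unfolding emb_diff by (rule r_right_minus_eq[symmetric]) simp_all
  then show ?thesis by (simp add: emb_eq_0_iff cong_iff_dvd_diff)
qed

text \<open>The \<open>p\<close> residues have distinct images in \<open>F\<close>, and
  \<open>F\<close> has only \<open>p\<close> elements. Hence every entry of a group element is the
  reduction of an integer.\<close>

lemma emb_surj: "x \<in> F \<Longrightarrow> \<exists>k. x = emb k"
proof -
  assume "x \<in> F"
  have fin: "finite F" using card_F prime_p by (metis card.infinite not_prime_0)
  have "inj_on emb {0..<int p}" by (auto simp: inj_on_def emb_eq_iff cong_def)
  then have "card (emb ` {0..<int p}) = p" by (simp add: card_image)
  then have "emb ` {0..<int p} = F" using card_F fin emb_in_F by (intro card_subset_eq) auto
  then show ?thesis using \<open>x \<in> F\<close> by blast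
qed

lemma emb_sum: "finite A \<Longrightarrow> emb (\<Sum>a\<in>A. f a) = (\<Oplus>a\<in>A. emb (f a))"
  by (induction A rule: finite_induct) (simp_all add: emb_add)

text \<open>The linear map with integer matrix \<open>T\<close>, the row index in \<open>J\<close>
  coming first. With integer entries, identities between maps become congruences between sums in
  \<open>int\<close> and need no finite sums in \<open>R\<close>.\<close>

definition lin :: "('j \<Rightarrow> 'i \<Rightarrow> int) \<Rightarrow> 'i set \<Rightarrow> 'j set \<Rightarrow> ('i \<Rightarrow> 'k) \<Rightarrow> ('j \<Rightarrow> 'k)" where
  "lin T I J v = (\<lambda>j\<in>J. \<Oplus>i\<in>I. emb (T j i) \<otimes> v i)"

lemma lin_closed: "v \<in> I \<rightarrow>\<^sub>E carrier R \<Longrightarrow> lin T I J v \<in> J \<rightarrow>\<^sub>E carrier R"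
proof -
  assume v: "v \<in> I \<rightarrow>\<^sub>E carrier R"
  have "(\<Oplus>i\<in>I. emb (T j i) \<otimes> v i) \<in> carrier R" for j
    by (rule finsum_closed) (use v in \<open>simp add: Pi_def PiE_def\<close>)
  then show "lin T I J v \<in> J \<rightarrow>\<^sub>E carrier R" unfolding lin_def by simp
qed

lemma lin_add:
  assumes "v \<in> I \<rightarrow>\<^sub>E carrier R" "w \<in> I \<rightarrow>\<^sub>E carrier R"
  shows "lin T I J (\<lambda>i\<in>I. v i \<oplus> w i) = (\<lambda>j\<in>J. lin T I J v j \<oplus> lin T I J w j)"
proof (rule ext)
  have vc: "v i \<in> carrier R" if "i \<in> I" for i using assms(1) that by auto
  have wc: "w i \<in> carrier R" if "i \<in> I" for i using assms(2) that by auto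
  fix j
  have "(\<Oplus>i\<in>I. emb (T j i) \<otimes> (\<lambda>i\<in>I. v i \<oplus> w i) i) = (\<Oplus>i\<in>I. emb (T j i) \<otimes> v i \<oplus> emb (T j i) \<otimes> w i)"
    using vc wc by (intro finsum_cong') (auto simp: r_distr)
  also have "\<dots> = (\<Oplus>i\<in>I. emb (T j i) \<otimes> v i) \<oplus> (\<Oplus>i\<in>I. emb (T j i) \<otimes> w i)"
    using assms by (intro finsum_addf) auto
  finally show "lin T I J (\<lambda>i\<in>I. v i \<oplus> w i) j = (\<lambda>j\<in>J. lin T I J v j \<oplus> lin T I J w j) j"
    by (simp add: lin_def)
qed

lemma lin_smult:
  assumes "finite I" "v \<in> I \<rightarrow>\<^sub>E carrier R" "c \<in> carrier R"
  shows "lin T I J (\<lambda>i\<in>I. c \<otimes> v i) = (\<lambda>j\<in>J. c \<otimes> lin T I J v j)"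
proof (rule ext)
  have vc: "v i \<in> carrier R" if "i \<in> I" for i using assms(2) that by auto
  fix j
  have "(\<Oplus>i\<in>I. emb (T j i) \<otimes> (\<lambda>i\<in>I. c \<otimes> v i) i) = (\<Oplus>i\<in>I. c \<otimes> (emb (T j i) \<otimes> v i))"
    using vc assms(3) by (intro finsum_cong') (auto simp: m_lcomm)
  also have "\<dots> = c \<otimes> (\<Oplus>i\<in>I. emb (T j i) \<otimes> v i)"
    using assms by (intro finsum_rdistr[symmetric]) auto
  finally show "lin T I J (\<lambda>i\<in>I. c \<otimes> v i) j = (\<lambda>j\<in>J. c \<otimes> lin T I J v j) j"
    by (simp add: lin_def)
qed

lemma lin_plus:
  assumes "v \<in> I \<rightarrow>\<^sub>E carrier R"
  shows "lin (\<lambda>j i. S j i + T j i) I J v = (\<lambda>j\<in>J. lin S I J v j \<oplus> lin T I J v j)"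
proof (rule ext)
  have vc: "v i \<in> carrier R" if "i \<in> I" for i using assms that by auto
  fix j
  have "(\<Oplus>i\<in>I. emb (S j i + T j i) \<otimes> v i) = (\<Oplus>i\<in>I. emb (S j i) \<otimes> v i \<oplus> emb (T j i) \<otimes> v i)"
    using vc by (intro finsum_cong') (auto simp: l_distr emb_add)
  also have "\<dots> = (\<Oplus>i\<in>I. emb (S j i) \<otimes> v i) \<oplus> (\<Oplus>i\<in>I. emb (T j i) \<otimes> v i)"
    using assms by (intro finsum_addf) auto
  finally show "lin (\<lambda>j i. S j i + T j i) I J v j = (\<lambda>j\<in>J. lin S I J v j \<oplus> lin T I J v j) j"
    by (simp add: lin_def)
qed

lemma lin_cong:
  assumes "\<And>j i. j \<in> J \<Longrightarrow> i \<in> I \<Longrightarrow> [S j i = T j i] (mod int p)" "v \<in> I \<rightarrow>\<^sub>E carrier R"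
  shows "lin S I J v = lin T I J v"
proof (rule ext)
  fix j
  show "lin S I J v j = lin T I J v j"
  proof (cases "j \<in> J")
    case True
    have "(\<Oplus>i\<in>I. emb (S j i) \<otimes> v i) = (\<Oplus>i\<in>I. emb (T j i) \<otimes> v i)"
    proof (rule finsum_cong')
      fix i assume i: "i \<in> I"
      have "emb (S j i) = emb (T j i)" using assms(1)[OF True i] by (simp add: emb_eq_iff)
      then show "emb (S j i) \<otimes> v i = emb (T j i) \<otimes> v i" by simp
    qed (use assms(2) in auto)
    then show ?thesis by (simp add: lin_def)
  qed (simp add: lin_def)
qed

lemma lin_at:
  assumes "v \<in> I \<rightarrow>\<^sub>E carrier R" "finite I" "j \<in> J" "i0 \<in> I"
    and "\<And>i. i \<in> I \<Longrightarrow> i \<noteq> i0 \<Longrightarrow> emb (T j i) = \<zero> \<or> v i = \<zero>"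
  shows "lin T I J v j = emb (T j i0) \<otimes> v i0"
proof -
  have vc: "v i \<in> carrier R" if "i \<in> I" for i using assms(1) that by auto
  have "(\<Oplus>i\<in>I. emb (T j i) \<otimes> v i) = (\<Oplus>i\<in>I. if i0 = i then emb (T j i) \<otimes> v i else \<zero>)"
  proof (rule finsum_cong')
    fix i assume "i \<in> I"
    moreover then have "v i \<in> carrier R" using assms(1) by auto
    ultimately show "emb (T j i) \<otimes> v i = (if i0 = i then emb (T j i) \<otimes> v i else \<zero>)"
      using assms(5)[of i] by auto
  qed (use vc assms(4) in auto)
  also have "\<dots> = emb (T j i0) \<otimes> v i0"
    using vc assms(2,4) by (intro finsum_singleton) auto
  finally show ?thesis using assms(3) by (simp add: lin_def)
qed

lemma lin_zero_at:
  assumes "v \<in> I \<rightarrow>\<^sub>E carrier R" "j \<in> J"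
    and "\<And>i. i \<in> I \<Longrightarrow> emb (T j i) = \<zero> \<or> v i = \<zero>"
  shows "lin T I J v j = \<zero>"
proof -
  have "(\<Oplus>i\<in>I. emb (T j i) \<otimes> v i) = (\<Oplus>i\<in>I. \<zero>)"
  proof (rule finsum_cong')
    fix i assume "i \<in> I"
    moreover then have "v i \<in> carrier R" using assms(1) by auto
    ultimately show "emb (T j i) \<otimes> v i = \<zero>" using assms(3)[of i] by auto
  qed auto
  then show ?thesis using assms(2) by (simp add: lin_def)
qed

lemma lin_id:
  assumes "finite I" "v \<in> I \<rightarrow>\<^sub>E carrier R"
  shows "lin (\<lambda>j i. if i = j then 1 else 0) I I v = v"
proof (rule ext)
  fix j
  show "lin (\<lambda>j i. if i = j then 1 else 0) I I v j = v j"
  proof (cases "j \<in> I")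
    case True
    then have "v j \<in> carrier R" using assms(2) by auto
    then show ?thesis
      using lin_at[OF assms(2,1) True True, of "\<lambda>j i. if i = j then 1 else 0"] by simp
  next
    case False
    then show ?thesis using PiE_arb[OF assms(2) False] by (simp add: lin_def)
  qed
qed

lemma lin_comp:
  assumes "finite I" "finite J" "v \<in> I \<rightarrow>\<^sub>E carrier R"
  shows "lin S J K (lin T I J v) = lin (\<lambda>k i. \<Sum>j\<in>J. S k j * T j i) I K v"
proof (rule ext)
  fix k
  have v: "v i \<in> carrier R" if "i \<in> I" for i using that assms(3) by auto
  have row: "(\<Oplus>i\<in>I. emb (T j i) \<otimes> v i) \<in> carrier R" for j
    using v by (intro finsum_closed) auto
  have "(\<Oplus>j\<in>J. emb (S k j) \<otimes> (\<Oplus>i\<in>I. emb (T j i) \<otimes> v i)) =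
      (\<Oplus>i\<in>I. emb (\<Sum>j\<in>J. S k j * T j i) \<otimes> v i)"
    using assms(2)
  proof (induction J rule: finite_induct)
    case empty
    have "(\<Oplus>i\<in>I. \<zero> \<otimes> v i) = (\<Oplus>i\<in>I. \<zero>)" using v by (intro finsum_cong') auto
    then show ?case by simp
  next
    case (insert j J)
    have "(\<Oplus>j\<in>insert j J. emb (S k j) \<otimes> (\<Oplus>i\<in>I. emb (T j i) \<otimes> v i)) =
        emb (S k j) \<otimes> (\<Oplus>i\<in>I. emb (T j i) \<otimes> v i) \<oplus>
        (\<Oplus>i\<in>I. emb (\<Sum>j\<in>J. S k j * T j i) \<otimes> v i)"
      using insert row by (simp add: insert.IH[symmetric] Pi_def)
    also have "emb (S k j) \<otimes> (\<Oplus>i\<in>I. emb (T j i) \<otimes> v i) =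
        (\<Oplus>i\<in>I. emb (S k j) \<otimes> (emb (T j i) \<otimes> v i))"
      using v assms(1) by (intro finsum_rdistr) auto
    also have "\<dots> \<oplus> (\<Oplus>i\<in>I. emb (\<Sum>j\<in>J. S k j * T j i) \<otimes> v i) =
        (\<Oplus>i\<in>I. emb (S k j) \<otimes> (emb (T j i) \<otimes> v i) \<oplus> emb (\<Sum>j\<in>J. S k j * T j i) \<otimes> v i)"
      using v by (intro finsum_addf[symmetric]) auto
    also have "\<dots> = (\<Oplus>i\<in>I. emb (\<Sum>j\<in>insert j J. S k j * T j i) \<otimes> v i)"
    proof (rule finsum_cong')
      fix i assume "i \<in> I"
      then show "emb (S k j) \<otimes> (emb (T j i) \<otimes> v i) \<oplus> emb (\<Sum>j\<in>J. S k j * T j i) \<otimes> v i =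
          emb (\<Sum>j\<in>insert j J. S k j * T j i) \<otimes> v i"
        using insert(1,2) v by (simp add: emb_add emb_mult l_distr m_assoc)
    qed (use v in auto)
    finally show ?case .
  qed
  moreover have "(\<Oplus>j\<in>J. emb (S k j) \<otimes> lin T I J v j) =
      (\<Oplus>j\<in>J. emb (S k j) \<otimes> (\<Oplus>i\<in>I. emb (T j i) \<otimes> v i))"
    using row by (intro finsum_cong') (auto simp: lin_def)
  ultimately show "lin S J K (lin T I J v) k = lin (\<lambda>k i. \<Sum>j\<in>J. S k j * T j i) I K v k"
    by (simp add: lin_def)
qed

end

section \<open>Integer matrices and the group\<close>

type_synonym int_mat2 = "int \<times> int \<times> int \<times> int"

fun mat2_mult :: "int_mat2 \<Rightarrow> int_mat2 \<Rightarrow> int_mat2" where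
  "mat2_mult (a, b, c, d) (a', b', c', d') =
     (a * a' + b * c', a * b' + b * d', c * a' + d * c', c * b' + d * d')"

fun mat2_det :: "int_mat2 \<Rightarrow> int" where
  "mat2_det (a, b, c, d) = a * d - b * c"

lemma mat2_det_mult: "mat2_det (mat2_mult q q') = mat2_det q * mat2_det q'"
  by (cases q; cases q') (simp add: algebra_simps)

lemma mat2_mult_assoc: "mat2_mult (mat2_mult q q') q'' = mat2_mult q (mat2_mult q' q'')"
  by (cases q; cases q'; cases q'') (simp add: algebra_simps)

lemma mat2_mult_one: "mat2_mult (1, 0, 0, 1) q = q"
  by (cases q) simp

text \<open>Multiplicativity holds for all integer 2x2 matrices, whatever their determinant: a
  representation of the multiplicative monoid, which symmetric powers and their tensor products
  satisfy before any reduction modulo \<open>p\<close>.\<close>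

locale int_matrix_rep =
  fixes I :: "'i set" and A :: "int_mat2 \<Rightarrow> 'i \<Rightarrow> 'i \<Rightarrow> int"
  assumes finite_I: "finite I"
    and A_one: "i \<in> I \<Longrightarrow> j \<in> I \<Longrightarrow> A (1, 0, 0, 1) i j = (if j = i then 1 else 0)"
    and A_mult: "i \<in> I \<Longrightarrow> j \<in> I \<Longrightarrow> (\<Sum>k\<in>I. A q i k * A q' k j) = A (mat2_mult q q') i j"

lemma int_matrix_rep_tensor:
  assumes "int_matrix_rep I A" "int_matrix_rep J B"
  shows "int_matrix_rep (I \<times> J) (\<lambda>q i j. A q (fst i) (fst j) * B q (snd i) (snd j))"
proof -
  interpret A: int_matrix_rep I A by fact
  interpret B: int_matrix_rep J B by fact
  show ?thesis
  proof
    fix i j q q' assume ij: "i \<in> I \<times> J" "j \<in> I \<times> J"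
    have "(\<Sum>k\<in>I \<times> J. A q (fst i) (fst k) * B q (snd i) (snd k) *
          (A q' (fst k) (fst j) * B q' (snd k) (snd j))) =
        (\<Sum>k\<in>I. \<Sum>l\<in>J. (A q (fst i) k * A q' k (fst j)) * (B q (snd i) l * B q' l (snd j)))"
      by (simp add: sum.cartesian_product case_prod_beta mult_ac)
    also have "\<dots> = (\<Sum>k\<in>I. A q (fst i) k * A q' k (fst j)) * (\<Sum>l\<in>J. B q (snd i) l * B q' l (snd j))"
      by (simp add: sum_product)
    also have "\<dots> = A (mat2_mult q q') (fst i) (fst j) * B (mat2_mult q q') (snd i) (snd j)"
      using ij by (auto simp: A.A_mult B.A_mult)
    finally show "(\<Sum>k\<in>I \<times> J. A q (fst i) (fst k) * B q (snd i) (snd k) *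
          (A q' (fst k) (fst j) * B q' (snd k) (snd j))) =
        A (mat2_mult q q') (fst i) (fst j) * B (mat2_mult q q') (snd i) (snd j)" .
  qed (auto simp: A.finite_I B.finite_I A.A_one B.A_one split: if_splits)
qed

context prime_subfield
begin

abbreviation SLF where "SLF \<equiv> SL2 (R\<lparr>carrier := F\<rparr>)"

definition mat2_emb :: "int_mat2 \<Rightarrow> 'k \<times> 'k \<times> 'k \<times> 'k" where
  "mat2_emb = (\<lambda>(a, b, c, d). (emb a, emb b, emb c, emb d))"

text \<open>The determinant is 1 only modulo \<open>p\<close>, so the four entries of a group
  element can be lifted separately, without a correction that would make the determinant exactly
  1.\<close>

definition SLp :: "int_mat2 set" where
  "SLp = {q. [mat2_det q = 1] (mod int p)}"

text \<open>The determinant condition in \<open>SL2\<close> uses the negation of the ring restricted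
  to \<open>F\<close>, an inverse searched for inside \<open>F\<close>; as \<open>F\<close> is a
  subring it is the inverse of \<open>R\<close>.\<close>

lemma a_inv_F: "x \<in> F \<Longrightarrow> \<ominus>\<^bsub>R\<lparr>carrier := F\<rparr>\<^esub> x = \<ominus> x"
  using add.m_inv_consistent[OF subring.axioms(1)[OF subring_F], of x] by (simp add: a_inv_def)

lemma mat2_emb_mult: "mat2_emb q \<otimes>\<^bsub>SLF\<^esub> mat2_emb q' = mat2_emb (mat2_mult q q')"
  by (cases q; cases q') (simp add: SL2_def mat2_emb_def emb_add emb_mult)

lemma mat2_emb_one: "\<one>\<^bsub>SLF\<^esub> = mat2_emb (1, 0, 0, 1)"
  by (simp add: SL2_def mat2_emb_def)

lemma carrier_SLF: "carrier SLF = mat2_emb ` SLp"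
proof -
  have det: "emb a \<otimes> emb d \<ominus>\<^bsub>R\<lparr>carrier := F\<rparr>\<^esub> emb b \<otimes> emb c = \<one> \<longleftrightarrow> (a, b, c, d) \<in> SLp" for a b c d
  proof -
    have "emb a \<otimes> emb d \<ominus>\<^bsub>R\<lparr>carrier := F\<rparr>\<^esub> emb b \<otimes> emb c = emb (a * d - b * c)"
      using a_inv_F[OF emb_in_F[of "b * c"]] by (simp add: a_minus_def emb_mult emb_diff)
    then show ?thesis using emb_eq_iff[of "a * d - b * c" 1] by (simp add: SLp_def)
  qed
  show ?thesis
  proof (intro equalityI subsetI)
    fix g assume "g \<in> carrier SLF"
    then obtain x y z w where g: "g = (x, y, z, w)" "x \<in> F" "y \<in> F" "z \<in> F" "w \<in> F"
      "x \<otimes> w \<ominus>\<^bsub>R\<lparr>carrier := F\<rparr>\<^esub> y \<otimes> z = \<one>"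
      by (auto simp: SL2_def)
    obtain a b c d where e: "x = emb a" "y = emb b" "z = emb c" "w = emb d"
      using g(2-5) emb_surj by metis
    have "(a, b, c, d) \<in> SLp" using g(6) unfolding e det .
    moreover have "g = mat2_emb (a, b, c, d)" by (simp add: g(1) e mat2_emb_def)
    ultimately show "g \<in> mat2_emb ` SLp" by blast
  next
    fix g assume "g \<in> mat2_emb ` SLp"
    then obtain a b c d where "(a, b, c, d) \<in> SLp" "g = mat2_emb (a, b, c, d)" by auto
    then show "g \<in> carrier SLF" using det[of a d b c] emb_in_F by (simp add: SL2_def mat2_emb_def)
  qed
qed

lemma SLp_mult: "q \<in> SLp \<Longrightarrow> q' \<in> SLp \<Longrightarrow> mat2_mult q q' \<in> SLp"
  using cong_mult[of "mat2_det q" 1 "int p" "mat2_det q'" 1] by (simp add: SLp_def mat2_det_mult)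

lemma SLp_one: "(1, 0, 0, 1) \<in> SLp" by (simp add: SLp_def)

lemma mat2_emb_in: "q \<in> SLp \<Longrightarrow> mat2_emb q \<in> carrier SLF"
  by (simp add: carrier_SLF)

lemma mat2_emb_eq:
  "mat2_emb (a, b, c, d) = mat2_emb (a', b', c', d') \<longleftrightarrow>
    [a = a'] (mod int p) \<and> [b = b'] (mod int p) \<and> [c = c'] (mod int p) \<and> [d = d'] (mod int p)"
  by (simp add: mat2_emb_def emb_eq_iff)

lemma group_SLF: "group SLF"
proof (rule groupI)
  show "\<one>\<^bsub>SLF\<^esub> \<in> carrier SLF" by (simp add: mat2_emb_one mat2_emb_in SLp_one)
next
  fix x y assume "x \<in> carrier SLF" "y \<in> carrier SLF"
  then show "x \<otimes>\<^bsub>SLF\<^esub> y \<in> carrier SLF"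
    by (auto simp: carrier_SLF mat2_emb_mult simp del: mat2_mult.simps intro!: imageI SLp_mult)
next
  fix x y z assume "x \<in> carrier SLF" "y \<in> carrier SLF" "z \<in> carrier SLF"
  then show "x \<otimes>\<^bsub>SLF\<^esub> y \<otimes>\<^bsub>SLF\<^esub> z = x \<otimes>\<^bsub>SLF\<^esub> (y \<otimes>\<^bsub>SLF\<^esub> z)"
    by (auto simp: carrier_SLF mat2_emb_mult mat2_mult_assoc simp del: mat2_mult.simps)
next
  fix x assume "x \<in> carrier SLF"
  then show "\<one>\<^bsub>SLF\<^esub> \<otimes>\<^bsub>SLF\<^esub> x = x"
    by (auto simp: carrier_SLF mat2_emb_mult mat2_emb_one mat2_mult_one simp del: mat2_mult.simps)
next
  fix x assume "x \<in> carrier SLF"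
  then obtain a b c d where q: "(a, b, c, d) \<in> SLp" "x = mat2_emb (a, b, c, d)"
    by (auto simp: carrier_SLF)
  \<comment> \<open>The adjugate matrix is the inverse, because the determinant is 1 modulo
    \<open>p\<close>.\<close>
  have "(d, - b, - c, a) \<in> SLp" using q(1) by (simp add: SLp_def mult.commute)
  moreover have "mat2_emb (d, - b, - c, a) \<otimes>\<^bsub>SLF\<^esub> x = \<one>\<^bsub>SLF\<^esub>"
    using q unfolding q(2) mat2_emb_mult mat2_emb_one
    by (simp add: mat2_emb_eq SLp_def mult.commute)
  ultimately show "\<exists>y\<in>carrier SLF. y \<otimes>\<^bsub>SLF\<^esub> x = \<one>\<^bsub>SLF\<^esub>" using mat2_emb_in by blast
qed

section \<open>Modules realized by integer matrices\<close>

definition realizes :: "('k, 'k \<times> 'k \<times> 'k \<times> 'k, 'i) matrep \<Rightarrow> 'i set \<Rightarrow> (int_mat2 \<Rightarrow> 'i \<Rightarrow> 'i \<Rightarrow> int) \<Rightarrow> bool" where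
  "realizes V I A \<longleftrightarrow> int_matrix_rep I A \<and> basis V = I \<and>
     (\<forall>q. \<forall>i\<in>I. \<forall>j\<in>I. entry V (mat2_emb q) i j = emb (A q i j))"

lemma realizesD:
  assumes "realizes V I A"
  shows "int_matrix_rep I A" "basis V = I"
    and "i \<in> I \<Longrightarrow> j \<in> I \<Longrightarrow> entry V (mat2_emb q) i j = emb (A q i j)"
  using assms unfolding realizes_def by blast+

lemma realizes_tensor:
  assumes "realizes V I A" "realizes W J B"
  shows "realizes (tensor_rep R V W) (I \<times> J) (\<lambda>q i j. A q (fst i) (fst j) * B q (snd i) (snd j))"
  using int_matrix_rep_tensor[OF realizesD(1)[OF assms(1)] realizesD(1)[OF assms(2)]]
    realizesD(2,3)[OF assms(1)] realizesD(2,3)[OF assms(2)]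
  unfolding realizes_def by (auto simp: tensor_rep_def emb_mult simp del: split_paired_All)

lemma gmod_of_sel:
  "carrier (gmod_of R V) = basis V \<rightarrow>\<^sub>E carrier R"
  "\<zero>\<^bsub>gmod_of R V\<^esub> = (\<lambda>i\<in>basis V. \<zero>)"
  "v \<oplus>\<^bsub>gmod_of R V\<^esub> w = (\<lambda>i\<in>basis V. v i \<oplus> w i)"
  "c \<odot>\<^bsub>gmod_of R V\<^esub> v = (\<lambda>i\<in>basis V. c \<otimes> v i)"
  by (simp_all add: gmod_of_def)

lemma act_gmod_of:
  assumes "realizes V I A" "v \<in> I \<rightarrow>\<^sub>E carrier R"
  shows "act (gmod_of R V) (mat2_emb q) v = lin (A q) I I v"
proof (rule ext)
  fix i
  have B: "basis V = I" using assms(1) by (simp add: realizes_def)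
  show "act (gmod_of R V) (mat2_emb q) v i = lin (A q) I I v i"
  proof (cases "i \<in> I")
    case True
    have "(\<Oplus>j\<in>I. entry V (mat2_emb q) i j \<otimes> v j) = (\<Oplus>j\<in>I. emb (A q i j) \<otimes> v j)"
    proof (rule finsum_cong')
      fix j assume "j \<in> I"
      then have "entry V (mat2_emb q) i j = emb (A q i j)" using realizesD(3)[OF assms(1)] True by simp
      then show "entry V (mat2_emb q) i j \<otimes> v j = emb (A q i j) \<otimes> v j" by simp
    qed (use assms(2) in \<open>simp_all add: Pi_def PiE_def\<close>)
    then show ?thesis using True by (simp add: gmod_of_def lin_def B)
  qed (simp add: gmod_of_def lin_def B)
qed

lemma group_module_gmod_of:
  assumes V: "realizes V I A"
  shows "group_module SLF R (gmod_of R V)"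
proof -
  let ?M = "gmod_of R V"
  interpret A: int_matrix_rep I A using V by (simp add: realizes_def)
  have B: "basis V = I" using V by (simp add: realizes_def)
  note sel = gmod_of_sel[of V, unfolded B]
  have val: "v i \<in> carrier R" if "v \<in> I \<rightarrow>\<^sub>E carrier R" "i \<in> I" for v i using PiE_mem[OF that] .
  have ext: "v = w" if "v \<in> I \<rightarrow>\<^sub>E carrier R" "w \<in> I \<rightarrow>\<^sub>E carrier R" "\<And>i. i \<in> I \<Longrightarrow> v i = w i" for v w
    using PiE_ext[OF that] .
  have add_cl: "(\<lambda>i\<in>I. v i \<oplus> w i) \<in> I \<rightarrow>\<^sub>E carrier R"
    if "v \<in> I \<rightarrow>\<^sub>E carrier R" "w \<in> I \<rightarrow>\<^sub>E carrier R" for v w using val that by simp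
  have smult_cl: "(\<lambda>i\<in>I. c \<otimes> v i) \<in> I \<rightarrow>\<^sub>E carrier R"
    if "c \<in> carrier R" "v \<in> I \<rightarrow>\<^sub>E carrier R" for c v using val that by simp
  have "abelian_group ?M"
  proof (rule abelian_groupI, unfold sel)
    fix v assume v: "v \<in> I \<rightarrow>\<^sub>E carrier R"
    show "(\<lambda>i\<in>I. (\<lambda>i\<in>I. \<zero>) i \<oplus> v i) = v"
      using v val by (intro ext) simp_all
    have "(\<lambda>i\<in>I. \<ominus> v i) \<in> I \<rightarrow>\<^sub>E carrier R" using v val by simp
    moreover have "(\<lambda>i\<in>I. (\<lambda>i\<in>I. \<ominus> v i) i \<oplus> v i) = (\<lambda>i\<in>I. \<zero>)"
      using v val by (intro restrict_ext) (simp add: l_neg)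
    ultimately show "\<exists>y\<in>I \<rightarrow>\<^sub>E carrier R. (\<lambda>i\<in>I. y i \<oplus> v i) = (\<lambda>i\<in>I. \<zero>)" by blast
  next
    fix v w assume vw: "v \<in> I \<rightarrow>\<^sub>E carrier R" "w \<in> I \<rightarrow>\<^sub>E carrier R"
    then show "(\<lambda>i\<in>I. v i \<oplus> w i) \<in> I \<rightarrow>\<^sub>E carrier R" by (rule add_cl)
    show "(\<lambda>i\<in>I. v i \<oplus> w i) = (\<lambda>i\<in>I. w i \<oplus> v i)"
      using vw val by (intro restrict_ext) (simp add: a_comm)
    fix u assume u: "u \<in> I \<rightarrow>\<^sub>E carrier R"
    show "(\<lambda>i\<in>I. (\<lambda>i\<in>I. v i \<oplus> w i) i \<oplus> u i) = (\<lambda>i\<in>I. v i \<oplus> (\<lambda>i\<in>I. w i \<oplus> u i) i)"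
      using vw u val by (intro restrict_ext) (simp add: a_assoc)
  qed simp
  then have mod: "module R ?M"
  proof (intro moduleI is_cring, unfold sel)
    fix c v assume cv: "c \<in> carrier R" "v \<in> I \<rightarrow>\<^sub>E carrier R"
    then show "(\<lambda>i\<in>I. c \<otimes> v i) \<in> I \<rightarrow>\<^sub>E carrier R" by (rule smult_cl)
    fix d assume d: "d \<in> carrier R"
    show "(\<lambda>i\<in>I. (c \<oplus> d) \<otimes> v i) = (\<lambda>i\<in>I. (\<lambda>i\<in>I. c \<otimes> v i) i \<oplus> (\<lambda>i\<in>I. d \<otimes> v i) i)"
      using cv d val by (intro restrict_ext) (simp add: l_distr)
    show "(\<lambda>i\<in>I. c \<otimes> d \<otimes> v i) = (\<lambda>i\<in>I. c \<otimes> (\<lambda>i\<in>I. d \<otimes> v i) i)"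
      using cv d val by (intro restrict_ext) (simp add: m_assoc)
  next
    fix c v w assume cv: "c \<in> carrier R" "v \<in> I \<rightarrow>\<^sub>E carrier R" "w \<in> I \<rightarrow>\<^sub>E carrier R"
    show "(\<lambda>i\<in>I. c \<otimes> (\<lambda>i\<in>I. v i \<oplus> w i) i) = (\<lambda>i\<in>I. (\<lambda>i\<in>I. c \<otimes> v i) i \<oplus> (\<lambda>i\<in>I. c \<otimes> w i) i)"
      using cv val by (intro restrict_ext) (simp add: r_distr)
  next
    fix v assume v: "v \<in> I \<rightarrow>\<^sub>E carrier R"
    show "(\<lambda>i\<in>I. \<one> \<otimes> v i) = v" using v val by (intro ext) simp_all
  qed
  note act = act_gmod_of[OF V]
  have "group_module_axioms SLF R ?M"
  proof (rule group_module_axioms.intro, unfold sel carrier_SLF mat2_emb_one)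
    fix g v assume g: "g \<in> mat2_emb ` SLp" and v: "v \<in> I \<rightarrow>\<^sub>E carrier R"
    from g obtain q where q: "g = mat2_emb q" "q \<in> SLp" by blast
    show "act ?M g v \<in> I \<rightarrow>\<^sub>E carrier R" unfolding q act[OF v] using v by (rule lin_closed)
    fix w assume w: "w \<in> I \<rightarrow>\<^sub>E carrier R"
    show "act ?M g (\<lambda>i\<in>I. v i \<oplus> w i) = (\<lambda>i\<in>I. act ?M g v i \<oplus> act ?M g w i)"
      unfolding q act[OF v] act[OF w] act[OF add_cl[OF v w]] by (rule lin_add[OF v w])
  next
    fix g c v assume g: "g \<in> mat2_emb ` SLp" and c: "c \<in> carrier R" and v: "v \<in> I \<rightarrow>\<^sub>E carrier R"
    from g obtain q where q: "g = mat2_emb q" "q \<in> SLp" by blast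
    show "act ?M g (\<lambda>i\<in>I. c \<otimes> v i) = (\<lambda>i\<in>I. c \<otimes> act ?M g v i)"
      unfolding q act[OF v] act[OF smult_cl[OF c v]] by (rule lin_smult[OF A.finite_I v c])
  next
    fix v assume v: "v \<in> I \<rightarrow>\<^sub>E carrier R"
    have "lin (A (1, 0, 0, 1)) I I v = lin (\<lambda>j i. if i = j then 1 else 0) I I v"
      using v by (intro lin_cong) (simp_all add: A.A_one)
    then show "act ?M (mat2_emb (1, 0, 0, 1)) v = v"
      unfolding act[OF v] using lin_id[OF A.finite_I v] by simp
  next
    fix g h v assume g: "g \<in> mat2_emb ` SLp" "h \<in> mat2_emb ` SLp" and v: "v \<in> I \<rightarrow>\<^sub>E carrier R"
    then obtain q q' where q: "g = mat2_emb q" "h = mat2_emb q'" by blast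
    have "lin (A (mat2_mult q q')) I I v = lin (\<lambda>i j. \<Sum>k\<in>I. A q i k * A q' k j) I I v"
      using v by (intro lin_cong) (simp_all add: A.A_mult)
    then show "act ?M (g \<otimes>\<^bsub>SLF\<^esub> h) v = act ?M g (act ?M h v)"
      unfolding q mat2_emb_mult act[OF v] act[OF lin_closed[OF v]]
      by (simp add: lin_comp[OF A.finite_I A.finite_I v])
  qed
  then show ?thesis using mod group_SLF by (intro group_module.intro)
qed

end

section \<open>Symmetric powers\<close>

fun sym_poly :: "nat \<Rightarrow> nat \<Rightarrow> int_mat2 \<Rightarrow> int poly" where
  "sym_poly n j (a, b, c, d) = [:a, c:] ^ (n - j) * [:b, d:] ^ j"

definition sym_mat :: "nat \<Rightarrow> int_mat2 \<Rightarrow> nat \<Rightarrow> nat \<Rightarrow> int" where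
  "sym_mat n q i j = coeff (sym_poly n j q) i"

lemma degree_linear_powers: "degree ([:s, t:] ^ k * [:s', t':] ^ j) \<le> k + j"
proof -
  have "degree ([:x, y:] ^ m) \<le> m" for x y and m
    using degree_power_le[of "[:x, y:]" m] degree_pCons_le[of x "[:y:]"]
    by (metis degree_pCons_0 le_trans mult.commute mult.right_neutral mult_le_mono2 One_nat_def)
  then show ?thesis by (meson add_mono degree_mult_le le_trans)
qed

lemma sym_mat_eq_0:
  assumes "n < i" "j \<le> n" shows "sym_mat n q i j = 0"
proof (cases q)
  case (fields a b c d)
  have "degree ([:a, c:] ^ (n - j) * [:b, d:] ^ j) < i"
    using degree_linear_powers[of a c "n - j" b d j] assms by simp
  then show ?thesis by (simp add: fields sym_mat_def coeff_eq_0)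
qed

lemma smult_sum_right: "smult c (\<Sum>i\<in>S. f i) = (\<Sum>i\<in>S. smult c (f i))"
  by (induction S rule: infinite_finite_induct) (simp_all add: smult_add_right)

text \<open>Substitution of \<open>x\<close> and \<open>y\<close> into a binary form of degree
  \<open>n\<close> stored as a polynomial in one variable. The degree is a separate argument because
  a form may be divisible by the variable that has been set to 1.\<close>

definition form_subst :: "nat \<Rightarrow> int poly \<Rightarrow> int poly \<Rightarrow> int poly \<Rightarrow> int poly" where
  "form_subst n f x y = (\<Sum>i\<le>n. smult (coeff f i) (x ^ (n - i) * y ^ i))"

text \<open>Substitution respects multiplication by one linear factor. This suffices, since the
  images of monomials are products of linear forms.\<close>

lemma form_subst_linear:
  assumes "degree f \<le> n"
  shows "form_subst (Suc n) ([:s, t:] * f) x y = (smult s x + smult t y) * form_subst n f x y"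
proof -
  have c: "coeff ([:s, t:] * f) i = s * coeff f i + coeff (pCons 0 (smult t f)) i" for i
    by simp
  have x: "(\<Sum>i\<le>Suc n. smult (coeff f i) (x ^ (Suc n - i) * y ^ i)) = x * form_subst n f x y"
  proof -
    have "coeff f (Suc n) = 0" using assms by (intro coeff_eq_0) simp
    moreover have "(\<Sum>i\<le>n. smult (coeff f i) (x ^ (Suc n - i) * y ^ i)) =
        (\<Sum>i\<le>n. x * smult (coeff f i) (x ^ (n - i) * y ^ i))"
      by (rule sum.cong) (simp_all add: Suc_diff_le mult.assoc)
    ultimately show ?thesis by (simp add: form_subst_def sum_distrib_left)
  qed
  have y: "(\<Sum>i\<le>Suc n. smult (coeff (pCons 0 (smult t f)) i) (x ^ (Suc n - i) * y ^ i)) =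
      smult t (y * form_subst n f x y)"
    unfolding form_subst_def
    by (subst sum.atMost_Suc_shift) (simp add: sum_distrib_left smult_sum_right mult_ac)
  have "form_subst (Suc n) ([:s, t:] * f) x y =
      smult s (\<Sum>i\<le>Suc n. smult (coeff f i) (x ^ (Suc n - i) * y ^ i)) +
      (\<Sum>i\<le>Suc n. smult (coeff (pCons 0 (smult t f)) i) (x ^ (Suc n - i) * y ^ i))"
    unfolding form_subst_def c by (simp only: smult_sum_right smult_smult smult_add_left sum.distrib)
  then show ?thesis unfolding x y by (simp add: algebra_simps)
qed

lemma form_subst_powers:
  "form_subst (k + j) ([:s, t:] ^ k * [:s', t':] ^ j) x y =
    (smult s x + smult t y) ^ k * (smult s' x + smult t' y) ^ j"
proof (induction k)
  case 0
  show ?case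
  proof (induction j)
    case 0
    show ?case by (simp add: form_subst_def)
  next
    case (Suc j)
    have "degree ([:s', t':] ^ j) \<le> j" using degree_linear_powers[of 1 0 0 s' t' j] by simp
    from form_subst_linear[OF this, of s' t' x y] show ?case using Suc by simp
  qed
next
  case (Suc k)
  from form_subst_linear[OF degree_linear_powers[of s t k s' t' j], of s t x y]
  show ?case using Suc by (simp only: add_Suc power_Suc mult.assoc)
qed

text \<open>The action of a product is a substitution of linear forms into the image under the
  second factor; comparing coefficients gives the multiplicativity of
  \<open>sym_mat\<close>.\<close>

lemma sym_poly_mult:
  assumes "j \<le> n"
  shows "sym_poly n j (mat2_mult (a, b, c, d) q') = form_subst n (sym_poly n j q') [:a, c:] [:b, d:]"
proof (cases q')
  case (fields a' b' c' d')
  show ?thesis unfolding fields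
    using form_subst_powers[of "n - j" j a' c' b' d' "[:a, c:]" "[:b, d:]"] assms
    by (simp add: mult.commute)
qed

lemma int_matrix_rep_sym: "int_matrix_rep {0..n} (sym_mat n)"
proof
  fix i j assume ij: "i \<in> {0..n}" "j \<in> {0..n}"
  have "sym_poly n j (1, 0, 0, 1) = monom 1 j" by (simp add: monom_altdef pCons_one)
  then show "sym_mat n (1, 0, 0, 1) i j = (if j = i then 1 else 0)" by (simp add: sym_mat_def)
next
  fix i j and q q' :: int_mat2 assume ij: "i \<in> {0..n}" "j \<in> {0..n}"
  obtain a b c d where q: "q = (a, b, c, d)" by (cases q)
  have "sym_mat n (mat2_mult q q') i j =
      (\<Sum>k\<le>n. coeff (sym_poly n j q') k * coeff ([:a, c:] ^ (n - k) * [:b, d:] ^ k) i)"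
    unfolding sym_mat_def q using ij by (simp add: sym_poly_mult form_subst_def coeff_sum del: mat2_mult.simps)
  also have "\<dots> = (\<Sum>k\<in>{0..n}. sym_mat n q i k * sym_mat n q' k j)"
    unfolding atLeast0AtMost by (intro sum.cong) (simp_all add: sym_mat_def q mult.commute)
  finally show "(\<Sum>k\<in>{0..n}. sym_mat n q i k * sym_mat n q' k j) = sym_mat n (mat2_mult q q') i j" by simp
qed simp

context prime_subfield
begin

text \<open>The bridge from polynomials over \<open>int\<close> to the polynomial ring
  \<open>UP R\<close> in which the entries of \<open>sym_rep\<close> are defined: \<open>P\<close>
  is the reduction of \<open>f\<close>.\<close>

definition up_reduces :: "int poly \<Rightarrow> (nat \<Rightarrow> 'k) \<Rightarrow> bool" where
  "up_reduces f P \<longleftrightarrow> P \<in> carrier (UP R) \<and> (\<forall>i. up_ring.coeff (UP R) P i = emb (poly.coeff f i))"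

lemma up_reduces_mult:
  assumes "up_reduces f P" "up_reduces g Q"
  shows "up_reduces (f * g) (P \<otimes>\<^bsub>UP R\<^esub> Q)"
proof -
  interpret UP: UP_cring R "UP R" by unfold_locales
  have c: "P \<in> carrier (UP R)" "Q \<in> carrier (UP R)" using assms by (auto simp: up_reduces_def)
  have "up_ring.coeff (UP R) (P \<otimes>\<^bsub>UP R\<^esub> Q) n = emb (poly.coeff (f * g) n)" for n
  proof -
    have "up_ring.coeff (UP R) (P \<otimes>\<^bsub>UP R\<^esub> Q) n =
        (\<Oplus>i\<in>{..n}. up_ring.coeff (UP R) P i \<otimes> up_ring.coeff (UP R) Q (n - i))"
      using c by (rule UP.coeff_mult)
    also have "\<dots> = emb (poly.coeff (f * g) n)"
      using assms by (simp add: up_reduces_def Polynomial.coeff_mult atMost_atLeast0 emb_sum emb_mult)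
    finally show ?thesis .
  qed
  then show ?thesis using c by (simp add: up_reduces_def)
qed

lemma up_reduces_power:
  assumes "up_reduces f P" shows "up_reduces (f ^ n) (P [^]\<^bsub>UP R\<^esub> n)"
proof (induction n)
  case 0
  interpret UP: UP_cring R "UP R" by unfold_locales
  show ?case by (auto simp: up_reduces_def)
next
  case (Suc n)
  interpret UP: UP_cring R "UP R" by unfold_locales
  show ?case using up_reduces_mult[OF Suc assms] by (simp add: mult.commute)
qed

lemma up_reduces_linear: "up_reduces [:s, t:] (linear_poly R (emb s) (emb t))"
proof -
  interpret UP: UP_cring R "UP R" by unfold_locales
  show ?thesis
    by (auto simp: up_reduces_def linear_poly_def Polynomial.coeff_pCons split: nat.split)
qed

lemma realizes_sym: "realizes (sym_rep R n) {0..n} (sym_mat n)"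
proof -
  have "entry (sym_rep R n) (mat2_emb q) i j = emb (sym_mat n q i j)" for q i j
  proof (cases q)
    case (fields a b c d)
    show ?thesis
      using up_reduces_mult[OF up_reduces_power[OF up_reduces_linear[of a c], of "n - j"]
          up_reduces_power[OF up_reduces_linear[of b d], of j]]
      by (simp add: fields sym_rep_def mat2_emb_def up_reduces_def sym_mat_def)
  qed
  then show ?thesis using int_matrix_rep_sym by (simp add: realizes_def sym_rep_def)
qed

section \<open>Equivariant maps and exact sequences from integer matrices\<close>

lemma lin_restrict: "(\<lambda>j\<in>J. lin T I J v j) = lin T I J v"
  by (rule ext) (simp add: lin_def)

lemma lin_gmod_homI:
  assumes V: "realizes V I A" and W: "realizes W J B"
    and eq: "\<And>g v. g \<in> carrier SLF \<Longrightarrow> v \<in> I \<rightarrow>\<^sub>E carrier R \<Longrightarrow>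
      lin T I J (act (gmod_of R V) g v) = act (gmod_of R W) g (lin T I J v)"
  shows "gmod_hom SLF R (gmod_of R V) (gmod_of R W) (lin T I J)"
proof -
  have fin: "finite I" using realizesD(1)[OF V] by (simp add: int_matrix_rep_def)
  show ?thesis
    unfolding gmod_hom_def gmod_of_sel realizesD(2)[OF V] realizesD(2)[OF W]
    by (intro conjI ballI) (simp_all add: lin_closed lin_add lin_smult[OF fin] eq)
qed

text \<open>Stated for a single \<open>q\<close>, so that equivariance can also be verified on
  generators alone.\<close>

lemma lin_equivariant:
  assumes V: "realizes V I A" and W: "realizes W J B" and v: "v \<in> I \<rightarrow>\<^sub>E carrier R"
    and T: "\<And>i j. i \<in> I \<Longrightarrow> j \<in> J \<Longrightarrow>
      [(\<Sum>k\<in>I. T j k * A q k i) = (\<Sum>k\<in>J. B q j k * T k i)] (mod int p)"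
  shows "lin T I J (act (gmod_of R V) (mat2_emb q) v) = act (gmod_of R W) (mat2_emb q) (lin T I J v)"
proof -
  have fin: "finite I" "finite J"
    using realizesD(1)[OF V] realizesD(1)[OF W] by (simp_all add: int_matrix_rep_def)
  show ?thesis
    unfolding act_gmod_of[OF V v] act_gmod_of[OF W lin_closed[OF v]]
      lin_comp[OF fin(1) fin(1) v] lin_comp[OF fin v]
    using T v by (intro lin_cong) simp_all
qed

lemma lin_gmod_hom_matrix:
  assumes V: "realizes V I A" and W: "realizes W J B"
    and T: "\<And>q i j. q \<in> SLp \<Longrightarrow> i \<in> I \<Longrightarrow> j \<in> J \<Longrightarrow>
      [(\<Sum>k\<in>I. T j k * A q k i) = (\<Sum>k\<in>J. B q j k * T k i)] (mod int p)"
  shows "gmod_hom SLF R (gmod_of R V) (gmod_of R W) (lin T I J)"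
  by (rule lin_gmod_homI[OF V W]) (use lin_equivariant[OF V W _ T] carrier_SLF in auto)

text \<open>An integral splitting modulo \<open>p\<close> certifies exactness of a sequence of linear maps.\<close>

lemma has_factors_split:
  assumes A: "realizes VA I A" and M: "realizes VM J M" and B: "realizes VB K B"
    and f: "gmod_hom SLF R (gmod_of R VA) (gmod_of R VM) (lin f I J)"
    and h: "gmod_hom SLF R (gmod_of R VM) (gmod_of R VB) (lin h J K)"
    and tf: "\<And>i i'. i \<in> I \<Longrightarrow> i' \<in> I \<Longrightarrow> [(\<Sum>j\<in>J. t i j * f j i') = (if i' = i then 1 else 0)] (mod int p)"
    and hs: "\<And>k k'. k \<in> K \<Longrightarrow> k' \<in> K \<Longrightarrow> [(\<Sum>j\<in>J. h k j * s j k') = (if k' = k then 1 else 0)] (mod int p)"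
    and hf: "\<And>k i. k \<in> K \<Longrightarrow> i \<in> I \<Longrightarrow> [(\<Sum>j\<in>J. h k j * f j i) = 0] (mod int p)"
    and id: "\<And>j j'. j \<in> J \<Longrightarrow> j' \<in> J \<Longrightarrow>
      [(\<Sum>i\<in>I. f j i * t i j') + (\<Sum>k\<in>K. s j k * h k j') = (if j' = j then 1 else 0)] (mod int p)"
    and facA: "has_factors SLF R L (gmod_of R VA) as" and facB: "has_factors SLF R L (gmod_of R VB) bs"
  shows "has_factors SLF R L (gmod_of R VM) (as @ bs)"
proof -
  have fin: "finite I" "finite J" "finite K"
    using realizesD(1)[OF A] realizesD(1)[OF M] realizesD(1)[OF B] by (simp_all add: int_matrix_rep_def)
  note selA = gmod_of_sel[of VA, unfolded realizesD(2)[OF A]]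
    and selM = gmod_of_sel[of VM, unfolded realizesD(2)[OF M]]
    and selB = gmod_of_sel[of VB, unfolded realizesD(2)[OF B]]
  have tf_v: "lin t J I (lin f I J v) = v" if v: "v \<in> I \<rightarrow>\<^sub>E carrier R" for v
  proof -
    have "lin t J I (lin f I J v) = lin (\<lambda>i i'. if i' = i then 1 else 0) I I v"
      unfolding lin_comp[OF fin(1,2) v] using tf v by (intro lin_cong)
    then show ?thesis using lin_id[OF fin(1) v] by simp
  qed
  have hs_v: "lin h J K (lin s K J v) = v" if v: "v \<in> K \<rightarrow>\<^sub>E carrier R" for v
  proof -
    have "lin h J K (lin s K J v) = lin (\<lambda>i i'. if i' = i then 1 else 0) K K v"
      unfolding lin_comp[OF fin(3,2) v] using hs v by (intro lin_cong)
    then show ?thesis using lin_id[OF fin(3) v] by simp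
  qed
  have hf_v: "lin h J K (lin f I J v) = (\<lambda>k\<in>K. \<zero>)" if v: "v \<in> I \<rightarrow>\<^sub>E carrier R" for v
  proof -
    have "lin h J K (lin f I J v) = lin (\<lambda>k i. 0) I K v"
      unfolding lin_comp[OF fin(1,2) v] using hf v by (intro lin_cong)
    moreover have "lin (\<lambda>k i. 0) I K v = (\<lambda>k\<in>K. \<zero>)"
    proof (rule ext)
      fix k show "lin (\<lambda>k i. 0) I K v k = (\<lambda>k\<in>K. \<zero>) k"
        using lin_zero_at[OF v, of k K "\<lambda>k i. 0"] by (cases "k \<in> K") (simp_all add: lin_def)
    qed
    ultimately show ?thesis by simp
  qed
  have id_v: "(\<lambda>j\<in>J. lin f I J (lin t J I v) j \<oplus> lin s K J (lin h J K v) j) = v"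
    if v: "v \<in> J \<rightarrow>\<^sub>E carrier R" for v
  proof -
    have "(\<lambda>j\<in>J. lin f I J (lin t J I v) j \<oplus> lin s K J (lin h J K v) j) =
        lin (\<lambda>j i'. if i' = j then 1 else 0) J J v"
      unfolding lin_comp[OF fin(2,1) v] lin_comp[OF fin(2,3) v] lin_plus[OF v, symmetric]
      using id v by (intro lin_cong)
    then show ?thesis using lin_id[OF fin(2) v] by simp
  qed
  show ?thesis
  proof (rule has_factors_exact[OF facA facB group_module_gmod_of[OF M] f _ h])
    show "inj_on (lin f I J) (carrier (gmod_of R VA))"
      using tf_v unfolding selA by (intro inj_on_inverseI)
    show "lin h J K ` carrier (gmod_of R VM) = carrier (gmod_of R VB)"
      unfolding selM selB
    proof
      show "lin h J K ` (J \<rightarrow>\<^sub>E carrier R) \<subseteq> K \<rightarrow>\<^sub>E carrier R" using lin_closed by (intro image_subsetI)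
      show "K \<rightarrow>\<^sub>E carrier R \<subseteq> lin h J K ` (J \<rightarrow>\<^sub>E carrier R)"
      proof
        fix v assume v: "v \<in> K \<rightarrow>\<^sub>E carrier R"
        show "v \<in> lin h J K ` (J \<rightarrow>\<^sub>E carrier R)"
          by (rule image_eqI[of _ _ "lin s K J v"]) (use hs_v[OF v] lin_closed[OF v] in simp_all)
      qed
    qed
    fix v assume "v \<in> carrier (gmod_of R VM)"
    then have v: "v \<in> J \<rightarrow>\<^sub>E carrier R" by (simp add: selM)
    show "lin h J K v = \<zero>\<^bsub>gmod_of R VB\<^esub> \<longleftrightarrow> v \<in> lin f I J ` carrier (gmod_of R VA)"
      unfolding selA selB
    proof
      assume "v \<in> lin f I J ` (I \<rightarrow>\<^sub>E carrier R)"
      then show "lin h J K v = (\<lambda>k\<in>K. \<zero>)" using hf_v by auto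
    next
      assume z: "lin h J K v = (\<lambda>k\<in>K. \<zero>)"
      \<comment> \<open>The splitting writes v = f(t v) + s(h v); on the kernel of \<open>h\<close>
        the second term drops out, and t v is the preimage under \<open>f\<close>.\<close>
      let ?w = "lin t J I v"
      have w: "?w \<in> I \<rightarrow>\<^sub>E carrier R" using lin_closed[OF v] .
      have zK: "(\<lambda>k\<in>K. \<zero>) \<in> K \<rightarrow>\<^sub>E carrier R" by simp
      have "lin s K J (\<lambda>k\<in>K. \<zero>) j = \<zero>" if "j \<in> J" for j
        using lin_zero_at[OF zK that, of s] by simp
      then have "(\<lambda>j\<in>J. lin f I J ?w j \<oplus> lin s K J (lin h J K v) j) = (\<lambda>j\<in>J. lin f I J ?w j)"
        unfolding z by (intro restrict_ext) (simp add: PiE_mem[OF lin_closed[OF w]])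
      also have "\<dots> = lin f I J ?w" by (rule lin_restrict)
      finally have "v = lin f I J ?w" using id_v[OF v] by simp
      then show "v \<in> lin f I J ` (I \<rightarrow>\<^sub>E carrier R)" using w by (rule image_eqI)
    qed
  qed
qed

lemma has_factors_iso:
  assumes A: "realizes VA I A" and M: "realizes VM J M"
    and f: "gmod_hom SLF R (gmod_of R VA) (gmod_of R VM) (lin f I J)"
    and b: "bij_betw (lin f I J) (I \<rightarrow>\<^sub>E carrier R) (J \<rightarrow>\<^sub>E carrier R)"
    and fac: "has_factors SLF R L (gmod_of R VA) as"
  shows "has_factors SLF R L (gmod_of R VM) as"
proof -
  let ?A = "gmod_of R VA" and ?M = "gmod_of R VM"
  have gA: "group_module SLF R ?A" and gM: "group_module SLF R ?M"
    using group_module_gmod_of[OF A] group_module_gmod_of[OF M] by auto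
  have inj: "inj_on (lin f I J) (carrier ?A)" and im: "lin f I J ` carrier ?A = carrier ?M"
    using b by (simp_all add: bij_betw_def gmod_of_sel realizesD(2)[OF A] realizesD(2)[OF M])
  obtain N where N: "N 0 = {\<zero>\<^bsub>?A\<^esub>}" "N (length as) = carrier ?A"
    and sub: "\<And>i. i \<le> length as \<Longrightarrow> gsubmodule SLF R ?A (N i)"
    and inc: "\<And>i. i < length as \<Longrightarrow> N i \<subseteq> N (Suc i)"
    and sec: "\<And>i. i < length as \<Longrightarrow> gmod_section SLF R ?A (N i) (N (Suc i)) (L (as ! i))"
    using fac unfolding has_factors_def by blast
  have "lin f I J ` N 0 = {\<zero>\<^bsub>?M\<^esub>}" using N(1) gmod_hom_zero[OF gA gM f] by simp
  moreover have "lin f I J ` N (length as) = carrier ?M" using N(2) im by simp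
  moreover have "gsubmodule SLF R ?M (lin f I J ` N i)" if "i \<le> length as" for i
    using gsubmodule_image[OF gA gM f sub[OF that]] .
  moreover have "lin f I J ` N i \<subseteq> lin f I J ` N (Suc i) \<and>
      gmod_section SLF R ?M (lin f I J ` N i) (lin f I J ` N (Suc i)) (L (as ! i))" if "i < length as" for i
    using image_mono[OF inc[OF that]] section_image[OF gA gM f inj sub sec[OF that]] that by simp
  ultimately show ?thesis unfolding has_factors_def using gM
    by (intro conjI exI[of _ "\<lambda>i. lin f I J ` N i"]) blast+
qed

end

text \<open>The Cauchy product, summed over the rectangle of exponents that indexes the basis of a
  tensor product.\<close>

lemma coeff_mult_bounded:
  fixes P Q :: "int poly"
  assumes "degree P \<le> M" "degree Q \<le> N"
  shows "(\<Sum>x\<in>{0..M} \<times> {0..N}. of_bool (fst x + snd x = k) * (coeff P (fst x) * coeff Q (snd x))) =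
    coeff (P * Q) k"
proof -
  have inner: "(\<Sum>j\<in>{0..N}. of_bool (i + j = k) * (coeff P i * coeff Q j)) =
      (if i \<le> k then coeff P i * coeff Q (k - i) else 0)" for i
  proof (cases "i \<le> k \<and> k - i \<le> N")
    case True
    then have "(\<Sum>j\<in>{0..N}. of_bool (i + j = k) * (coeff P i * coeff Q j)) =
        (\<Sum>j\<in>{0..N}. if j = k - i then coeff P i * coeff Q j else 0)"
      by (intro sum.cong) (auto simp: of_bool_def)
    then show ?thesis using True by simp
  next
    case False
    then have "coeff Q (k - i) = 0" if "i \<le> k" using that assms(2) by (intro coeff_eq_0) simp
    moreover have "(\<Sum>j\<in>{0..N}. of_bool (i + j = k) * (coeff P i * coeff Q j)) = 0"
      using False by (intro sum.neutral) auto
    ultimately show ?thesis by simp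
  qed
  have "(\<Sum>x\<in>{0..M} \<times> {0..N}. of_bool (fst x + snd x = k) * (coeff P (fst x) * coeff Q (snd x))) =
      (\<Sum>i\<in>{0..M}. if i \<le> k then coeff P i * coeff Q (k - i) else 0)"
    unfolding inner[symmetric] sum.cartesian_product by (intro sum.cong refl) auto
  also have "\<dots> = (\<Sum>i\<in>{0..M + k}. if i \<le> k then coeff P i * coeff Q (k - i) else 0)"
    using assms(1) by (intro sum.mono_neutral_left) (auto simp: coeff_eq_0)
  also have "\<dots> = (\<Sum>i\<in>{..k}. if i \<le> k then coeff P i * coeff Q (k - i) else 0)"
    by (intro sum.mono_neutral_right) auto
  also have "\<dots> = coeff (P * Q) k" by (simp add: coeff_mult)
  finally show ?thesis .
qed

lemma degree_sym_poly: "j \<le> n \<Longrightarrow> degree (sym_poly n j q) \<le> n"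
  using degree_linear_powers[of _ _ "n - j" _ _ j] by (cases q) simp

lemma coeff_linear_mult:
  fixes P :: "int poly"
  shows "coeff ([:s, t:] * P) i = s * coeff P i + t * coeff (pCons 0 P) i"
  by (cases i) simp_all

lemma sum_of_bool_eq:
  fixes g :: "'a \<Rightarrow> int"
  assumes "finite S"
  shows "(\<Sum>x\<in>S. of_bool (x = y) * g x) = of_bool (y \<in> S) * g y"
    and "(\<Sum>x\<in>S. g x * of_bool (x = y)) = of_bool (y \<in> S) * g y"
    and "(\<Sum>x\<in>S. of_bool (y = x) * g x) = of_bool (y \<in> S) * g y"
    and "(\<Sum>x\<in>S. g x * of_bool (y = x)) = of_bool (y \<in> S) * g y"
  using assms by (simp_all add: of_bool_def if_distrib[of "\<lambda>z. z * _"] if_distrib[of "\<lambda>z. _ * z"] cong: if_cong)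

section \<open>The tensor product of two symmetric powers\<close>

abbreviation tensor_mat where
  "tensor_mat m n q i j \<equiv> sym_mat m q (fst i) (fst j) * sym_mat n q (snd i) (snd j)"

text \<open>Multiplication of a form in \<open>(x\<^sub>1, y\<^sub>1)\<close> and a form in \<open>(x\<^sub>2, y\<^sub>2)\<close> by
  \<open>x\<^sub>1 y\<^sub>2 - y\<^sub>1 x\<^sub>2\<close>, followed by the restriction to the diagonal.\<close>

definition det_mat :: "nat \<times> nat \<Rightarrow> nat \<times> nat \<Rightarrow> int" where
  "det_mat x y = of_bool (x = (fst y, Suc (snd y))) - of_bool (x = (Suc (fst y), snd y))"

definition diag_mat :: "nat \<Rightarrow> nat \<times> nat \<Rightarrow> int" where
  "diag_mat k x = of_bool (fst x + snd x = k)"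

text \<open>In a fixed total degree, multiplication by
  \<open>x\<^sub>1 y\<^sub>2 - y\<^sub>1 x\<^sub>2\<close> takes differences of neighbouring
  monomials, ordered by the first exponent. Partial sums of coefficients undo this, hence the
  condition \<open>fst y \<le> fst x\<close>.\<close>

definition det_inv_mat :: "nat \<times> nat \<Rightarrow> nat \<times> nat \<Rightarrow> int" where
  "det_inv_mat x y = of_bool (fst y + snd y = Suc (fst x + snd x) \<and> fst y \<le> fst x)"

text \<open>A right inverse of the restriction to the diagonal: of the monomials of total degree
  \<open>k\<close> it takes the one with the largest first exponent. This is where the partial sums
  of \<open>det_inv_mat\<close> end, so the two splittings are complementary.\<close>

definition diag_inv_mat :: "nat \<Rightarrow> nat \<times> nat \<Rightarrow> nat \<Rightarrow> int" where
  "diag_inv_mat M x k = of_bool (x = (if k \<le> M then (k, 0) else (M, k - M)))"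

lemma sum_det_mat_right:
  fixes g :: "nat \<times> nat \<Rightarrow> int"
  assumes "y \<in> {0..m} \<times> {0..n}"
  shows "(\<Sum>x\<in>{0..Suc m} \<times> {0..Suc n}. g x * det_mat x y) =
    g (fst y, Suc (snd y)) - g (Suc (fst y), snd y)"
  using assms by (auto simp: det_mat_def right_diff_distrib sum_subtractf sum_of_bool_eq)

lemma sum_det_mat_left:
  fixes g :: "nat \<times> nat \<Rightarrow> int"
  assumes "x \<in> {0..Suc m} \<times> {0..Suc n}"
  shows "(\<Sum>y\<in>{0..m} \<times> {0..n}. det_mat x y * g y) =
    (if fst x \<le> m \<and> snd x \<noteq> 0 then g (fst x, snd x - 1) else 0) -
    (if fst x \<noteq> 0 \<and> snd x \<le> n then g (fst x - 1, snd x) else 0)"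
proof -
  obtain i j where x: "x = (i, j)" by (cases x)
  have 1: "(\<Sum>y\<in>{0..m} \<times> {0..n}. of_bool (x = (fst y, Suc (snd y))) * g y) =
      (if i \<le> m \<and> j \<noteq> 0 then g (i, j - 1) else 0)"
  proof (cases j)
    case (Suc j')
    have "(\<Sum>y\<in>{0..m} \<times> {0..n}. of_bool (x = (fst y, Suc (snd y))) * g y) =
        (\<Sum>y\<in>{0..m} \<times> {0..n}. of_bool (y = (i, j')) * g y)"
      by (intro sum.cong) (auto simp: x Suc)
    then show ?thesis using assms by (simp add: sum_of_bool_eq x Suc)
  qed (simp add: x)
  have 2: "(\<Sum>y\<in>{0..m} \<times> {0..n}. of_bool (x = (Suc (fst y), snd y)) * g y) =
      (if i \<noteq> 0 \<and> j \<le> n then g (i - 1, j) else 0)"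
  proof (cases i)
    case (Suc i')
    have "(\<Sum>y\<in>{0..m} \<times> {0..n}. of_bool (x = (Suc (fst y), snd y)) * g y) =
        (\<Sum>y\<in>{0..m} \<times> {0..n}. of_bool (y = (i', j)) * g y)"
      by (intro sum.cong) (auto simp: x Suc)
    then show ?thesis using assms by (simp add: sum_of_bool_eq x Suc)
  qed (simp add: x)
  show ?thesis using 1 2 by (simp add: det_mat_def left_diff_distrib sum_subtractf x)
qed

lemma sum_diag_mat_right:
  fixes g :: "nat \<Rightarrow> int"
  assumes "fst x + snd x \<le> K"
  shows "(\<Sum>k\<in>{0..K}. g k * diag_mat k x) = g (fst x + snd x)"
  using assms by (simp add: diag_mat_def sum_of_bool_eq)

text \<open>Restriction to the diagonal multiplies polynomials, and the image of a product of two
  monomials is the product of their images.\<close>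

lemma diag_mat_equivariant:
  assumes "y \<in> {0..M} \<times> {0..N}" "k \<in> {0..M + N}"
  shows "(\<Sum>x\<in>{0..M} \<times> {0..N}. diag_mat k x * tensor_mat M N q x y) =
    (\<Sum>l\<in>{0..M + N}. sym_mat (M + N) q k l * diag_mat l y)"
proof -
  obtain a b c d where q: "q = (a, b, c, d)" by (cases q)
  obtain i j where y: "y = (i, j)" by (cases y)
  have ij: "i \<le> M" "j \<le> N" using assms y by auto
  have "M + N - (i + j) = (M - i) + (N - j)" using ij by simp
  then have "sym_poly (M + N) (i + j) q = sym_poly M i q * sym_poly N j q"
    by (simp add: q power_add mult_ac)
  then have "coeff (sym_poly M i q * sym_poly N j q) k = sym_mat (M + N) q k (i + j)"
    by (simp add: sym_mat_def)
  also have "\<dots> = (\<Sum>l\<in>{0..M + N}. sym_mat (M + N) q k l * diag_mat l y)"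
    using sum_diag_mat_right[of y "M + N" "sym_mat (M + N) q k"] ij y by simp
  finally show ?thesis
    using coeff_mult_bounded[OF degree_sym_poly[OF ij(1), of q] degree_sym_poly[OF ij(2), of q], of k]
    unfolding y by (simp only: diag_mat_def sym_mat_def fst_conv snd_conv)
qed

text \<open>The form \<open>x\<^sub>1 y\<^sub>2 - y\<^sub>1 x\<^sub>2\<close> is multiplied by the
  determinant under \<open>q\<close>. The identity is exact over the integers; for \<open>q\<close>
  in \<open>SLp\<close> the factor is 1 modulo \<open>p\<close>.\<close>

lemma det_mat_equivariant:
  assumes y: "y \<in> {0..m} \<times> {0..n}" and x: "x \<in> {0..Suc m} \<times> {0..Suc n}"
  shows "mat2_det q * (\<Sum>z\<in>{0..m} \<times> {0..n}. det_mat x z * tensor_mat m n q z y) =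
    (\<Sum>z\<in>{0..Suc m} \<times> {0..Suc n}. tensor_mat (Suc m) (Suc n) q x z * det_mat z y)"
proof -
  obtain a b c d where q: "q = (a, b, c, d)" by (cases q)
  obtain i j where ij: "y = (i, j)" by (cases y)
  obtain k l where kl: "x = (k, l)" by (cases x)
  have b: "i \<le> m" "j \<le> n" "k \<le> Suc m" "l \<le> Suc n" using x y by (auto simp: ij kl)
  let ?P = "sym_poly m i q" and ?Q = "sym_poly n j q"
  have "sym_poly (Suc m) i q = [:a, c:] * ?P" "sym_poly (Suc m) (Suc i) q = [:b, d:] * ?P"
    "sym_poly (Suc n) j q = [:a, c:] * ?Q" "sym_poly (Suc n) (Suc j) q = [:b, d:] * ?Q"
    using b by (simp_all only: q sym_poly.simps Suc_diff_le diff_Suc_Suc power_Suc mult_ac)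
  then have S: "sym_mat (Suc m) q k i = a * coeff ?P k + c * coeff (pCons 0 ?P) k"
    "sym_mat (Suc m) q k (Suc i) = b * coeff ?P k + d * coeff (pCons 0 ?P) k"
    "sym_mat (Suc n) q l j = a * coeff ?Q l + c * coeff (pCons 0 ?Q) l"
    "sym_mat (Suc n) q l (Suc j) = b * coeff ?Q l + d * coeff (pCons 0 ?Q) l"
    unfolding sym_mat_def by (simp_all only: coeff_linear_mult)
  have "(\<Sum>z\<in>{0..m} \<times> {0..n}. det_mat x z * tensor_mat m n q z y) =
      (if k \<le> m \<and> l \<noteq> 0 then coeff ?P k * coeff ?Q (l - 1) else 0) -
      (if k \<noteq> 0 \<and> l \<le> n then coeff ?P (k - 1) * coeff ?Q l else 0)"
    using sum_det_mat_left[OF x, of "\<lambda>z. tensor_mat m n q z y"] by (simp add: kl ij sym_mat_def)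
  also have "\<dots> = coeff ?P k * coeff (pCons 0 ?Q) l - coeff (pCons 0 ?P) k * coeff ?Q l"
    using b sym_mat_eq_0[of m k i q] sym_mat_eq_0[of n l j q]
    by (auto simp: coeff_pCons sym_mat_def split: nat.split)
  finally have L: "(\<Sum>z\<in>{0..m} \<times> {0..n}. det_mat x z * tensor_mat m n q z y) =
      coeff ?P k * coeff (pCons 0 ?Q) l - coeff (pCons 0 ?P) k * coeff ?Q l" .
  have "(\<Sum>z\<in>{0..Suc m} \<times> {0..Suc n}. tensor_mat (Suc m) (Suc n) q x z * det_mat z y) =
      sym_mat (Suc m) q k i * sym_mat (Suc n) q l (Suc j) - sym_mat (Suc m) q k (Suc i) * sym_mat (Suc n) q l j"
    using sum_det_mat_right[OF y, of "tensor_mat (Suc m) (Suc n) q x"] by (simp add: kl ij)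
  then show ?thesis unfolding L S by (simp add: q algebra_simps)
qed

text \<open>Taking partial sums and then differences telescopes: a monomial is returned minus the
  last monomial of its total degree, and the other term adds that one back.\<close>

lemma det_diag_split:
  assumes x: "x \<in> {0..Suc m} \<times> {0..Suc n}" and y: "y \<in> {0..Suc m} \<times> {0..Suc n}"
  shows "(\<Sum>z\<in>{0..m} \<times> {0..n}. det_mat x z * det_inv_mat z y) +
    (\<Sum>k\<in>{0..Suc m + Suc n}. diag_inv_mat (Suc m) x k * diag_mat k y) = of_bool (y = x)"
proof -
  obtain i j where ij: "x = (i, j)" by (cases x)
  obtain k l where kl: "y = (k, l)" by (cases y)
  have b: "i \<le> Suc m" "j \<le> Suc n" "k \<le> Suc m" "l \<le> Suc n" using x y by (auto simp: ij kl)
  have s1: "(\<Sum>k\<in>{0..Suc m + Suc n}. diag_inv_mat (Suc m) x k * diag_mat k y) = diag_inv_mat (Suc m) x (k + l)"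
    using sum_diag_mat_right[of y "Suc m + Suc n" "diag_inv_mat (Suc m) x"] b by (simp add: kl)
  have s2: "(if i \<le> m \<and> j \<noteq> 0 then det_inv_mat (i, j - 1) y else 0) -
      (if i \<noteq> 0 \<and> j \<le> n then det_inv_mat (i - 1, j) y else 0) + diag_inv_mat (Suc m) x (k + l) = of_bool (y = x)"
    using b unfolding det_inv_mat_def diag_inv_mat_def ij kl
    by (cases i; cases j) (auto simp: of_bool_def split: if_splits)
  show ?thesis
    unfolding s1 sum_det_mat_left[OF x, of "\<lambda>z. det_inv_mat z y"] s2[symmetric]
    unfolding ij fst_conv snd_conv ..
qed

context prime_subfield
begin

abbreviation sym_mod where "sym_mod n \<equiv> gmod_of R (sym_rep R n)"
abbreviation tensor_mod where "tensor_mod m n \<equiv> gmod_of R (tensor_rep R (sym_rep R m) (sym_rep R n))"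

lemmas realizes_tensor_sym = realizes_tensor[OF realizes_sym realizes_sym]

lemma has_factors_tensor_Suc:
  assumes "has_factors SLF R L (tensor_mod m n) as" "has_factors SLF R L (sym_mod (Suc m + Suc n)) bs"
  shows "has_factors SLF R L (tensor_mod (Suc m) (Suc n)) (as @ bs)"
proof (rule has_factors_split[OF realizes_tensor_sym realizes_tensor_sym realizes_sym
      lin_gmod_hom_matrix[OF realizes_tensor_sym realizes_tensor_sym]
      lin_gmod_hom_matrix[OF realizes_tensor_sym realizes_sym] _ _ _ _ assms,
      where t = det_inv_mat and s = "diag_inv_mat (Suc m)"])
  fix q y x assume q: "q \<in> SLp" and xy: "y \<in> {0..m} \<times> {0..n}" "x \<in> {0..Suc m} \<times> {0..Suc n}"
  have "[mat2_det q * (\<Sum>z\<in>{0..m} \<times> {0..n}. det_mat x z * tensor_mat m n q z y) =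
      1 * (\<Sum>z\<in>{0..m} \<times> {0..n}. det_mat x z * tensor_mat m n q z y)] (mod int p)"
    using q by (intro cong_mult cong_refl) (simp add: SLp_def)
  then show "[(\<Sum>z\<in>{0..m} \<times> {0..n}. det_mat x z * tensor_mat m n q z y) =
      (\<Sum>z\<in>{0..Suc m} \<times> {0..Suc n}. tensor_mat (Suc m) (Suc n) q x z * det_mat z y)] (mod int p)"
    unfolding det_mat_equivariant[OF xy] by (simp add: cong_sym)
next
  fix q y k assume "y \<in> {0..Suc m} \<times> {0..Suc n}" "k \<in> {0..Suc m + Suc n}"
  then show "[(\<Sum>x\<in>{0..Suc m} \<times> {0..Suc n}. diag_mat k x * tensor_mat (Suc m) (Suc n) q x y) =
      (\<Sum>l\<in>{0..Suc m + Suc n}. sym_mat (Suc m + Suc n) q k l * diag_mat l y)] (mod int p)"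
    using diag_mat_equivariant[of y "Suc m" "Suc n" k q] by simp
next
  fix x y assume "x \<in> {0..m} \<times> {0..n}" "y \<in> {0..m} \<times> {0..n}"
  then show "[(\<Sum>z\<in>{0..Suc m} \<times> {0..Suc n}. det_inv_mat x z * det_mat z y) =
      (if y = x then 1 else 0)] (mod int p)"
    by (subst sum_det_mat_right) (auto simp: det_inv_mat_def of_bool_def prod_eq_iff)
next
  fix k k' assume k: "k \<in> {0..Suc m + Suc n}" "k' \<in> {0..Suc m + Suc n}"
  have "(if k' \<le> Suc m then (k', 0) else (Suc m, k' - Suc m)) \<in> {0..Suc m} \<times> {0..Suc n}"
    using k by auto
  then show "[(\<Sum>x\<in>{0..Suc m} \<times> {0..Suc n}. diag_mat k x * diag_inv_mat (Suc m) x k') =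
      (if k' = k then 1 else 0)] (mod int p)"
    unfolding diag_inv_mat_def by (subst sum_of_bool_eq(2)) (auto simp: diag_mat_def of_bool_def)
next
  fix k y assume "k \<in> {0..Suc m + Suc n}" "y \<in> {0..m} \<times> {0..n}"
  then show "[(\<Sum>x\<in>{0..Suc m} \<times> {0..Suc n}. diag_mat k x * det_mat x y) = 0] (mod int p)"
    by (subst sum_det_mat_right) (auto simp: diag_mat_def)
next
  fix x y assume "x \<in> {0..Suc m} \<times> {0..Suc n}" "y \<in> {0..Suc m} \<times> {0..Suc n}"
  then show "[(\<Sum>z\<in>{0..m} \<times> {0..n}. det_mat x z * det_inv_mat z y) +
      (\<Sum>k\<in>{0..Suc m + Suc n}. diag_inv_mat (Suc m) x k * diag_mat k y) = (if y = x then 1 else 0)] (mod int p)"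
    using det_diag_split[of x m n y] by (simp add: of_bool_def)
qed

text \<open>The zeroth symmetric power is trivial, its only entry being 1, so relabelling
  \<open>k\<close> as \<open>(0, k)\<close> or \<open>(k, 0)\<close> is an isomorphism.\<close>

lemma has_factors_tensor_0:
  assumes "has_factors SLF R L (sym_mod n) bs"
  shows "has_factors SLF R L (tensor_mod 0 n) bs" "has_factors SLF R L (tensor_mod n 0) bs"
proof -
  have one: "sym_mat 0 q 0 0 = 1" for q by (cases q) (simp add: sym_mat_def)
  show "has_factors SLF R L (tensor_mod 0 n) bs"
  proof (rule has_factors_iso[OF realizes_sym realizes_tensor_sym lin_gmod_hom_matrix[OF realizes_sym realizes_tensor_sym] _ assms,
        where f = "\<lambda>x k. of_bool (k = snd x)"])
    fix q i x assume "i \<in> {0..n}" "x \<in> {0..0::nat} \<times> {0..n}"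
    moreover have "(\<Sum>z\<in>{0..0::nat} \<times> {0..n}. tensor_mat 0 n q x z * of_bool (i = snd z)) =
        (\<Sum>z\<in>{0..0::nat} \<times> {0..n}. tensor_mat 0 n q x z * of_bool (z = (0, i)))"
      by (intro sum.cong) auto
    ultimately show "[(\<Sum>k\<in>{0..n}. of_bool (k = snd x) * sym_mat n q k i) =
        (\<Sum>z\<in>{0..0} \<times> {0..n}. tensor_mat 0 n q x z * of_bool (i = snd z))] (mod int p)"
      by (auto simp: sum_of_bool_eq one)
  next
    show "bij_betw (lin (\<lambda>x k. of_bool (k = snd x)) {0..n} ({0..0::nat} \<times> {0..n}))
       ({0..n} \<rightarrow>\<^sub>E carrier R) ({0..0} \<times> {0..n} \<rightarrow>\<^sub>E carrier R)"
    proof (rule bij_betw_byWitness[where f' = "\<lambda>v. \<lambda>k\<in>{0..n}. v (0, k)"])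
      have at: "lin (\<lambda>x k. of_bool (k = snd x)) {0..n} ({0..0::nat} \<times> {0..n}) v x = v (snd x)"
        if "v \<in> {0..n} \<rightarrow>\<^sub>E carrier R" "x \<in> {0..0::nat} \<times> {0..n}" for v x
        using lin_at[OF that(1) _ that(2), of "snd x" "\<lambda>x k. of_bool (k = snd x)"] that
          PiE_mem[OF that(1), of "snd x"] by auto
      show "\<forall>v\<in>{0..n} \<rightarrow>\<^sub>E carrier R. (\<lambda>k\<in>{0..n}. lin (\<lambda>x k. of_bool (k = snd x)) {0..n} ({0..0::nat} \<times> {0..n}) v (0, k)) = v"
      proof
        fix v assume v: "v \<in> {0..n} \<rightarrow>\<^sub>E carrier R"
        show "(\<lambda>k\<in>{0..n}. lin (\<lambda>x k. of_bool (k = snd x)) {0..n} ({0..0::nat} \<times> {0..n}) v (0, k)) = v"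
          using at[OF v] PiE_arb[OF v] by (intro ext) auto
      qed
      show "\<forall>v\<in>{0..0} \<times> {0..n} \<rightarrow>\<^sub>E carrier R. lin (\<lambda>x k. of_bool (k = snd x)) {0..n} ({0..0::nat} \<times> {0..n}) (\<lambda>k\<in>{0..n}. v (0, k)) = v"
      proof
        fix v assume v: "v \<in> {0..0::nat} \<times> {0..n} \<rightarrow>\<^sub>E carrier R"
        then have "(\<lambda>k\<in>{0..n}. v (0, k)) \<in> {0..n} \<rightarrow>\<^sub>E carrier R" by auto
        then show "lin (\<lambda>x k. of_bool (k = snd x)) {0..n} ({0..0::nat} \<times> {0..n}) (\<lambda>k\<in>{0..n}. v (0, k)) = v"
          using at v by (intro PiE_ext[OF lin_closed v]) auto
      qed
      show "(\<lambda>v. \<lambda>k\<in>{0..n}. v (0, k)) ` ({0..0::nat} \<times> {0..n} \<rightarrow>\<^sub>E carrier R) \<subseteq> {0..n} \<rightarrow>\<^sub>E carrier R"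
      proof (intro image_subsetI)
        fix v assume v: "v \<in> {0..0::nat} \<times> {0..n} \<rightarrow>\<^sub>E carrier R"
        show "(\<lambda>k\<in>{0..n}. v (0, k)) \<in> {0..n} \<rightarrow>\<^sub>E carrier R" using PiE_mem[OF v] by simp
      qed
    qed (intro image_subsetI lin_closed)
  qed
  show "has_factors SLF R L (tensor_mod n 0) bs"
  proof (rule has_factors_iso[OF realizes_sym realizes_tensor_sym lin_gmod_hom_matrix[OF realizes_sym realizes_tensor_sym] _ assms,
        where f = "\<lambda>x k. of_bool (k = fst x)"])
    fix q i x assume "i \<in> {0..n}" "x \<in> {0..n} \<times> {0..0::nat}"
    moreover have "(\<Sum>z\<in>{0..n} \<times> {0..0::nat}. tensor_mat n 0 q x z * of_bool (i = fst z)) =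
        (\<Sum>z\<in>{0..n} \<times> {0..0::nat}. tensor_mat n 0 q x z * of_bool (z = (i, 0)))"
      by (intro sum.cong) auto
    ultimately show "[(\<Sum>k\<in>{0..n}. of_bool (k = fst x) * sym_mat n q k i) =
        (\<Sum>z\<in>{0..n} \<times> {0..0}. tensor_mat n 0 q x z * of_bool (i = fst z))] (mod int p)"
      by (auto simp: sum_of_bool_eq one)
  next
    show "bij_betw (lin (\<lambda>x k. of_bool (k = fst x)) {0..n} ({0..n} \<times> {0..0::nat}))
       ({0..n} \<rightarrow>\<^sub>E carrier R) ({0..n} \<times> {0..0} \<rightarrow>\<^sub>E carrier R)"
    proof (rule bij_betw_byWitness[where f' = "\<lambda>v. \<lambda>k\<in>{0..n}. v (k, 0)"])
      have at: "lin (\<lambda>x k. of_bool (k = fst x)) {0..n} ({0..n} \<times> {0..0::nat}) v x = v (fst x)"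
        if "v \<in> {0..n} \<rightarrow>\<^sub>E carrier R" "x \<in> {0..n} \<times> {0..0::nat}" for v x
        using lin_at[OF that(1) _ that(2), of "fst x" "\<lambda>x k. of_bool (k = fst x)"] that
          PiE_mem[OF that(1), of "fst x"] by auto
      show "\<forall>v\<in>{0..n} \<rightarrow>\<^sub>E carrier R. (\<lambda>k\<in>{0..n}. lin (\<lambda>x k. of_bool (k = fst x)) {0..n} ({0..n} \<times> {0..0::nat}) v (k, 0)) = v"
      proof
        fix v assume v: "v \<in> {0..n} \<rightarrow>\<^sub>E carrier R"
        show "(\<lambda>k\<in>{0..n}. lin (\<lambda>x k. of_bool (k = fst x)) {0..n} ({0..n} \<times> {0..0::nat}) v (k, 0)) = v"
          using at[OF v] PiE_arb[OF v] by (intro ext) auto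
      qed
      show "\<forall>v\<in>{0..n} \<times> {0..0} \<rightarrow>\<^sub>E carrier R. lin (\<lambda>x k. of_bool (k = fst x)) {0..n} ({0..n} \<times> {0..0::nat}) (\<lambda>k\<in>{0..n}. v (k, 0)) = v"
      proof
        fix v assume v: "v \<in> {0..n} \<times> {0..0::nat} \<rightarrow>\<^sub>E carrier R"
        then have "(\<lambda>k\<in>{0..n}. v (k, 0)) \<in> {0..n} \<rightarrow>\<^sub>E carrier R" by auto
        then show "lin (\<lambda>x k. of_bool (k = fst x)) {0..n} ({0..n} \<times> {0..0::nat}) (\<lambda>k\<in>{0..n}. v (k, 0)) = v"
          using at v by (intro PiE_ext[OF lin_closed v]) auto
      qed
      show "(\<lambda>v. \<lambda>k\<in>{0..n}. v (k, 0)) ` ({0..n} \<times> {0..0::nat} \<rightarrow>\<^sub>E carrier R) \<subseteq> {0..n} \<rightarrow>\<^sub>E carrier R"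
      proof (intro image_subsetI)
        fix v assume v: "v \<in> {0..n} \<times> {0..0::nat} \<rightarrow>\<^sub>E carrier R"
        show "(\<lambda>k\<in>{0..n}. v (k, 0)) \<in> {0..n} \<rightarrow>\<^sub>E carrier R" using PiE_mem[OF v] by simp
      qed
    qed (intro image_subsetI lin_closed)
  qed
qed

end

section \<open>Symmetric powers of degree at least \<open>p\<close>\<close>

text \<open>Modulo \<open>p\<close> the upper index p - 1 - e is -(e + 1), and (-1)^j times the
  binomial coefficient of -(e + 1) over j is that of e + j over j. The induction compares
  consecutive \<open>j\<close> after multiplication by \<open>Suc j\<close>, which is prime to
  \<open>p\<close>.\<close>

lemma choose_reflect_cong:
  assumes "prime p" "e + j < p"
  shows "[(-1) ^ j * int ((p - 1 - e) choose j) = int ((e + j) choose j)] (mod int p)"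
  using assms(2)
proof (induction j)
  case (Suc j)
  let ?N = "p - 1 - e"
  have cop: "coprime (int (Suc j)) (int p)"
    using assms(1) Suc.prems by (metis add_lessD1 coprime_commute coprime_int_iff dvd_imp_le not_less prime_imp_coprime zero_less_Suc add.commute)
  have N: "int (Suc j) * int (?N choose Suc j) = int (?N - j) * int (?N choose j)"
    using binomial_absorb_comp[of ?N j] Suc_times_binomial_eq[of "?N - 1" j]
    by (metis binomial_absorption of_nat_mult mult.commute)
  have N': "int (?N - j) = int p - int (e + Suc j)" using Suc.prems by simp
  have E: "int (Suc j) * int ((e + Suc j) choose Suc j) = int (e + Suc j) * int ((e + j) choose j)"
    using Suc_times_binomial_eq[of "e + j" j] by (metis add_Suc_right mult.commute of_nat_mult)
  have flip: "x * ((-1) ^ Suc j * z) = - ((-1) ^ j * (x * z))" for x z :: int by (simp add: mult_ac)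
  have "[int (Suc j) * ((-1) ^ Suc j * int (?N choose Suc j)) =
      - ((int p - int (e + Suc j)) * ((-1) ^ j * int (?N choose j)))] (mod int p)"
    unfolding flip N N' by (simp add: mult_ac)
  also have "[- ((int p - int (e + Suc j)) * ((-1) ^ j * int (?N choose j))) =
      int (e + Suc j) * ((-1) ^ j * int (?N choose j))] (mod int p)"
    by (simp add: cong_iff_dvd_diff algebra_simps)
  also have "[int (e + Suc j) * ((-1) ^ j * int (?N choose j)) = int (e + Suc j) * int ((e + j) choose j)] (mod int p)"
    using Suc by (intro cong_scalar_left) simp
  also have "int (e + Suc j) * int ((e + j) choose j) = int (Suc j) * int ((e + Suc j) choose Suc j)"
    using E by simp
  finally show ?case using cop by (simp only: cong_mult_lcancel)
qed simp

text \<open>In Vandermonde's sum for (p + k) over \<open>e\<close>, the term with i = 0 vanishes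
  because k < e, and \<open>p\<close> divides p over i for all other i <= e < p.\<close>

lemma prime_dvd_choose_add:
  assumes "prime p" "k < e" "e < p"
  shows "p dvd ((p + k) choose e)"
proof -
  have "p dvd (p choose i) * (k choose (e - i))" if "i \<le> e" for i
  proof (cases "i = 0")
    case False
    then show ?thesis using assms that by (intro dvd_mult2 dvd_choose_prime) auto
  qed (use assms in \<open>simp add: binomial_eq_0\<close>)
  then show ?thesis unfolding vandermonde[symmetric] by (intro dvd_sum) simp
qed

text \<open>Modulo \<open>p\<close> the \<open>p\<close>th power of s + t X is s + t X^p: the middle
  binomial coefficients vanish and Fermat's theorem removes the exponents on \<open>s\<close> and
  \<open>t\<close>.\<close>

lemma frobenius_linear_cong:
  fixes Q :: "int poly"
  assumes "prime p"
  shows "[coeff ([:s, t:] ^ p * Q) k = s * coeff Q k + (if p \<le> k then t * coeff Q (k - p) else 0)] (mod int p)"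
proof -
  have p0: "p > 0" using assms prime_gt_0_nat by blast
  have fermat: "[z ^ p = z] (mod int p)" for z :: int
  proof (cases "int p dvd z")
    case True
    have "z dvd z ^ p" using p0 by (simp add: dvd_power)
    then have "int p dvd z ^ p" using True by (rule dvd_trans[rotated])
    then show ?thesis using True by (simp add: cong_iff_dvd_diff)
  next
    case False
    define a where "a = nat (z mod int p)"
    have a: "int a = z mod int p" using p0 by (simp add: a_def)
    have "\<not> int p dvd int a" using False unfolding a by (simp add: dvd_mod_iff)
    then have "[a ^ (p - 1) = 1] (mod p)" using assms by (intro fermat_theorem) simp_all
    then have "[int (a ^ (p - 1)) = int 1] (mod int p)" by (simp only: cong_int_iff)
    then have "[int a ^ (p - 1) = 1] (mod int p)" by simp
    moreover have "[int a = z] (mod int p)" unfolding a by simp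
    ultimately have "[z ^ (p - 1) = 1] (mod int p)" by (metis cong_pow cong_sym cong_trans)
    then have "[z ^ (p - 1) * z = 1 * z] (mod int p)" by (rule cong_scalar_right)
    moreover have "z ^ (p - 1) * z = z ^ p" using p0 by (simp add: power_eq_if mult.commute)
    ultimately show ?thesis by simp
  qed
  have c: "[coeff ([:s, t:] ^ p) i = (if i = 0 then s else 0) + (if i = p then t else 0)] (mod int p)" for i
  proof -
    consider "i = 0" | "i = p" | "0 < i" "i < p" | "p < i" by linarith
    then show ?thesis
    proof cases
      case 1
      then show ?thesis using p0 fermat by (simp add: coeff_linear_poly_power)
    next
      case 2
      then show ?thesis using p0 fermat by (simp add: coeff_linear_poly_power)
    next
      case 3
      then have "int p dvd int (p choose i)" using assms by (simp add: dvd_choose_prime)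
      then show ?thesis using 3 by (simp add: coeff_linear_poly_power cong_0_iff)
    next
      case 4
      have "degree ([:s, t:] ^ p) \<le> p" using degree_linear_powers[of s t p 0 0 0] by simp
      then show ?thesis using 4 p0 by (simp add: coeff_eq_0)
    qed
  qed
  have "[coeff ([:s, t:] ^ p * Q) k =
      (\<Sum>i\<le>k. ((if i = 0 then s else 0) + (if i = p then t else 0)) * coeff Q (k - i))] (mod int p)"
    unfolding coeff_mult by (intro cong_sum cong_scalar_right c)
  also have "(\<Sum>i\<le>k. ((if i = 0 then s else 0) + (if i = p then t else 0)) * coeff Q (k - i)) =
      s * coeff Q k + (if p \<le> k then t * coeff Q (k - p) else 0)"
    by (simp add: distrib_right sum.distrib if_distrib[of "\<lambda>z. z * _"] cong: if_cong)
  finally show ?thesis .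
qed

text \<open>The map \<open>x\<^sup>i y\<^sup>j \<mapsto> x\<^sup>p\<^sup>i y\<^sup>p\<^sup>j\<close> on linear forms followed by multiplication with a form
  of degree \<open>r\<close>.\<close>

definition frob_mat :: "nat \<Rightarrow> nat \<Rightarrow> nat \<times> nat \<Rightarrow> int" where
  "frob_mat p k x = of_bool (k = p * fst x + snd x)"

text \<open>The projection onto the forms with all exponents less than \<open>p\<close>. These are dual to the
  forms of degree \<open>p - 2 - r\<close>, hence isomorphic to them.\<close>

definition trunc_mat :: "nat \<Rightarrow> nat \<Rightarrow> nat \<Rightarrow> nat \<Rightarrow> int" where
  "trunc_mat p r k j = of_bool (j = k + Suc r) * ((-1) ^ k * int ((p - 2 - r) choose k))"

lemma sum_frob_mat_left:
  fixes g :: "nat \<times> nat \<Rightarrow> int"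
  assumes "r < p"
  shows "(\<Sum>x\<in>{0..1} \<times> {0..r}. frob_mat p k x * g x) =
    (if k \<le> r then g (0, k) else if p \<le> k \<and> k \<le> p + r then g (1, k - p) else 0)"
proof -
  have "(\<Sum>x\<in>{0..1} \<times> {0..r}. frob_mat p k x * g x) =
      (\<Sum>e\<in>{0..1}. \<Sum>i\<in>{0..r}. frob_mat p k (e, i) * g (e, i))"
    by (simp add: sum.cartesian_product case_prod_beta)
  also have "\<dots> = (\<Sum>i\<in>{0..r}. of_bool (k = i) * g (0, i)) + (\<Sum>i\<in>{0..r}. of_bool (k = p + i) * g (1, i))"
    by (simp add: frob_mat_def)
  also have "(\<Sum>i\<in>{0..r}. of_bool (k = i) * g (0, i)) = (if k \<le> r then g (0, k) else 0)"
    by (subst sum_of_bool_eq(3)) auto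
  also have "(\<Sum>i\<in>{0..r}. of_bool (k = p + i) * g (1, i)) = (if p \<le> k \<and> k \<le> p + r then g (1, k - p) else 0)"
  proof (cases "p \<le> k")
    case True
    then have "(\<Sum>i\<in>{0..r}. of_bool (k = p + i) * g (1, i)) = (\<Sum>i\<in>{0..r}. of_bool (i = k - p) * g (1, i))"
      by (intro sum.cong) auto
    then show ?thesis using True by (auto simp: sum_of_bool_eq)
  next
    case False
    then show ?thesis by (auto intro!: sum.neutral)
  qed
  finally show ?thesis using assms by auto
qed

lemma sum_frob_mat_right:
  fixes g :: "nat \<Rightarrow> int"
  assumes "x \<in> {0..1} \<times> {0..r}"
  shows "(\<Sum>k\<in>{0..p + r}. g k * frob_mat p k x) = g (p * fst x + snd x)"
proof -
  have "p * fst x + snd x \<le> p + r" using assms by (cases "fst x") auto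
  then show ?thesis unfolding frob_mat_def by (simp add: sum_of_bool_eq)
qed

lemma sum_trunc_mat_left:
  fixes g :: "nat \<Rightarrow> int"
  assumes "k + Suc r \<le> m"
  shows "(\<Sum>j\<in>{0..m}. trunc_mat p r k j * g j) = (-1) ^ k * int ((p - 2 - r) choose k) * g (k + Suc r)"
  using assms by (simp add: trunc_mat_def mult.assoc sum_of_bool_eq)

lemma sum_trunc_mat_right:
  fixes g :: "nat \<Rightarrow> int"
  assumes "r + 2 \<le> p"
  shows "(\<Sum>k\<in>{0..p - 2 - r}. g k * trunc_mat p r k j) =
    (if Suc r \<le> j \<and> j < p then g (j - Suc r) * ((-1) ^ (j - Suc r) * int ((p - 2 - r) choose (j - Suc r))) else 0)"
proof (cases "Suc r \<le> j")
  case True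
  have "(\<Sum>k\<in>{0..p - 2 - r}. g k * trunc_mat p r k j) =
      (\<Sum>k\<in>{0..p - 2 - r}. of_bool (k = j - Suc r) * (g k * ((-1) ^ k * int ((p - 2 - r) choose k))))"
    using True by (intro sum.cong) (auto simp: trunc_mat_def)
  also have "\<dots> = of_bool (j - Suc r \<in> {0..p - 2 - r}) * (g (j - Suc r) * ((-1) ^ (j - Suc r) * int ((p - 2 - r) choose (j - Suc r))))"
    by (subst sum_of_bool_eq(1)) simp_all
  finally show ?thesis using True assms by auto
next
  case False
  then show ?thesis by (auto simp: trunc_mat_def intro!: sum.neutral)
qed

lemma sym_poly_frobenius:
  assumes "e \<le> 1" "i \<le> r"
  shows "sym_poly (p + r) (p * e + i) q = sym_poly 1 e q ^ p * sym_poly r i q"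
proof (cases q)
  case (fields a b c d)
  have e: "e = 0 \<or> e = 1" using assms(1) by auto
  have "p + r - i = p + (r - i)" using assms(2) by simp
  then show ?thesis using e by (auto simp: fields power_add mult_ac)
qed

text \<open>By Fermat the Frobenius map fixes the entries of \<open>q\<close> modulo
  \<open>p\<close>, so the \<open>p\<close>th power of the image of a linear form is its image with
  the variables raised to the power \<open>p\<close>.\<close>

lemma frob_mat_equivariant:
  assumes "prime p" "r < p" and y: "y \<in> {0..1} \<times> {0..r}" and k: "k \<in> {0..p + r}"
  shows "[(\<Sum>x\<in>{0..1} \<times> {0..r}. frob_mat p k x * tensor_mat 1 r q x y) =
    (\<Sum>l\<in>{0..p + r}. sym_mat (p + r) q k l * frob_mat p l y)] (mod int p)"
proof -
  obtain e i where ei: "y = (e, i)" "e \<le> 1" "i \<le> r" using y by auto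
  let ?Q = "sym_poly r i q"
  obtain s t where st: "sym_poly 1 e q = [:s, t:]"
    using ei(2) by (cases q; cases "e = 0") (auto simp: le_Suc_eq)
  have s1: "sym_mat 1 q 0 e = s" "sym_mat 1 q 1 e = t" by (simp_all add: sym_mat_def st[unfolded One_nat_def])
  have "(\<Sum>x\<in>{0..1} \<times> {0..r}. frob_mat p k x * tensor_mat 1 r q x y) =
      (if k \<le> r then s * coeff ?Q k else if p \<le> k \<and> k \<le> p + r then t * coeff ?Q (k - p) else 0)"
    unfolding sum_frob_mat_left[OF assms(2)] using s1 by (simp add: ei sym_mat_def)
  also have "\<dots> = s * coeff ?Q k + (if p \<le> k then t * coeff ?Q (k - p) else 0)"
    using k assms(2) sym_mat_eq_0[of r k i q] ei(3) by (auto simp: sym_mat_def)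
  finally have L: "(\<Sum>x\<in>{0..1} \<times> {0..r}. frob_mat p k x * tensor_mat 1 r q x y) =
      s * coeff ?Q k + (if p \<le> k then t * coeff ?Q (k - p) else 0)" .
  have "(\<Sum>l\<in>{0..p + r}. sym_mat (p + r) q k l * frob_mat p l y) = coeff ([:s, t:] ^ p * ?Q) k"
    unfolding sum_frob_mat_right[OF y] using sym_poly_frobenius[OF ei(2,3), of p q]
    by (simp add: ei sym_mat_def st[unfolded One_nat_def])
  then show ?thesis unfolding L using frobenius_linear_cong[OF assms(1), of s t ?Q k] by (simp add: cong_sym)
qed

section \<open>Equivariance of the truncation on generators\<close>

lemma sym_mat_upper: "sym_mat n (1, t, 0, 1) i j = (if i \<le> j then int (j choose i) * t ^ (j - i) else 0)"
proof (cases "i \<le> j")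
  case False
  then have "degree ([:t, 1:] ^ j) < i" using degree_linear_powers[of t 1 j 0 0 0] by simp
  then show ?thesis using False by (simp add: sym_mat_def pCons_one coeff_eq_0)
qed (use coeff_linear_poly_power[of i j t "1::int"] in \<open>simp add: sym_mat_def pCons_one\<close>)

lemma sym_mat_weyl: "sym_mat n (0, 1, -1, 0) i j = (if i = n - j then (-1) ^ (n - j) else 0)"
proof -
  have "[:0, -1:] = (monom (-1) 1 :: int poly)" by (simp add: monom_altdef)
  then have "sym_poly n j (0, 1, -1, 0) = monom ((-1) ^ (n - j)) (n - j)"
    by (simp add: monom_power pCons_one)
  then show ?thesis by (auto simp: sym_mat_def)
qed

text \<open>For small \<open>j\<close> both sides vanish by triangularity. For j < p the identity
  combines the reflection of binomial coefficients, which explains the signs and coefficients in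
  \<open>trunc_mat\<close>, with trinomial revision. For j >= p the right side is truncated away and
  \<open>p\<close> divides the binomial coefficient on the left.\<close>

lemma trunc_mat_upper:
  assumes p: "prime p" and r: "r + 2 \<le> p" and k: "k \<le> p - 2 - r" and j: "j \<le> p + r"
  shows "[(\<Sum>l\<in>{0..p + r}. trunc_mat p r k l * sym_mat (p + r) (1, t, 0, 1) l j) =
    (\<Sum>l\<in>{0..p - 2 - r}. sym_mat (p - 2 - r) (1, t, 0, 1) k l * trunc_mat p r l j)] (mod int p)"
proof -
  let ?n = "p - 2 - r"
  have "k + Suc r \<le> p + r" using k r by simp
  note L = sum_trunc_mat_left[OF this, of p "\<lambda>l. sym_mat (p + r) (1, t, 0, 1) l j"]
  note R = sum_trunc_mat_right[OF r, of "sym_mat ?n (1, t, 0, 1) k" j]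
  consider "j < k + Suc r" | "k + Suc r \<le> j" "j < p" | "p \<le> j" using k r by linarith
  then show ?thesis
  proof cases
    case 1
    then show ?thesis unfolding L R by (auto simp: sym_mat_upper)
  next
    case 2
    define e where "e = k + Suc r"
    define i where "i = j - e"
    have j': "j = e + i" using 2 by (simp add: i_def e_def)
    have js: "j - Suc r = k + i" using j' by (simp add: e_def)
    have lt: "e + i < p" using 2 j' by simp
    \<comment> \<open>Trinomial revision: choosing \<open>k\<close> and then \<open>i\<close>
      further elements, or all k + i at once and marking \<open>k\<close> of them.\<close>
    have "int (?n choose k) * int ((?n - k) choose i) = int (?n choose (k + i)) * int ((k + i) choose k)"
      using choose_mult[of k "k + i" ?n] lt k r by (simp add: e_def of_nat_mult[symmetric] del: of_nat_mult)
    moreover have "?n - k = p - 1 - e" using k r by (simp add: e_def)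
    ultimately have ch: "int (?n choose k) * int ((p - 1 - e) choose i) = int (?n choose (k + i)) * int ((k + i) choose k)"
      by simp
    have "[(-1) ^ k * int (?n choose k) * (int ((e + i) choose i) * t ^ i) =
      (-1) ^ k * int (?n choose k) * (((-1) ^ i * int ((p - 1 - e) choose i)) * t ^ i)] (mod int p)"
      using choose_reflect_cong[OF p lt] by (intro cong_scalar_left cong_scalar_right) (rule cong_sym)
    also have "(-1) ^ k * int (?n choose k) * (((-1) ^ i * int ((p - 1 - e) choose i)) * t ^ i) =
      (-1) ^ (k + i) * t ^ i * (int (?n choose k) * int ((p - 1 - e) choose i))"
      by (simp only: power_add mult_ac)
    also have "\<dots> = int ((k + i) choose k) * t ^ i * ((-1) ^ (k + i) * int (?n choose (k + i)))"
      unfolding ch by (simp only: mult_ac)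
    finally have fin: "[(-1) ^ k * int (?n choose k) * (int ((e + i) choose i) * t ^ i) =
      int ((k + i) choose k) * t ^ i * ((-1) ^ (k + i) * int (?n choose (k + i)))] (mod int p)" .
    have "(e + i) choose e = (e + i) choose i" using binomial_symmetric[of i "e + i"] by simp
    then have A: "sym_mat (p + r) (1, t, 0, 1) e j = int ((e + i) choose i) * t ^ i"
      by (simp add: sym_mat_upper j')
    have B: "sym_mat ?n (1, t, 0, 1) k (k + i) = int ((k + i) choose k) * t ^ i"
      by (simp add: sym_mat_upper)
    have c: "Suc r \<le> j \<and> j < p" using 2 by simp
    show ?thesis unfolding L R if_P[OF c] js e_def[symmetric] A B by (rule fin)
  next
    case 3
    define k' where "k' = j - p"
    have "p dvd (p + k' choose (k + Suc r))" using j k r by (intro prime_dvd_choose_add[OF p]) (auto simp: k'_def)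
    then have "int p dvd int (j choose (k + Suc r))" using 3 by (simp add: k'_def)
    then have "[(-1) ^ k * int (?n choose k) * (int (j choose (k + Suc r)) * t ^ (j - (k + Suc r))) = 0] (mod int p)"
      by (simp add: cong_0_iff)
    then show ?thesis unfolding L R using 3 k r by (auto simp: sym_mat_upper)
  qed
qed

text \<open>The Weyl element reverses the exponents, so each side has at most one term and only
  signs have to match. Their exponents differ by p - 3 - 2r up to an even number, which is even as
  \<open>p\<close> is odd.\<close>

lemma trunc_mat_weyl:
  assumes p: "odd p" and r: "r + 2 \<le> p" and k: "k \<le> p - 2 - r" and j: "j \<le> p + r"
  shows "(\<Sum>l\<in>{0..p + r}. trunc_mat p r k l * sym_mat (p + r) (0, 1, -1, 0) l j) =
    (\<Sum>l\<in>{0..p - 2 - r}. sym_mat (p - 2 - r) (0, 1, -1, 0) k l * trunc_mat p r l j)"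
proof -
  let ?n = "p - 2 - r"
  have "k + Suc r \<le> p + r" using k r by simp
  note L = sum_trunc_mat_left[OF this, of p "\<lambda>l. sym_mat (p + r) (0, 1, -1, 0) l j"]
  note R = sum_trunc_mat_right[OF r, of "sym_mat ?n (0, 1, -1, 0) k" j]
  show ?thesis
  proof (cases "k + Suc r + j = p + r")
    case True
    then have js: "j - Suc r = ?n - k" "Suc r \<le> j" "j < p" "?n - (?n - k) = k" "p + r - j = k + Suc r"
      using k r by auto
    have sign: "(-1 :: int) ^ k * (-1) ^ (k + Suc r) = (-1) ^ k * (-1) ^ (?n - k)"
    proof -
      have "even (k + (k + Suc r)) \<longleftrightarrow> even (k + (?n - k))" using p r k by auto
      then show ?thesis unfolding power_add[symmetric] by (metis neg_one_even_power neg_one_odd_power)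
    qed
    have A: "sym_mat (p + r) (0, 1, -1, 0) (k + Suc r) j = (-1) ^ (k + Suc r)"
      "sym_mat ?n (0, 1, -1, 0) k (?n - k) = (-1) ^ k"
      unfolding sym_mat_weyl js(4,5) by (simp_all only: refl if_True)
    have c: "Suc r \<le> j \<and> j < p" using js by simp
    have C: "?n choose (?n - k) = ?n choose k" using binomial_symmetric[OF k] by simp
    have "x * z * y = x * (w * z)" if "x * y = x * w" for x y z w :: int
      using that by (metis mult.assoc mult.commute)
    from this[OF sign] show ?thesis unfolding L R if_P[OF c] js(1) A C .
  next
    case False
    then have "k + Suc r \<noteq> p + r - j" using j by simp
    moreover have "k \<noteq> ?n - (j - Suc r)" if "Suc r \<le> j" "j < p" using that False r by auto
    ultimately show ?thesis unfolding L R by (auto simp: sym_mat_weyl)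
  qed
qed

context prime_subfield
begin

text \<open>Conjugation by the Weyl element turns upper into lower unipotents, and a matrix with
  invertible lower left entry is a product upper, lower, upper. This serves the truncation, which is
  verified on generators only.\<close>

lemma SLF_generated:
  assumes mult: "\<And>g h. g \<in> carrier SLF \<Longrightarrow> h \<in> carrier SLF \<Longrightarrow> P g \<Longrightarrow> P h \<Longrightarrow> P (g \<otimes>\<^bsub>SLF\<^esub> h)"
    and upper: "\<And>t. P (mat2_emb (1, t, 0, 1))" and weyl: "P (mat2_emb (0, 1, -1, 0))"
    and g: "g \<in> carrier SLF"
  shows "P g"
proof -
  have PM: "P (mat2_emb (mat2_mult q q')) \<and> mat2_mult q q' \<in> SLp"
    if "P (mat2_emb q) \<and> q \<in> SLp" "P (mat2_emb q') \<and> q' \<in> SLp" for q q'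
    using mult[of "mat2_emb q" "mat2_emb q'"] that mat2_emb_in SLp_mult[of q q'] by (simp only: mat2_emb_mult)
  have U: "P (mat2_emb (1, t, 0, 1)) \<and> (1, t, 0, 1) \<in> SLp" for t using upper by (simp add: SLp_def)
  have W: "P (mat2_emb (0, 1, -1, 0)) \<and> (0, 1, -1, 0) \<in> SLp" using weyl by (simp add: SLp_def)
  \<comment> \<open>With w the Weyl element, the lower unipotent is w u(-t) w^3, and w^3 is the
    inverse of w.\<close>
  have Lo: "P (mat2_emb (1, 0, t, 1)) \<and> (1, 0, t, 1) \<in> SLp" for t
    using PM[OF W PM[OF U[of "-t"] PM[OF W PM[OF W W]]]] by simp
  have main: "P (mat2_emb (a, b, c, d))" if q: "(a, b, c, d) \<in> SLp" and c: "\<not> int p dvd c" for a b c d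
  proof -
    have "coprime c (int p)" using c prime_p by (metis coprime_commute prime_imp_coprime prime_int_nat_transfer prime_nat_int_transfer)
    then obtain c' where "[c * c' = 1] (mod int p)" using cong_solve_coprime_int by blast
    then obtain u where u: "c * c' = 1 + int p * u" by (metis cong_iff_lin cong_sym)
    obtain v where v: "a * d - b * c = 1 + int p * v" using q by (auto simp: SLp_def) (metis cong_iff_lin cong_sym)
    \<comment> \<open>The upper factors are forced by the product: with \<open>c'\<close> inverse to
      \<open>c\<close> modulo \<open>p\<close>, the diagonal entries \<open>a\<close> and
      \<open>d\<close> require the parameters (a - 1) c' and c' (d - 1); the entry \<open>b\<close>
      then follows from the determinant.\<close>
    let ?q = "mat2_mult (1, (a - 1) * c', 0, 1) (mat2_mult (1, 0, c, 1) (1, c' * (d - 1), 0, 1))"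
    have P: "P (mat2_emb ?q)" using PM[OF U PM[OF Lo U]] by blast
    have E0: "c * c' - (1 + int p * u) = 0" "a * d - b * c - (1 + int p * v) = 0" using u v by auto
    have "1 + (a - 1) * c' * c - a = int p * (u * (a - 1)) + (a - 1) * (c * c' - (1 + int p * u))"
      by (simp add: algebra_simps)
    moreover have "c' * (d - 1) + (a - 1) * c' * (c * (c' * (d - 1)) + 1) - b =
        int p * (b * u + v * c' + u * (a - 1) * (d - 1) * c') +
        c' * (a * d - b * c - (1 + int p * v)) + b * (c * c' - (1 + int p * u)) +
        (d - 1) * (a - 1) * c' * (c * c' - (1 + int p * u))"
      by (simp add: algebra_simps)
    moreover have "c * (c' * (d - 1)) + 1 - d = int p * (u * (d - 1)) + (d - 1) * (c * c' - (1 + int p * u))"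
      by (simp add: algebra_simps)
    ultimately have "1 + (a - 1) * c' * c - a = int p * (u * (a - 1))"
      "c' * (d - 1) + (a - 1) * c' * (c * (c' * (d - 1)) + 1) - b =
        int p * (b * u + v * c' + u * (a - 1) * (d - 1) * c')"
      "c * (c' * (d - 1)) + 1 - d = int p * (u * (d - 1))"
      unfolding E0 by simp_all
    then have "int p dvd 1 + (a - 1) * c' * c - a"
      "int p dvd c' * (d - 1) + (a - 1) * c' * (c * (c' * (d - 1)) + 1) - b"
      "int p dvd c * (c' * (d - 1)) + 1 - d"
      by (simp_all only: dvd_triv_left)
    then have "mat2_emb ?q = mat2_emb (a, b, c, d)"
      by (simp add: mat2_emb_eq cong_iff_dvd_diff)
    then show ?thesis using P by simp
  qed
  obtain a b c d where q: "(a, b, c, d) \<in> SLp" "g = mat2_emb (a, b, c, d)"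
    using g by (auto simp: carrier_SLF)
  show ?thesis
  proof (cases "int p dvd c")
    case True
    have "\<not> int p dvd a"
    proof
      assume "int p dvd a"
      then have "int p dvd a * d - b * c" using True by simp
      then have "int p dvd 1" using q(1) by (auto simp: SLp_def cong_dvd_iff)
      then show False using prime_p by (simp add: zdvd1_eq)
    qed
    \<comment> \<open>If \<open>c\<close> vanishes modulo \<open>p\<close>, then \<open>a\<close>
      does not, and multiplying by a lower unipotent from the left replaces \<open>c\<close> by the
      unit a + c.\<close>
    then have "\<not> int p dvd a + c" using True by (simp add: dvd_add_left_iff)
    moreover have "mat2_mult (1, 0, 1, 1) (a, b, c, d) \<in> SLp" using SLp_mult[of "(1,0,1,1)"] Lo[of 1] q(1) by blast
    ultimately have "P (mat2_emb (a, b, a + c, b + d)) \<and> (a, b, a + c, b + d) \<in> SLp" using main by simp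
    from PM[OF Lo[of "-1"] this] show ?thesis using q by simp
  qed (use main q in simp)
qed

lemma has_factors_sym_large:
  assumes p: "odd p" and r: "r + 2 \<le> p"
    and A: "has_factors SLF R L (tensor_mod 1 r) as" and B: "has_factors SLF R L (sym_mod (p - 2 - r)) bs"
  shows "has_factors SLF R L (sym_mod (p + r)) (as @ bs)"
proof -
  let ?n = "p - 2 - r"
  \<comment> \<open>The degree p - 2 - r is below \<open>p\<close>, so the nonzero entries of
    \<open>trunc_mat\<close> are units modulo \<open>p\<close>; their inverses define the splitting
    \<open>s\<close>.\<close>
  have "\<exists>c. [int (?n choose k) * c = 1] (mod int p)" if "k \<le> ?n" for k
  proof -
    have "\<not> p dvd (?n choose k)"
    proof
      assume "p dvd (?n choose k)"
      also have "(?n choose k) dvd fact ?n"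
        using binomial_fact_lemma[OF that] by (metis dvd_triv_right)
      finally show False using prime_dvd_fact_iff[OF prime_p, of ?n] r by simp
    qed
    then have "coprime (int (?n choose k)) (int p)"
      using prime_p by (metis coprime_commute coprime_int_iff prime_imp_coprime)
    then show ?thesis by (rule cong_solve_coprime_int)
  qed
  then obtain c where c: "\<And>k. k \<le> ?n \<Longrightarrow> [int (?n choose k) * c k = 1] (mod int p)" by metis
  define s where "s j k = of_bool (j = k + Suc r) * ((-1) ^ k * c k)" for j k :: nat
  have sign: "(-1) ^ k * x * ((-1) ^ k * y) = x * y" for k :: nat and x y :: int
    by (metis (no_types, opaque_lifting) left_minus_one_mult_self mult.assoc mult.left_commute)
  have n_lt: "k + Suc r \<le> p + r" if "k \<le> ?n" for k using that r by simp
  have hom: "gmod_hom SLF R (sym_mod (p + r)) (sym_mod ?n) (lin (trunc_mat p r) {0..p + r} {0..?n})"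
  proof (rule lin_gmod_homI[OF realizes_sym realizes_sym])
    fix g v assume g: "g \<in> carrier SLF" and v: "v \<in> {0..p + r} \<rightarrow>\<^sub>E carrier R"
    let ?f = "lin (trunc_mat p r) {0..p + r} {0..?n}"
    \<comment> \<open>The quantifier over \<open>v\<close> belongs to the property spread over the
      group, because the case of a product applies it to \<open>g\<close> at the vector moved by
      \<open>h\<close>.\<close>
    have "\<forall>v\<in>{0..p + r} \<rightarrow>\<^sub>E carrier R. ?f (act (sym_mod (p + r)) g v) = act (sym_mod ?n) g (?f v)"
      using _ _ _ g
    proof (rule SLF_generated)
      fix t
      show "\<forall>v\<in>{0..p + r} \<rightarrow>\<^sub>E carrier R. ?f (act (sym_mod (p + r)) (mat2_emb (1, t, 0, 1)) v) =
          act (sym_mod ?n) (mat2_emb (1, t, 0, 1)) (?f v)"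
        by (intro ballI lin_equivariant[OF realizes_sym realizes_sym] trunc_mat_upper[OF prime_p r]) auto
    next
      show "\<forall>v\<in>{0..p + r} \<rightarrow>\<^sub>E carrier R. ?f (act (sym_mod (p + r)) (mat2_emb (0, 1, -1, 0)) v) =
          act (sym_mod ?n) (mat2_emb (0, 1, -1, 0)) (?f v)"
        by (intro ballI lin_equivariant[OF realizes_sym realizes_sym]) (use trunc_mat_weyl[OF p r] in auto)
    next
      fix g h assume gh: "g \<in> carrier SLF" "h \<in> carrier SLF"
        and eq: "\<forall>v\<in>{0..p + r} \<rightarrow>\<^sub>E carrier R. ?f (act (sym_mod (p + r)) g v) = act (sym_mod ?n) g (?f v)"
          "\<forall>v\<in>{0..p + r} \<rightarrow>\<^sub>E carrier R. ?f (act (sym_mod (p + r)) h v) = act (sym_mod ?n) h (?f v)"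
      interpret M: group_module SLF R "sym_mod (p + r)" by (rule group_module_gmod_of[OF realizes_sym])
      interpret N: group_module SLF R "sym_mod ?n" by (rule group_module_gmod_of[OF realizes_sym])
      show "\<forall>v\<in>{0..p + r} \<rightarrow>\<^sub>E carrier R. ?f (act (sym_mod (p + r)) (g \<otimes>\<^bsub>SLF\<^esub> h) v) =
          act (sym_mod ?n) (g \<otimes>\<^bsub>SLF\<^esub> h) (?f v)"
      proof
        fix v assume v: "v \<in> {0..p + r} \<rightarrow>\<^sub>E carrier R"
        have car: "carrier (sym_mod m) = {0..m} \<rightarrow>\<^sub>E carrier R" for m
          by (simp add: gmod_of_sel realizesD(2)[OF realizes_sym])
        have hv: "act (sym_mod (p + r)) h v \<in> {0..p + r} \<rightarrow>\<^sub>E carrier R"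
          using M.act_closed[OF gh(2), of v] v by (simp only: car)
        have "?f (act (sym_mod (p + r)) (g \<otimes>\<^bsub>SLF\<^esub> h) v) = ?f (act (sym_mod (p + r)) g (act (sym_mod (p + r)) h v))"
          using M.act_mult[OF gh, of v] v by (simp only: car)
        also have "\<dots> = act (sym_mod ?n) g (act (sym_mod ?n) h (?f v))" using eq hv v by simp
        also have "\<dots> = act (sym_mod ?n) (g \<otimes>\<^bsub>SLF\<^esub> h) (?f v)"
          by (rule N.act_mult[OF gh, symmetric]) (simp only: car lin_closed[OF v])
        finally show "?f (act (sym_mod (p + r)) (g \<otimes>\<^bsub>SLF\<^esub> h) v) =
          act (sym_mod ?n) (g \<otimes>\<^bsub>SLF\<^esub> h) (?f v)" .
      qed
    qed
    then show "?f (act (sym_mod (p + r)) g v) = act (sym_mod ?n) g (?f v)" using v by blast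
  qed
  show ?thesis
  proof (rule has_factors_split[OF realizes_tensor_sym realizes_sym realizes_sym
        lin_gmod_hom_matrix[OF realizes_tensor_sym realizes_sym] hom _ _ _ _ A B,
        where t = "\<lambda>x k. frob_mat p k x" and s = s])
    fix q k and y :: "nat \<times> nat" assume "y \<in> {0..1} \<times> {0..r}" "k \<in> {0..p + r}"
    then show "[(\<Sum>x\<in>{0..1} \<times> {0..r}. frob_mat p k x * tensor_mat 1 r q x y) =
        (\<Sum>l\<in>{0..p + r}. sym_mat (p + r) q k l * frob_mat p l y)] (mod int p)"
      using r by (intro frob_mat_equivariant[OF prime_p]) auto
  next
    fix x y :: "nat \<times> nat" assume xy: "x \<in> {0..1} \<times> {0..r}" "y \<in> {0..1} \<times> {0..r}"
    have "p * fst x + snd x = p * fst y + snd y \<longleftrightarrow> y = x"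
    proof
      assume eq: "p * fst x + snd x = p * fst y + snd y"
      have lt: "snd x < p" "snd y < p" using xy r by auto
      have "snd x = snd y" using arg_cong[OF eq, of "\<lambda>z. z mod p"] lt by simp
      moreover have "fst x = fst y" using arg_cong[OF eq, of "\<lambda>z. z div p"] lt by simp
      ultimately show "y = x" by (simp add: prod_eq_iff)
    qed simp
    then show "[(\<Sum>j\<in>{0..p + r}. frob_mat p j x * frob_mat p j y) = (if y = x then 1 else 0)] (mod int p)"
      unfolding sum_frob_mat_right[OF xy(2)] by (auto simp: frob_mat_def)
  next
    fix k k' assume k: "k \<in> {0..?n}" "k' \<in> {0..?n}"
    have "(\<Sum>j\<in>{0..p + r}. trunc_mat p r k j * s j k') = (-1) ^ k * int (?n choose k) * s (k + Suc r) k'"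
      using k n_lt by (intro sum_trunc_mat_left) auto
    also have "\<dots> = (if k' = k then int (?n choose k) * c k else 0)" by (auto simp: s_def sign)
    finally show "[(\<Sum>j\<in>{0..p + r}. trunc_mat p r k j * s j k') = (if k' = k then 1 else 0)] (mod int p)"
      using c[of k] k by simp
  next
    fix k and y :: "nat \<times> nat" assume k: "k \<in> {0..?n}" and y: "y \<in> {0..1} \<times> {0..r}"
    have "k + Suc r < p" using k r by auto
    \<comment> \<open>Exponents in the image of the Frobenius map are at most \<open>r\<close> or at
      least \<open>p\<close>; the truncation sees exactly those from r + 1 to p - 1.\<close>
    then have "k + Suc r \<noteq> p * fst y + snd y" using y by (cases "fst y") auto
    then show "[(\<Sum>j\<in>{0..p + r}. trunc_mat p r k j * frob_mat p j y) = 0] (mod int p)"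
      unfolding sum_frob_mat_right[OF y] by (simp add: trunc_mat_def)
  next
    fix j j' assume j: "j \<in> {0..p + r}" "j' \<in> {0..p + r}"
    have "(\<Sum>x\<in>{0..1} \<times> {0..r}. frob_mat p j x * frob_mat p j' x) = of_bool (j' = j \<and> (j \<le> r \<or> p \<le> j))"
      using sum_frob_mat_left[of r p j "frob_mat p j'"] j r by (auto simp: frob_mat_def)
    moreover have "[(\<Sum>k\<in>{0..?n}. s j k * trunc_mat p r k j') = of_bool (j' = j \<and> r < j \<and> j < p)] (mod int p)"
    proof -
      have "(\<Sum>k\<in>{0..?n}. s j k * trunc_mat p r k j') =
          (if Suc r \<le> j' \<and> j' < p then s j (j' - Suc r) * ((-1) ^ (j' - Suc r) * int (?n choose (j' - Suc r))) else 0)"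
        by (rule sum_trunc_mat_right[OF r])
      also have "\<dots> = (if j' = j \<and> r < j \<and> j < p then int (?n choose (j - Suc r)) * c (j - Suc r) else 0)"
        by (auto simp: s_def sign mult.commute)
      finally show ?thesis using c[of "j - Suc r"] r by auto
    qed
    ultimately have "[(\<Sum>x\<in>{0..1} \<times> {0..r}. frob_mat p j x * frob_mat p j' x) +
        (\<Sum>k\<in>{0..?n}. s j k * trunc_mat p r k j') =
        of_bool (j' = j \<and> (j \<le> r \<or> p \<le> j)) + of_bool (j' = j \<and> r < j \<and> j < p)] (mod int p)"
      by (intro cong_add) simp_all
    also have "of_bool (j' = j \<and> (j \<le> r \<or> p \<le> j)) + of_bool (j' = j \<and> r < j \<and> j < p) = (if j' = j then 1 else 0 :: int)"
      using r by auto
    finally show "[(\<Sum>x\<in>{0..1} \<times> {0..r}. frob_mat p j x * frob_mat p j' x) +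
        (\<Sum>k\<in>{0..?n}. s j k * trunc_mat p r k j') = (if j' = j then 1 else 0)] (mod int p)" .
  qed
qed

end

text \<open>The composition factors of a tensor product of two symmetric powers, if \<open>S k\<close> lists those of
  the \<open>k\<close>th symmetric power.\<close>

fun tensor_factors :: "(nat \<Rightarrow> nat list) \<Rightarrow> nat \<Rightarrow> nat \<Rightarrow> nat list" where
  "tensor_factors S (Suc m) (Suc n) = tensor_factors S m n @ S (Suc m + Suc n)"
| "tensor_factors S m n = S (m + n)"

text \<open>Intended for \<open>k \<le> 2 * p - 2\<close>, the largest degree met in V(a) \<otimes>
  V(w). With r = k - p the tensor product with V(1) involves only degrees up to r + 1 < p, so
  singleton lists suffice inside, and 2p - 2 - k is p - 2 - r.\<close>

definition sym_factors :: "nat \<Rightarrow> nat \<Rightarrow> nat list" where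
  "sym_factors p k = (if k < p then [k] else tensor_factors (\<lambda>k. [k]) 1 (k - p) @ [2 * p - 2 - k])"

section \<open>Irreducibility\<close>

lemma sym_mat_lower: "j \<le> n \<Longrightarrow> sym_mat n (1, 0, 1, 1) i j = (if j \<le> i \<and> i \<le> n then int ((n - j) choose (i - j)) else 0)"
proof -
  assume j: "j \<le> n"
  have "sym_poly n j (1, 0, 1, 1) = monom 1 j * [:1, 1:] ^ (n - j)"
    by (simp add: monom_altdef mult.commute)
  then have "sym_mat n (1, 0, 1, 1) i j = (if j \<le> i then coeff ([:1, 1:] ^ (n - j)) (i - j) else 0)"
    unfolding sym_mat_def by (simp only: coeff_monom_mult) auto
  moreover have "coeff ([:1, 1:] ^ (n - j)) (i - j) = (0 :: int)" if "n < i"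
  proof -
    have "degree ([:1, 1 :: int:] ^ (n - j)) \<le> n - j" using degree_linear_powers[of 1 1 "n - j" 0 0 0] by simp
    also have "\<dots> < i - j" using that j by linarith
    finally show ?thesis by (rule coeff_eq_0)
  qed
  moreover have "coeff ([:1, 1:] ^ (n - j)) (i - j) = int ((n - j) choose (i - j))" if "i \<le> n" "j \<le> i"
    using coeff_linear_poly_power[of "i - j" "n - j" "1::int" 1] that by simp
  ultimately show ?thesis by auto
qed

context prime_subfield
begin

text \<open>The operator q - 1. It preserves submodules and commutes with homomorphisms, and for
  unipotent \<open>q\<close> it moves the exponents in one direction.\<close>

definition shift_op :: "int_mat2 \<Rightarrow> nat \<Rightarrow> (nat \<Rightarrow> 'k) \<Rightarrow> nat \<Rightarrow> 'k" where
  "shift_op q n = lin (\<lambda>i j. sym_mat n q i j - (if j = i then 1 else 0)) {0..n} {0..n}"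

lemma sym_mod_sel:
  "carrier (sym_mod n) = {0..n} \<rightarrow>\<^sub>E carrier R"
  "\<zero>\<^bsub>sym_mod n\<^esub> = (\<lambda>i\<in>{0..n}. \<zero>)"
  "v \<oplus>\<^bsub>sym_mod n\<^esub> w = (\<lambda>i\<in>{0..n}. v i \<oplus> w i)"
  "c \<odot>\<^bsub>sym_mod n\<^esub> v = (\<lambda>i\<in>{0..n}. c \<otimes> v i)"
  by (simp_all add: gmod_of_sel realizesD(2)[OF realizes_sym])

lemma group_module_sym: "group_module SLF R (sym_mod n)"
  by (rule group_module_gmod_of[OF realizes_sym])

lemma shift_op_closed: "v \<in> {0..n} \<rightarrow>\<^sub>E carrier R \<Longrightarrow> shift_op q n v \<in> {0..n} \<rightarrow>\<^sub>E carrier R"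
  unfolding shift_op_def by (rule lin_closed)

lemma shift_op_eq:
  assumes v: "v \<in> {0..n} \<rightarrow>\<^sub>E carrier R"
  shows "shift_op q n v = act (sym_mod n) (mat2_emb q) v \<oplus>\<^bsub>sym_mod n\<^esub> ((\<ominus> \<one>) \<odot>\<^bsub>sym_mod n\<^esub> v)"
proof -
  have "lin (\<lambda>i j. - (if j = i then 1 else 0)) {0..n} {0..n} v i = \<ominus> v i" if "i \<in> {0..n}" for i
  proof -
    have "v i \<in> carrier R" using v that by auto
    then show ?thesis
      using lin_at[OF v _ that that, of "\<lambda>i j. - (if j = i then 1 else 0)"] by (simp add: emb_minus l_minus)
  qed
  moreover have "shift_op q n v = (\<lambda>i\<in>{0..n}. lin (sym_mat n q) {0..n} {0..n} v i \<oplus>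
      lin (\<lambda>i j. - (if j = i then 1 else 0)) {0..n} {0..n} v i)"
    using lin_plus[OF v, of "sym_mat n q" "\<lambda>i j. - (if j = i then 1 else 0)"] by (simp add: shift_op_def)
  ultimately have "shift_op q n v = (\<lambda>i\<in>{0..n}. lin (sym_mat n q) {0..n} {0..n} v i \<oplus> \<ominus> v i)"
    by (auto intro!: restrict_ext)
  moreover have "(\<ominus> \<one>) \<otimes> v i = \<ominus> v i" if "i \<in> {0..n}" for i
  proof -
    have "v i \<in> carrier R" using v that by auto
    then show ?thesis by (simp add: l_minus)
  qed
  ultimately show ?thesis unfolding act_gmod_of[OF realizes_sym v] sym_mod_sel
    by (auto intro!: restrict_ext)
qed

lemma shift_op_mem:
  assumes N: "gsubmodule SLF R (sym_mod n) N" and q: "q \<in> SLp" and v: "v \<in> N"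
  shows "shift_op q n v \<in> N"
proof -
  note D = gsubmoduleD[OF group_module_sym N]
  have "v \<in> {0..n} \<rightarrow>\<^sub>E carrier R" using D(1) v by (auto simp: sym_mod_sel)
  then show ?thesis using D(3)[OF D(6)[OF mat2_emb_in[OF q] v] D(4)[of "\<ominus> \<one>" v]] v
    by (simp add: shift_op_eq)
qed

lemma emb_nonzero: "0 < k \<Longrightarrow> k < p \<Longrightarrow> emb (int k) \<noteq> \<zero>"
  by (simp add: emb_eq_0_iff nat_dvd_not_less)

text \<open>The operator \<open>u - 1\<close>, with \<open>u\<close> upper unipotent, lowers the degree in \<open>y\<close>.\<close>

definition top_at :: "nat \<Rightarrow> nat \<Rightarrow> (nat \<Rightarrow> 'k) \<Rightarrow> bool" where
  "top_at n t v \<longleftrightarrow> v \<in> {0..n} \<rightarrow>\<^sub>E carrier R \<and> (\<forall>i\<in>{0..n}. t \<le> i \<longrightarrow> v i = \<zero>)"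

lemma upper_shift_entry:
  "j \<le> i \<Longrightarrow> sym_mat n (1, 1, 0, 1) i j - (if j = i then 1 else 0) = 0"
  by (simp add: sym_mat_upper)

lemma top_at_upper:
  assumes "top_at n (Suc t) v"
  shows "top_at n t (shift_op (1, 1, 0, 1) n v)"
proof -
  have v: "v \<in> {0..n} \<rightarrow>\<^sub>E carrier R" and z: "\<And>i. i \<in> {0..n} \<Longrightarrow> Suc t \<le> i \<Longrightarrow> v i = \<zero>"
    using assms by (auto simp: top_at_def)
  have "shift_op (1, 1, 0, 1) n v i = \<zero>" if i: "i \<in> {0..n}" "t \<le> i" for i
    unfolding shift_op_def
  proof (rule lin_zero_at[OF v i(1)])
    fix j assume j: "j \<in> {0..n}"
    show "emb (sym_mat n (1, 1, 0, 1) i j - (if j = i then 1 else 0)) = \<zero> \<or> v j = \<zero>"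
    proof (cases "Suc t \<le> j")
      case False
      then have "j \<le> i" using i by simp
      then show ?thesis using upper_shift_entry by simp
    qed (use z j in simp)
  qed
  then show ?thesis using shift_op_closed[OF v] by (simp add: top_at_def)
qed

lemma upper_shift_coeff:
  assumes "top_at n (Suc (Suc t)) v" "Suc t \<le> n"
  shows "shift_op (1, 1, 0, 1) n v t = emb (int (Suc t)) \<otimes> v (Suc t)"
proof -
  have v: "v \<in> {0..n} \<rightarrow>\<^sub>E carrier R" and z: "\<And>i. i \<in> {0..n} \<Longrightarrow> Suc (Suc t) \<le> i \<Longrightarrow> v i = \<zero>"
    using assms by (auto simp: top_at_def)
  have "shift_op (1, 1, 0, 1) n v t =
      emb (sym_mat n (1, 1, 0, 1) t (Suc t) - (if Suc t = t then 1 else 0)) \<otimes> v (Suc t)"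
    unfolding shift_op_def
  proof (rule lin_at[OF v])
    fix j assume j: "j \<in> {0..n}" "j \<noteq> Suc t"
    show "emb (sym_mat n (1, 1, 0, 1) t j - (if j = t then 1 else 0)) = \<zero> \<or> v j = \<zero>"
    proof (cases "Suc (Suc t) \<le> j")
      case False
      then have "j \<le> t" using j by simp
      then show ?thesis using upper_shift_entry by simp
    qed (use z j in simp)
  qed (use assms(2) in auto)
  then show ?thesis by (simp add: sym_mat_upper)
qed

text \<open>For the lower unipotent, q - 1 raises the lowest exponent by one. The new lowest
  coefficient acquires the factor \<open>n - t\<close>, which is nonzero in the field as long as n <
  p.\<close>

lemma bottom_shift_coeff:
  assumes v: "v \<in> {0..n} \<rightarrow>\<^sub>E carrier R" and z: "\<And>i. i < t \<Longrightarrow> v i = \<zero>" and t: "t < n"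
  shows "shift_op (1, 0, 1, 1) n v (Suc t) = emb (int (n - t)) \<otimes> v t"
    and "\<And>i. i < Suc t \<Longrightarrow> shift_op (1, 0, 1, 1) n v i = \<zero>"
proof -
  have e: "sym_mat n (1, 0, 1, 1) i j - (if j = i then 1 else 0) = 0" if "i \<le> j" "j \<le> n" for i j
    using that by (simp add: sym_mat_lower)
  have "shift_op (1, 0, 1, 1) n v (Suc t) =
      emb (sym_mat n (1, 0, 1, 1) (Suc t) t - (if t = Suc t then 1 else 0)) \<otimes> v t"
    unfolding shift_op_def
  proof (rule lin_at[OF v])
    fix j assume j: "j \<in> {0..n}" "j \<noteq> t"
    then show "emb (sym_mat n (1, 0, 1, 1) (Suc t) j - (if j = Suc t then 1 else 0)) = \<zero> \<or> v j = \<zero>"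
      using z[of j] e[of "Suc t" j] by (cases "j < t") simp_all
  qed (use t in auto)
  then show "shift_op (1, 0, 1, 1) n v (Suc t) = emb (int (n - t)) \<otimes> v t"
    using t by (simp add: sym_mat_lower)
  fix i assume i: "i < Suc t"
  show "shift_op (1, 0, 1, 1) n v i = \<zero>"
    unfolding shift_op_def
  proof (rule lin_zero_at[OF v])
    fix j assume j: "j \<in> {0..n}"
    then show "emb (sym_mat n (1, 0, 1, 1) i j - (if j = i then 1 else 0)) = \<zero> \<or> v j = \<zero>"
      using z[of j] e[of i j] i by (cases "j < t") simp_all
  qed (use i t in auto)
qed

text \<open>Lowering a nonzero vector of \<open>N\<close> repeatedly gives one with nonzero
  coefficient at 0; raising that one gives, for each \<open>k\<close>, a vector of \<open>N\<close>
  with lowest exponent exactly \<open>k\<close>. These form a triangular basis. The factors met on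
  the way are integers from 1 to \<open>n\<close>, nonzero because n < p.\<close>

lemma irreducible_sym:
  assumes n: "n < p"
  shows "irreducible_gmod SLF R (sym_mod n)"
proof -
  have SL: "(1, 1, 0, 1) \<in> SLp" "(1, 0, 1, 1) \<in> SLp" by (simp_all add: SLp_def)
  have "N = carrier (sym_mod n)" if N: "gsubmodule SLF R (sym_mod n) N" and nz: "N \<noteq> {\<zero>\<^bsub>sym_mod n\<^esub>}" for N
  proof -
    note D = gsubmoduleD[OF group_module_sym N, unfolded sym_mod_sel]
    obtain v0 where v0: "v0 \<in> N" "v0 \<noteq> \<zero>\<^bsub>sym_mod n\<^esub>" using nz D(2) by (auto simp: sym_mod_sel)
    have v0c: "v0 \<in> {0..n} \<rightarrow>\<^sub>E carrier R" using v0 D(1) by auto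
    have down: "\<exists>w\<in>N. w 0 \<noteq> \<zero>" if "v \<in> N" "top_at n (Suc t) v" "v t \<noteq> \<zero>" "t \<le> n" for t v
      using that
    proof (induction t arbitrary: v)
      case (Suc t)
      let ?w = "shift_op (1, 1, 0, 1) n v"
      have "v (Suc t) \<in> carrier R" using Suc.prems by (auto simp: top_at_def)
      then have "?w t \<noteq> \<zero>"
        using upper_shift_coeff[OF Suc.prems(2,4)] emb_nonzero[of "Suc t"] Suc.prems(3,4) n integral_iff by simp
      then show ?case
        using Suc.IH[of ?w] shift_op_mem[OF N SL(1) Suc.prems(1)] top_at_upper[OF Suc.prems(2)] Suc.prems(4) by simp
    qed blast
    have "\<exists>t\<in>{0..n}. v0 t \<noteq> \<zero>"
    proof (rule ccontr)
      assume "\<not> ?thesis"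
      then have "v0 = (\<lambda>i\<in>{0..n}. \<zero>)" using v0c by (intro PiE_ext[OF v0c]) auto
      then show False using v0(2) by (simp add: sym_mod_sel)
    qed
    then have ne: "{t\<in>{0..n}. v0 t \<noteq> \<zero>} \<noteq> {}" by blast
    define t where "t = Max {t\<in>{0..n}. v0 t \<noteq> \<zero>}"
    have "t \<in> {t\<in>{0..n}. v0 t \<noteq> \<zero>}" unfolding t_def by (rule Max_in) (use ne in auto)
    moreover have "i \<le> t" if "i \<in> {0..n}" "v0 i \<noteq> \<zero>" for i
      unfolding t_def using that by (intro Max_ge) auto
    ultimately obtain w0 where w0: "w0 \<in> N" "w0 0 \<noteq> \<zero>"
      using down[OF v0(1), of t] v0c by (force simp: top_at_def)
    have bottom: "\<exists>w\<in>N. w k \<noteq> \<zero> \<and> (\<forall>i<k. w i = \<zero>)" if "k \<le> n" for k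
      using that
    proof (induction k)
      case 0
      then show ?case using w0 by blast
    next
      case (Suc k)
      then obtain w where w: "w \<in> N" "w k \<noteq> \<zero>" "\<And>i. i < k \<Longrightarrow> w i = \<zero>" by auto
      have wc: "w \<in> {0..n} \<rightarrow>\<^sub>E carrier R" using w D(1) by auto
      then have "w k \<in> carrier R" using Suc.prems by auto
      then have "shift_op (1, 0, 1, 1) n w (Suc k) \<noteq> \<zero>"
        using bottom_shift_coeff(1)[OF wc w(3), of k] emb_nonzero[of "n - k"] n Suc.prems w(2) integral_iff by simp
      then show ?case
        using bottom_shift_coeff(2)[OF wc w(3), of k] Suc.prems shift_op_mem[OF N SL(2) w(1)]
        by (intro bexI[of _ "shift_op (1, 0, 1, 1) n w"]) auto
    qed
    \<comment> \<open>Elimination along the triangular basis, by downward induction on the lowest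
      exponent that may occur in \<open>v\<close>; at k = n + 1 only the zero vector is
      left.\<close>
    have "v \<in> N" if "v \<in> {0..n} \<rightarrow>\<^sub>E carrier R" "\<And>i. i \<in> {0..n} \<Longrightarrow> i < k \<Longrightarrow> v i = \<zero>" "k \<le> Suc n" for k v
      using that(3,1,2)
    proof (induction k arbitrary: v rule: inc_induct)
      case base
      then have "v = (\<lambda>i\<in>{0..n}. \<zero>)" by (intro PiE_ext[OF base(1)]) auto
      then show ?case using D(2) by (simp only:)
    next
      case (step k)
      obtain w where w: "w \<in> N" "w k \<noteq> \<zero>" "\<And>i. i < k \<Longrightarrow> w i = \<zero>" using bottom[of k] step.hyps by auto
      have wc: "w i \<in> carrier R" and vc: "v i \<in> carrier R" if "i \<in> {0..n}" for i
        using PiE_mem[OF subsetD[OF D(1) w(1)] that] PiE_mem[OF step.prems(1) that] by auto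
      have k: "k \<in> {0..n}" using step.hyps by simp
      let ?c = "v k \<otimes> inv (w k)"
      have u: "w k \<in> Units R" using w(2) wc[OF k] field_Units by blast
      have cc: "?c \<in> carrier R" using vc[OF k] u by simp
      let ?d = "\<lambda>i\<in>{0..n}. v i \<oplus> (\<lambda>i\<in>{0..n}. (\<ominus> ?c) \<otimes> w i) i"
      have "?d \<in> N"
      proof (rule step.IH)
        show "?d \<in> {0..n} \<rightarrow>\<^sub>E carrier R" using wc vc cc by auto
        fix i assume i: "i \<in> {0..n}" "i < Suc k"
        show "?d i = \<zero>"
        proof (cases "i = k")
          case True
          have "?c \<otimes> w k = v k" using u vc[OF k] wc[OF k] by (simp add: m_assoc)
          then show ?thesis using True i vc[OF k] cc wc[OF k] by (simp add: l_minus r_neg)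
        next
          case False
          then show ?thesis using i w(3)[of i] step.prems(2)[of i] cc by simp
        qed
      qed
      then have "(\<lambda>i\<in>{0..n}. ?d i \<oplus> (\<lambda>i\<in>{0..n}. ?c \<otimes> w i) i) \<in> N"
        using D(3) D(4)[OF cc w(1)] by blast
      moreover have "(\<lambda>i\<in>{0..n}. ?d i \<oplus> (\<lambda>i\<in>{0..n}. ?c \<otimes> w i) i) = v"
      proof (rule PiE_ext[OF _ step.prems(1)])
        show "(\<lambda>i\<in>{0..n}. ?d i \<oplus> (\<lambda>i\<in>{0..n}. ?c \<otimes> w i) i) \<in> {0..n} \<rightarrow>\<^sub>E carrier R"
          using wc vc cc by auto
        fix i assume i: "i \<in> {0..n}"
        have x: "?c \<otimes> w i \<in> carrier R" using cc wc[OF i] by simp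
        have "(v i \<oplus> \<ominus> (?c \<otimes> w i)) \<oplus> ?c \<otimes> w i = v i"
          using vc[OF i] x by (simp add: a_assoc l_neg)
        then show "(\<lambda>i\<in>{0..n}. ?d i \<oplus> (\<lambda>i\<in>{0..n}. ?c \<otimes> w i) i) i = v i"
          using i cc wc[OF i] by (simp add: l_minus)
      qed
      ultimately show ?case by simp
    qed
    from this[of _ 0] have "{0..n} \<rightarrow>\<^sub>E carrier R \<subseteq> N" by auto
    then show ?thesis using D(1) by (auto simp: sym_mod_sel)
  qed
  moreover have "carrier (sym_mod n) \<noteq> {\<zero>\<^bsub>sym_mod n\<^esub>}"
  proof
    assume "carrier (sym_mod n) = {\<zero>\<^bsub>sym_mod n\<^esub>}"
    moreover have "(\<lambda>i\<in>{0..n}. \<one>) \<in> carrier (sym_mod n)" by (simp add: sym_mod_sel)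
    ultimately have "(\<lambda>i\<in>{0..n}. \<one>) = (\<lambda>i\<in>{0..n}. \<zero>)" by (simp add: sym_mod_sel)
    then have "\<one> = \<zero>" by (metis atLeastAtMost_iff le_refl restrict_apply' zero_le)
    then show False by simp
  qed
  ultimately show ?thesis unfolding irreducible_gmod_def using group_module_sym by blast
qed

section \<open>Symmetric powers of different degrees\<close>

lemma shift_op_iso_commute:
  assumes f: "gmod_hom SLF R (sym_mod m) (sym_mod n) f" and q: "q \<in> SLp"
    and v: "v \<in> {0..m} \<rightarrow>\<^sub>E carrier R"
  shows "f (shift_op q m v) = shift_op q n (f v)"
proof -
  interpret M: group_module SLF R "sym_mod m" by (rule group_module_sym)
  have v': "v \<in> carrier (sym_mod m)" using v by (simp only: sym_mod_sel)
  have fv: "f v \<in> {0..n} \<rightarrow>\<^sub>E carrier R" using gmod_homD(1)[OF f v'] by (simp only: sym_mod_sel)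
  have "f (shift_op q m v) = f (act (sym_mod m) (mat2_emb q) v) \<oplus>\<^bsub>sym_mod n\<^esub> f ((\<ominus> \<one>) \<odot>\<^bsub>sym_mod m\<^esub> v)"
    unfolding shift_op_eq[OF v] using M.act_closed[OF mat2_emb_in[OF q] v'] M.smult_closed[of "\<ominus> \<one>", OF _ v']
    by (intro gmod_homD(2)[OF f]) simp_all
  also have "\<dots> = shift_op q n (f v)"
    unfolding shift_op_eq[OF fv] gmod_homD(4)[OF f mat2_emb_in[OF q] v']
    using gmod_homD(3)[OF f _ v', of "\<ominus> \<one>"] by simp
  finally show ?thesis .
qed

lemma top_at_upper_power: "top_at n (t + k) v \<Longrightarrow> top_at n t ((shift_op (1, 1, 0, 1) n ^^ k) v)"
proof (induction k arbitrary: t)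
  case (Suc k)
  then show ?case using Suc.IH[of "Suc t"] top_at_upper by simp
qed simp

lemma shift_op_power_closed:
  "v \<in> {0..n} \<rightarrow>\<^sub>E carrier R \<Longrightarrow> (shift_op q n ^^ k) v \<in> {0..n} \<rightarrow>\<^sub>E carrier R"
  by (induction k) (simp_all add: shift_op_closed)

lemma upper_shift_power_coeff:
  assumes "top_at n (Suc (t + k)) v" "v (t + k) \<noteq> \<zero>" "t + k \<le> n" "n < p"
  shows "(shift_op (1, 1, 0, 1) n ^^ k) v t \<noteq> \<zero>"
  using assms
proof (induction k arbitrary: t)
  case (Suc k)
  let ?w = "(shift_op (1, 1, 0, 1) n ^^ k) v"
  have w: "?w (Suc t) \<noteq> \<zero>" using Suc.IH[of "Suc t"] Suc.prems by simp
  have top: "top_at n (Suc (Suc t)) ?w" using top_at_upper_power[of n "Suc (Suc t)" k v] Suc.prems by simp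
  have "?w (Suc t) \<in> carrier R" using top Suc.prems by (auto simp: top_at_def)
  then show ?case
    using upper_shift_coeff[OF top] w Suc.prems emb_nonzero[of "Suc t"] integral_iff by simp
qed simp

text \<open>With \<open>u\<close> upper unipotent, (u - 1)^(m + 1) annihilates the
  \<open>m\<close>th symmetric power but not the top basis vector of the \<open>n\<close>th one when
  m < n < p.\<close>

lemma not_isomorphic_sym_less:
  assumes "m < n" "n < p"
  shows "\<not> isomorphic_gmod SLF R (sym_mod n) (sym_mod m)"
proof
  assume "isomorphic_gmod SLF R (sym_mod n) (sym_mod m)"
  then obtain f where f: "gmod_hom SLF R (sym_mod n) (sym_mod m) f"
    "bij_betw f (carrier (sym_mod n)) (carrier (sym_mod m))" by (rule isomorphic_gmodE)
  have q: "(1, 1, 0, 1) \<in> SLp" by (simp add: SLp_def)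
  let ?e = "\<lambda>i\<in>{0..n}. if i = n then \<one> else \<zero>"
  let ?k = "Suc m"
  have e: "?e \<in> {0..n} \<rightarrow>\<^sub>E carrier R" by auto
  let ?u = "(shift_op (1, 1, 0, 1) n ^^ ?k) ?e"
  have u: "?u \<in> {0..n} \<rightarrow>\<^sub>E carrier R" using shift_op_power_closed[OF e] .
  have "top_at n (Suc (n - ?k + ?k)) ?e" using assms e by (simp add: top_at_def)
  then have nz: "?u (n - ?k) \<noteq> \<zero>"
    using upper_shift_power_coeff[of n "n - ?k" ?k ?e] assms by simp
  have comm: "f ((shift_op (1, 1, 0, 1) n ^^ k) ?e) = (shift_op (1, 1, 0, 1) m ^^ k) (f ?e)" for k
    using shift_op_iso_commute[OF f(1) q shift_op_power_closed[OF e]] by (induction k) simp_all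
  have fe: "f ?e \<in> {0..m} \<rightarrow>\<^sub>E carrier R" using gmod_homD(1)[OF f(1), of ?e] e by (simp only: sym_mod_sel)
  have "top_at m (0 + ?k) (f ?e)" using fe by (auto simp: top_at_def)
  then have top: "top_at m 0 (f ?u)" unfolding comm by (rule top_at_upper_power)
  then have "f ?u \<in> {0..m} \<rightarrow>\<^sub>E carrier R" by (simp add: top_at_def)
  then have "f ?u = \<zero>\<^bsub>sym_mod m\<^esub>" unfolding sym_mod_sel
    using top by (intro PiE_ext[of _ "{0..m}" "\<lambda>_. carrier R"]) (auto simp: top_at_def)
  also have "\<dots> = f \<zero>\<^bsub>sym_mod n\<^esub>" using gmod_hom_zero[OF group_module_sym group_module_sym f(1)] by simp
  finally have "?u = \<zero>\<^bsub>sym_mod n\<^esub>"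
  proof (rule inj_onD[OF bij_betw_imp_inj_on[OF f(2)]])
    show "?u \<in> carrier (sym_mod n)" using u by (simp only: sym_mod_sel)
    show "\<zero>\<^bsub>sym_mod n\<^esub> \<in> carrier (sym_mod n)"
      by (rule gsubmoduleD(2)[OF group_module_sym gsubmodule_carrier[OF group_module_sym]])
  qed
  moreover have "n - ?k \<in> {0..n}" by simp
  ultimately have "?u (n - ?k) = \<zero>" by (simp only: sym_mod_sel restrict_apply if_True)
  with nz show False by (rule notE)
qed

lemma isomorphic_sym_iff:
  assumes "m < p" "n < p" "isomorphic_gmod SLF R (sym_mod m) (sym_mod n)"
  shows "m = n"
  using not_isomorphic_sym_less[of m n] not_isomorphic_sym_less[of n m] assms
    isomorphic_gmod_sym[OF group_module_sym assms(3)] by (metis linorder_neqE_nat)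

section \<open>Composition factors of the tensor products\<close>

lemma has_factors_tensor:
  assumes "\<And>k. k \<le> m + n \<Longrightarrow> has_factors SLF R L (sym_mod k) (S k)"
  shows "has_factors SLF R L (tensor_mod m n) (tensor_factors S m n)"
  using assms
proof (induction S m n rule: tensor_factors.induct)
  case (1 S m n)
  have "has_factors SLF R L (tensor_mod m n) (tensor_factors S m n)" by (rule "1.IH", rule "1.prems") simp
  moreover have "has_factors SLF R L (sym_mod (Suc m + Suc n)) (S (Suc m + Suc n))" by (rule "1.prems") simp
  ultimately show ?case unfolding tensor_factors.simps by (rule has_factors_tensor_Suc)
next
  case ("2_1" S n)
  have "has_factors SLF R L (sym_mod n) (S n)" by (rule "2_1.prems") simp
  then show ?case unfolding tensor_factors.simps add_0 by (rule has_factors_tensor_0(1))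
next
  case ("2_2" S m)
  have "has_factors SLF R L (sym_mod m) (S m)" by (rule "2_2.prems") simp
  then show ?case unfolding tensor_factors.simps add_0_right by (cases m) (simp_all add: has_factors_tensor_0)
qed

lemma has_factors_sym:
  assumes "odd p" "k \<le> 2 * p - 2"
  shows "has_factors SLF R sym_mod (sym_mod k) (sym_factors p k)"
proof (cases "k < p")
  case True
  then show ?thesis using has_factors_self[where V = sym_mod and b = k, OF group_module_sym]
    by (simp add: sym_factors_def)
next
  case False
  define r where "r = k - p"
  have r: "r + 2 \<le> p" "k = p + r" using False assms prime_ge_2_nat[OF prime_p] by (auto simp: r_def)
  have "has_factors SLF R sym_mod (tensor_mod 1 r) (tensor_factors (\<lambda>k. [k]) 1 r)"
    using has_factors_self[where V = sym_mod, OF group_module_sym] by (intro has_factors_tensor)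
  from has_factors_sym_large[OF assms(1) r(1) this
      has_factors_self[where V = sym_mod and b = "p - 2 - r", OF group_module_sym]]
  show ?thesis using r by (simp add: sym_factors_def)
qed

lemma comp_mult_tensor:
  assumes "odd p" "a < p" "w < p" "b < p"
  shows "comp_mult SLF R (tensor_mod a w) (sym_mod b) = count_list (tensor_factors (sym_factors p) a w) b"
    and "set (tensor_factors (sym_factors p) a w) \<subseteq> {..<p}"
proof -
  have S: "set (sym_factors p k) \<subseteq> {..<p}" if "k \<le> 2 * p - 2" for k
  proof (cases "k < p")
    case False
    have p2: "2 \<le> p" using prime_ge_2_nat[OF prime_p] .
    then have "set (tensor_factors (\<lambda>k. [k]) 1 (k - p)) \<subseteq> {..<p}"
      using that False by (cases "k - p") auto
    moreover have "2 * p - 2 - k < p" using False p2 by simp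
    ultimately show ?thesis using False by (simp add: sym_factors_def)
  qed (simp add: sym_factors_def)
  have T: "set (tensor_factors (sym_factors p) m n) \<subseteq> {..<p}" if "m + n \<le> 2 * p - 2" for m n
    using that
  proof (induction "sym_factors p" m n rule: tensor_factors.induct)
    case (1 m n)
    then show ?case using S by simp
  qed (use S in simp_all)
  then show sub: "set (tensor_factors (sym_factors p) a w) \<subseteq> {..<p}" using assms by simp
  have "has_factors SLF R sym_mod (tensor_mod a w) (tensor_factors (sym_factors p) a w)"
    using has_factors_sym[OF assms(1)] assms(2,3) by (intro has_factors_tensor) simp
  then show "comp_mult SLF R (tensor_mod a w) (sym_mod b) = count_list (tensor_factors (sym_factors p) a w) b"
    using comp_mult_has_factors[of "{..<p}" SLF R sym_mod] irreducible_sym isomorphic_sym_iff sub assms(4) by blast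
qed

end

section \<open>Chebyshev polynomials and Brauer characters\<close>

text \<open>Chebyshev polynomials of the second kind at x/2: the character of the \<open>n\<close>th
  symmetric power at an element of trace \<open>x\<close>. Unlike the quotient of sines they make
  sense at \<theta> = 0 and \<theta> = pi.\<close>

fun cheb :: "real \<Rightarrow> nat \<Rightarrow> real" where
  "cheb x 0 = 1"
| "cheb x (Suc 0) = x"
| "cheb x (Suc (Suc n)) = x * cheb x (Suc n) - cheb x n"

text \<open>The shadow of the first exact sequence, in the shape of the recursion of
  \<open>tensor_factors\<close>.\<close>

lemma cheb_mult: "cheb x (Suc m) * cheb x (Suc n) = cheb x (Suc m + Suc n) + cheb x m * cheb x n"
proof (induction m rule: induct_nat_012)
  case (ge2 m)
  have "cheb x (Suc (Suc (Suc m))) * cheb x (Suc n) =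
      x * (cheb x (Suc (Suc m)) * cheb x (Suc n)) - cheb x (Suc m) * cheb x (Suc n)"
    by (simp add: algebra_simps)
  also have "\<dots> = x * (cheb x (Suc (Suc m) + Suc n) + cheb x (Suc m) * cheb x n) -
      (cheb x (Suc m + Suc n) + cheb x m * cheb x n)"
    using ge2 by (simp only:)
  also have "\<dots> = cheb x (Suc (Suc (Suc m)) + Suc n) + cheb x (Suc (Suc m)) * cheb x n"
    by (simp add: algebra_simps)
  finally show ?case .
qed (simp_all add: algebra_simps)

text \<open>The weights of the symmetric power of degree n + 2 are those of degree n together with n
  + 2 and -(n + 2).\<close>

lemma cheb_cos_step: "cheb (2 * cos \<theta>) (Suc (Suc n)) = cheb (2 * cos \<theta>) n + 2 * cos (real (n + 2) * \<theta>)"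
proof (induction n rule: induct_nat_012)
  case 0
  have "cos (2 * \<theta>) = 2 * (cos \<theta>)\<^sup>2 - 1" by (rule cos_double_cos)
  then show ?case by (simp add: power2_eq_square algebra_simps)
next
  case 1
  have "cos (3 * \<theta>) = 4 * cos \<theta> ^ 3 - 3 * cos \<theta>" by (rule cos_treble_cos)
  then show ?case by (simp add: power3_eq_cube algebra_simps)
next
  case (ge2 n)
  let ?x = "2 * cos \<theta>"
  have "?x * (2 * cos (real (n + 3) * \<theta>)) = 2 * cos (real (n + 4) * \<theta>) + 2 * cos (real (n + 2) * \<theta>)"
    using cos_times_cos[of \<theta> "real (n + 3) * \<theta>"] cos_minus[of "\<theta> - real (n + 3) * \<theta>"]
    by (simp add: algebra_simps)
  moreover have "cheb ?x (Suc (Suc (Suc (Suc n)))) - cheb ?x (Suc (Suc n)) =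
      ?x * (cheb ?x (Suc (Suc (Suc n))) - cheb ?x (Suc n)) - (cheb ?x (Suc (Suc n)) - cheb ?x n)"
    by (simp add: algebra_simps)
  ultimately show ?case using ge2 by (simp add: algebra_simps)
qed

lemma cheb_sin: "cheb (2 * cos \<theta>) n * sin \<theta> = sin (real (Suc n) * \<theta>)"
proof (induction n rule: induct_nat_012)
  case 1
  show ?case using sin_double[of \<theta>] by simp
next
  case (ge2 n)
  have "2 * cos \<theta> * sin (real (n + 2) * \<theta>) = sin (real (n + 3) * \<theta>) + sin (real (n + 1) * \<theta>)"
    using sin_times_cos[of "real (n + 2) * \<theta>" \<theta>] by (simp add: algebra_simps)
  moreover have "cheb (2 * cos \<theta>) (Suc (Suc n)) * sin \<theta> =
      2 * cos \<theta> * (cheb (2 * cos \<theta>) (Suc n) * sin \<theta>) - cheb (2 * cos \<theta>) n * sin \<theta>"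
    by (simp add: algebra_simps)
  ultimately show ?case unfolding ge2 by (simp add: algebra_simps)
qed simp

lemma cheb_2: "cheb 2 n = real (Suc n)"
  by (induction n rule: induct_nat_012) simp_all

lemma cheb_minus_2: "cheb (-2) n = (-1) ^ n * real (Suc n)"
  by (induction n rule: induct_nat_012) (simp_all add: algebra_simps)

lemma abs_cheb_cos_le: "\<bar>cheb (2 * cos \<theta>) n\<bar> \<le> real (Suc n)"
proof (induction n rule: induct_nat_012)
  case (ge2 n)
  define t where "t = cos (real (n + 2) * \<theta>)"
  have "- 1 \<le> t" "t \<le> 1" unfolding t_def by (rule cos_ge_minus_one, rule cos_le_one)
  moreover have "cheb (2 * cos \<theta>) (Suc (Suc n)) = cheb (2 * cos \<theta>) n + 2 * t"
    by (simp only: cheb_cos_step t_def)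
  ultimately show ?case using ge2(1) by (simp add: abs_le_iff)
qed (simp_all add: abs_mult)

lemma sum_list_cheb_tensor:
  assumes "\<And>k. k \<le> m + n \<Longrightarrow> sum_list (map (cheb x) (S k)) = cheb x k"
  shows "sum_list (map (cheb x) (tensor_factors S m n)) = cheb x m * cheb x n"
  using assms
proof (induction S m n rule: tensor_factors.induct)
  case (1 S m n)
  then show ?case unfolding cheb_mult by simp
qed simp_all

text \<open>The shadow of the Frobenius sequence. Both sides satisfy the Chebyshev recursion in
  \<open>r\<close>, so the hypothesis for r = 0 propagates to all \<open>r\<close>.\<close>

lemma cheb_reflect:
  assumes x: "cheb x p = x + cheb x (p - 2)" and "r + 2 \<le> p"
  shows "cheb x (p + r) = x * cheb x r + cheb x (p - 2 - r)"
  using assms(2)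
proof (induction r rule: induct_nat_012)
  case 0
  then show ?case using x by simp
next
  case 1
  define s where "s = p - 3"
  have s: "p = Suc (Suc (Suc s))" using 1 by (simp add: s_def)
  show ?case using x unfolding s by (simp add: algebra_simps)
next
  case (ge2 r)
  define s where "s = p - 2 - r - 2"
  have s: "p - 2 - r = Suc (Suc s)" using ge2(3) by (simp add: s_def)
  then have "p - 2 - Suc r = Suc s" "p - 2 - Suc (Suc r) = s" by simp_all
  then show ?case using ge2 s by (simp add: algebra_simps)
qed

lemma sum_list_cheb_sym:
  assumes x: "cheb x p = x + cheb x (p - 2)" and k: "k \<le> 2 * p - 2" "2 \<le> p"
  shows "sum_list (map (cheb x) (sym_factors p k)) = cheb x k"
proof (cases "k < p")
  case False
  define r where "r = k - p"
  have r: "k = p + r" "r + 2 \<le> p" "2 * p - 2 - k = p - 2 - r" using False k by (auto simp: r_def)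
  have "sum_list (map (cheb x) (tensor_factors (\<lambda>k. [k]) 1 r)) = x * cheb x r"
    using sum_list_cheb_tensor[of 1 r x "\<lambda>k. [k]"] by simp
  then show ?thesis using cheb_reflect[OF x r(2)] False r by (simp add: sym_factors_def)
qed (simp add: sym_factors_def)

text \<open>The roots of unity of order dividing \<open>p - 1\<close> and \<open>p + 1\<close> are the eigenvalues of the
  elements of order prime to \<open>p\<close> in \<open>SL\<^sub>2(p)\<close>. The weights of \<open>mean_diff\<close> are proportional to the
  sizes of their conjugacy classes, the sign being the value of the Steinberg character.\<close>

definition node :: "nat \<Rightarrow> nat \<Rightarrow> real" where
  "node n j = 2 * pi * real j / real n"

definition mean_diff :: "nat \<Rightarrow> (real \<Rightarrow> real) \<Rightarrow> real" where
  "mean_diff p g = ((\<Sum>j<p - 1. g (node (p - 1) j)) / real (p - 1) -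
    (\<Sum>j<p + 1. g (node (p + 1) j)) / real (p + 1)) / 2"

lemma mean_diff_add: "mean_diff p (\<lambda>\<theta>. f \<theta> + g \<theta>) = mean_diff p f + mean_diff p g"
  by (simp add: mean_diff_def sum.distrib add_divide_distrib diff_divide_distrib del: sum.lessThan_Suc)

lemma mean_diff_cmult: "mean_diff p (\<lambda>\<theta>. c * f \<theta>) = c * mean_diff p f"
  by (simp add: mean_diff_def sum_distrib_left[symmetric] algebra_simps diff_divide_distrib
      del: sum.lessThan_Suc)

lemma mean_diff_diff: "mean_diff p (\<lambda>\<theta>. f \<theta> - g \<theta>) = mean_diff p f - mean_diff p g"
  using mean_diff_add[of p f "\<lambda>\<theta>. - 1 * g \<theta>"] mean_diff_cmult[of p "-1" g] by simp

lemma mean_diff_sum: "mean_diff p (\<lambda>\<theta>. \<Sum>a\<in>A. f a \<theta>) = (\<Sum>a\<in>A. mean_diff p (f a))"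
proof (induction A rule: infinite_finite_induct)
  case (insert a A)
  then show ?case using mean_diff_add[of p "f a" "\<lambda>\<theta>. \<Sum>a\<in>A. f a \<theta>"] by simp
qed (simp_all add: mean_diff_def)

lemma mean_diff_cong:
  assumes "\<And>n j. n \<in> {p - 1, p + 1} \<Longrightarrow> j < n \<Longrightarrow> f (node n j) = g (node n j)"
  shows "mean_diff p f = mean_diff p g"
proof -
  have "(\<Sum>j<p - 1. f (node (p - 1) j)) = (\<Sum>j<p - 1. g (node (p - 1) j))"
    "(\<Sum>j<p + 1. f (node (p + 1) j)) = (\<Sum>j<p + 1. g (node (p + 1) j))"
    using assms by (auto intro!: sum.cong simp del: sum.lessThan_Suc)
  then show ?thesis by (simp only: mean_diff_def)
qed

text \<open>The real part of a geometric sum over powers of an \<open>n\<close>th root of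
  unity.\<close>

lemma sum_cos_nodes:
  assumes "n > 0"
  shows "(\<Sum>j<n. cos (real k * node n j)) = (if n dvd k then real n else 0)"
proof -
  define z where "z = cis (2 * pi * real k / real n)"
  have "cis (real k * node n j) = z ^ j" for j
    by (simp add: z_def DeMoivre node_def field_simps)
  then have "cos (real k * node n j) = Re (z ^ j)" for j by (metis cis.simps(1))
  then have S: "(\<Sum>j<n. cos (real k * node n j)) = Re (\<Sum>j<n. z ^ j)" by simp
  have zn: "z ^ n = 1"
  proof -
    have "z ^ n = cis (2 * pi * real k)" using assms by (simp add: z_def DeMoivre)
    also have "\<dots> = 1" using cis_multiple_2pi[of "real k"] by simp
    finally show ?thesis .
  qed
  show ?thesis
  proof (cases "n dvd k")
    case True
    then obtain m where m: "k = n * m" ..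
    have "2 * pi * real k / real n = 2 * pi * real m" using assms by (simp add: m)
    then have "z = cis (2 * pi * real m)" by (simp only: z_def)
    then have "z = 1" using cis_multiple_2pi[of "real m"] by simp
    then show ?thesis using S True by simp
  next
    case False
    have "z \<noteq> 1"
    proof
      assume "z = 1"
      then have "cos (2 * pi * real k / real n) = 1" by (simp add: z_def complex_eq_iff)
      then obtain m :: int where m: "2 * pi * real k / real n = real_of_int m * 2 * pi"
        by (auto simp: cos_one_2pi_int)
      then have "real k = real_of_int m * real n" using assms by (simp add: field_simps)
      then have "int k = m * int n" by (metis of_int_eq_iff of_int_mult of_int_of_nat_eq)
      then have "int n dvd int k" by simp
      then show False using False by simp
    qed
    then have "(\<Sum>j<n. z ^ j) = 0" using zn by (simp add: sum_gp_strict)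
    then show ?thesis using S False by simp
  qed
qed

text \<open>A frequency contributes 1 if divisible by p - 1 and -1 if divisible by p + 1. Up to 2p -
  2 the multiples are 0, p - 1, 2p - 2 and 0, p + 1; the two contributions of 0 cancel.\<close>

lemma mean_diff_cos:
  assumes "5 \<le> p" "k \<le> 2 * p - 2"
  shows "2 * mean_diff p (\<lambda>\<theta>. cos (real k * \<theta>)) =
    of_bool (k = p - 1) - of_bool (k = p + 1) + of_bool (k = 2 * p - 2)"
proof -
  have "2 * mean_diff p (\<lambda>\<theta>. cos (real k * \<theta>)) = of_bool ((p - 1) dvd k) - of_bool ((p + 1) dvd k)"
  proof -
    have "(\<Sum>j<p - 1. cos (real k * node (p - 1) j)) / real (p - 1) = of_bool ((p - 1) dvd k)"
      using assms(1) sum_cos_nodes[of "p - 1" k] by simp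
    moreover have "(\<Sum>j<p + 1. cos (real k * node (p + 1) j)) / real (p + 1) = of_bool ((p + 1) dvd k)"
      by (subst sum_cos_nodes) (simp_all del: of_nat_add)
    ultimately show ?thesis by (simp add: mean_diff_def del: sum.lessThan_Suc of_nat_add)
  qed
  moreover have "(p - 1) dvd k \<longleftrightarrow> k = 0 \<or> k = p - 1 \<or> k = 2 * p - 2"
  proof
    assume "(p - 1) dvd k"
    then obtain m where m: "k = (p - 1) * m" ..
    have "m \<le> 2"
    proof (rule ccontr)
      assume "\<not> m \<le> 2"
      then have "(p - 1) * 3 \<le> k" unfolding m by (intro mult_le_mono2) simp
      then show False using assms by simp
    qed
    then consider "m = 0" | "m = 1" | "m = 2" by linarith
    then show "k = 0 \<or> k = p - 1 \<or> k = 2 * p - 2" by cases (auto simp: m)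
  next
    assume "k = 0 \<or> k = p - 1 \<or> k = 2 * p - 2"
    moreover have "2 * p - 2 = (p - 1) * 2" by simp
    ultimately show "(p - 1) dvd k" by (metis dvd_0_right dvd_refl dvd_triv_left)
  qed
  moreover have "(p + 1) dvd k \<longleftrightarrow> k = 0 \<or> k = p + 1"
  proof
    assume "(p + 1) dvd k"
    then obtain m where m: "k = (p + 1) * m" ..
    have "m \<le> 1"
    proof (rule ccontr)
      assume "\<not> m \<le> 1"
      then have "(p + 1) * 2 \<le> k" unfolding m by (intro mult_le_mono2) simp
      then show False using assms by simp
    qed
    then show "k = 0 \<or> k = p + 1" by (cases m) (auto simp: m)
  qed auto
  moreover have "p - 1 \<noteq> 0" "p - 1 \<noteq> 2 * p - 2" "p + 1 \<noteq> 0" "2 * p - 2 \<noteq> 0" using assms by auto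
  ultimately show ?thesis by (auto simp: of_bool_def)
qed

text \<open>The characters of the projective covers of the modules \<open>V(b)\<close>, divided by the Steinberg
  character.\<close>

definition proj_char :: "nat \<Rightarrow> nat \<Rightarrow> real \<Rightarrow> real" where
  "proj_char p b \<theta> = (if b = p - 1 then 1
    else 2 * cos (real (p - 1 - b) * \<theta>) - (if b = 0 then 1 else 0))"

lemma mean_diff_cos_cheb_step:
  assumes "5 \<le> p" "c \<le> p - 1" "Suc (Suc a) \<le> p - 1"
  shows "mean_diff p (\<lambda>\<theta>. 2 * cos (real c * \<theta>) * cheb (2 * cos \<theta>) (Suc (Suc a))) =
    mean_diff p (\<lambda>\<theta>. 2 * cos (real c * \<theta>) * cheb (2 * cos \<theta>) a) +
    (of_bool (c + a + 2 = p - 1) - of_bool (c + a + 2 = p + 1) + of_bool (c + a + 2 = 2 * p - 2)) +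
    of_bool (c = 0 \<and> a + 2 = p - 1)"
proof -
  \<comment> \<open>The product of cosines has the frequencies c + a + 2 and d = |c - (a + 2)|. As d
    <= p - 1, the latter counts only if it equals p - 1, that is for c = 0.\<close>
  define d where "d = (if c \<ge> a + 2 then c - (a + 2) else a + 2 - c)"
  have d: "cos (real c * \<theta> - real (a + 2) * \<theta>) = cos (real d * \<theta>)" for \<theta>
  proof (cases "c \<ge> a + 2")
    case True
    then show ?thesis by (simp add: d_def of_nat_diff algebra_simps)
  next
    case False
    then have "real d = real (a + 2) - real c" by (simp add: d_def of_nat_diff)
    then have "real d * \<theta> = - (real c * \<theta> - real (a + 2) * \<theta>)" by (simp only: left_diff_distrib minus_diff_eq)
    then show ?thesis by (metis cos_minus)
  qed
  have e: "2 * cos (real c * \<theta>) * cheb (2 * cos \<theta>) (Suc (Suc a)) =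
      (2 * cos (real c * \<theta>) * cheb (2 * cos \<theta>) a + 2 * cos (real (c + (a + 2)) * \<theta>)) + 2 * cos (real d * \<theta>)" for \<theta>
    unfolding cheb_cos_step d[symmetric]
    using cos_times_cos[of "real c * \<theta>" "real (a + 2) * \<theta>"] by (simp add: algebra_simps)
  have "mean_diff p (\<lambda>\<theta>. 2 * cos (real c * \<theta>) * cheb (2 * cos \<theta>) (Suc (Suc a))) =
      mean_diff p (\<lambda>\<theta>. 2 * cos (real c * \<theta>) * cheb (2 * cos \<theta>) a) +
      2 * mean_diff p (\<lambda>\<theta>. cos (real (c + (a + 2)) * \<theta>)) + 2 * mean_diff p (\<lambda>\<theta>. cos (real d * \<theta>))"
    unfolding e mean_diff_add mean_diff_cmult ..
  also have "2 * mean_diff p (\<lambda>\<theta>. cos (real (c + (a + 2)) * \<theta>)) =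
      of_bool (c + (a + 2) = p - 1) - of_bool (c + (a + 2) = p + 1) + of_bool (c + (a + 2) = 2 * p - 2)"
    using assms by (intro mean_diff_cos) auto
  also have "2 * mean_diff p (\<lambda>\<theta>. cos (real d * \<theta>)) =
      of_bool (d = p - 1) - of_bool (d = p + 1) + of_bool (d = 2 * p - 2)"
    using assms by (intro mean_diff_cos) (auto simp: d_def)
  also have "\<dots> = of_bool (c = 0 \<and> a + 2 = p - 1)"
  proof -
    have "d = p - 1 \<longleftrightarrow> c = 0 \<and> a + 2 = p - 1" "d \<noteq> p + 1" "d \<noteq> 2 * p - 2"
      using assms by (auto simp: d_def)
    then show ?thesis by simp
  qed
  finally show ?thesis by (simp add: add.assoc)
qed

text \<open>Climbing in steps of two, a contribution appears when c + a reaches p - 1 and is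
  cancelled at the next step, where the frequency p + 1 enters with the opposite sign. The last two
  terms are boundary effects at a = p - 1.\<close>

lemma mean_diff_cos_cheb:
  assumes "5 \<le> p" "c \<le> p - 1" "a \<le> p - 1"
  shows "mean_diff p (\<lambda>\<theta>. 2 * cos (real c * \<theta>) * cheb (2 * cos \<theta>) a) =
    of_bool (a + c = p - 1) + of_bool (c = 0 \<and> a = p - 1) + of_bool (c = p - 1 \<and> a = p - 1)"
  using assms(3)
proof (induction a rule: induct_nat_012)
  case 0
  have "mean_diff p (\<lambda>\<theta>. 2 * cos (real c * \<theta>) * cheb (2 * cos \<theta>) 0) = 2 * mean_diff p (\<lambda>\<theta>. cos (real c * \<theta>))"
    using mean_diff_cmult[of p 2 "\<lambda>\<theta>. cos (real c * \<theta>)"] by simp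
  moreover have "c \<noteq> p + 1" "c \<noteq> 2 * p - 2" "c \<le> 2 * p - 2" "p - 1 \<noteq> 0" using assms by auto
  ultimately show ?case using mean_diff_cos[of p c] assms(1) by simp
next
  case 1
  define d where "d = (if c = 0 then 1 else c - 1)"
  have d: "cos (real c * \<theta> - \<theta>) = cos (real d * \<theta>)" for \<theta>
    by (cases c) (simp_all add: d_def algebra_simps)
  have e: "2 * cos (real c * \<theta>) * cheb (2 * cos \<theta>) (Suc 0) = 2 * cos (real (c + 1) * \<theta>) + 2 * cos (real d * \<theta>)" for \<theta>
    unfolding d[symmetric] using cos_times_cos[of "real c * \<theta>" \<theta>] by (simp add: algebra_simps)
  have "mean_diff p (\<lambda>\<theta>. 2 * cos (real c * \<theta>) * cheb (2 * cos \<theta>) (Suc 0)) =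
      2 * mean_diff p (\<lambda>\<theta>. cos (real (c + 1) * \<theta>)) + 2 * mean_diff p (\<lambda>\<theta>. cos (real d * \<theta>))"
    unfolding e mean_diff_add mean_diff_cmult ..
  also have "2 * mean_diff p (\<lambda>\<theta>. cos (real (c + 1) * \<theta>)) =
      of_bool (c + 1 = p - 1) - of_bool (c + 1 = p + 1) + of_bool (c + 1 = 2 * p - 2)"
    using assms by (intro mean_diff_cos) auto
  also have "2 * mean_diff p (\<lambda>\<theta>. cos (real d * \<theta>)) =
      of_bool (d = p - 1) - of_bool (d = p + 1) + of_bool (d = 2 * p - 2)"
    using assms by (intro mean_diff_cos) (auto simp: d_def)
  finally have "mean_diff p (\<lambda>\<theta>. 2 * cos (real c * \<theta>) * cheb (2 * cos \<theta>) (Suc 0)) =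
    of_bool (c + 1 = p - 1) - of_bool (c + 1 = p + 1) + of_bool (c + 1 = 2 * p - 2) +
    (of_bool (d = p - 1) - of_bool (d = p + 1) + of_bool (d = 2 * p - 2))" .
  moreover have "c + 1 \<noteq> p + 1" "c + 1 \<noteq> 2 * p - 2" "d \<noteq> p - 1" "d \<noteq> p + 1" "d \<noteq> 2 * p - 2" "Suc 0 \<noteq> p - 1"
    using assms by (auto simp: d_def)
  ultimately show ?case by (simp add: add.commute)
next
  case (ge2 a)
  have "a \<le> p - 1" using ge2(3) by simp
  note IH = ge2(1)[OF this]
  have "a \<noteq> p - 1" "c + a + 2 = p + 1 \<longleftrightarrow> a + c = p - 1" "c + a + 2 = 2 * p - 2 \<longleftrightarrow> c = p - 1 \<and> a + 2 = p - 1"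
    using ge2(3) assms(1,2) by auto
  then show ?case unfolding mean_diff_cos_cheb_step[OF assms(1,2) ge2(3)] IH
    by (simp add: add.commute)
qed

text \<open>The orthogonality of projective and irreducible Brauer characters. Indeed
  \<open>mean_diff\<close> averages over the group the product with the Steinberg character: j and n
  - j give the same class, and at the two central elements the sums combine to 1/(p^2 - 1), which is
  \<open>p\<close> over the group order.\<close>

lemma proj_char_orthogonal:
  assumes "5 \<le> p" "a < p" "b < p"
  shows "mean_diff p (\<lambda>\<theta>. proj_char p b \<theta> * cheb (2 * cos \<theta>) a) = of_bool (a = b)"
proof -
  have one: "mean_diff p (\<lambda>\<theta>. cheb (2 * cos \<theta>) a) = of_bool (a = p - 1)"
  proof -
    have "2 * mean_diff p (\<lambda>\<theta>. cheb (2 * cos \<theta>) a) = mean_diff p (\<lambda>\<theta>. 2 * cos (real 0 * \<theta>) * cheb (2 * cos \<theta>) a)"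
      unfolding mean_diff_cmult[symmetric] by simp
    also have "\<dots> = 2 * of_bool (a = p - 1)"
      using mean_diff_cos_cheb[of p 0 a] assms by simp
    finally show ?thesis by simp
  qed
  show ?thesis
  proof (cases "b = p - 1")
    case True
    then show ?thesis using one by (simp add: proj_char_def)
  next
    case False
    have "mean_diff p (\<lambda>\<theta>. proj_char p b \<theta> * cheb (2 * cos \<theta>) a) =
        mean_diff p (\<lambda>\<theta>. 2 * cos (real (p - 1 - b) * \<theta>) * cheb (2 * cos \<theta>) a) -
        (if b = 0 then 1 else 0) * mean_diff p (\<lambda>\<theta>. cheb (2 * cos \<theta>) a)"
      unfolding mean_diff_cmult[symmetric] mean_diff_diff[symmetric]
      using False by (simp add: proj_char_def left_diff_distrib)
    also have "\<dots> = of_bool (a = b)"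
    proof -
      have "a + (p - 1 - b) = p - 1 \<longleftrightarrow> a = b" "p - 1 - b \<noteq> 0" "p - 1 - b = p - 1 \<longleftrightarrow> b = 0"
        using assms False by auto
      then show ?thesis using mean_diff_cos_cheb[of p "p - 1 - b" a] one assms(1,2) by simp
    qed
    finally show ?thesis .
  qed
qed

text \<open>Fourier inversion. It will be applied to probabilities divided by dimensions, whose
  combinations with \<open>cheb\<close> are expectations of normalized characters.\<close>

lemma proj_char_inversion:
  assumes "5 \<le> p" "b < p"
  shows "mean_diff p (\<lambda>\<theta>. proj_char p b \<theta> * (\<Sum>a<p. k a * cheb (2 * cos \<theta>) a)) = k b"
proof -
  have "mean_diff p (\<lambda>\<theta>. proj_char p b \<theta> * (\<Sum>a<p. k a * cheb (2 * cos \<theta>) a)) =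
      (\<Sum>a<p. k a * mean_diff p (\<lambda>\<theta>. proj_char p b \<theta> * cheb (2 * cos \<theta>) a))"
    unfolding mean_diff_cmult[symmetric] mean_diff_sum[symmetric] by (simp add: sum_distrib_left mult_ac)
  also have "\<dots> = (\<Sum>a<p. k a * of_bool (a = b))"
    using assms by (intro sum.cong) (simp_all add: proj_char_orthogonal)
  finally show ?thesis using assms(2) by (simp add: of_bool_def if_distrib[of "\<lambda>z. _ * z"] cong: if_cong)
qed

section \<open>The random walk\<close>

lemma sum_list_eq_sum_count_list:
  fixes f :: "'a \<Rightarrow> real"
  assumes "finite B" "set xs \<subseteq> B"
  shows "sum_list (map f xs) = (\<Sum>b\<in>B. real (count_list xs b) * f b)"
  using assms(2)
proof (induction xs)
  case (Cons x xs)
  have "(\<Sum>b\<in>B. real (count_list (x # xs) b) * f b) =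
      (\<Sum>b\<in>B. real (count_list xs b) * f b + (if b = x then f b else 0))"
    by (intro sum.cong) (auto simp: distrib_right)
  also have "\<dots> = (\<Sum>b\<in>B. real (count_list xs b) * f b) + f x"
    using Cons.prems assms(1) by (simp add: sum.distrib)
  finally show ?case using Cons by simp
qed simp

text \<open>From here on the modules are forgotten: the chain is a real matrix whose entries count
  occurrences in the lists of composition factors, and \<open>support\<close> says that no factor
  lies outside the state space.\<close>

locale steinberg_walk =
  fixes p :: nat and K :: "real mat"
  assumes p5: "5 \<le> p" and odd_p: "odd p"
    and K_carrier: "K \<in> carrier_mat p p"
    and K_entry: "a < p \<Longrightarrow> b < p \<Longrightarrow> K $$ (a, b) =
      (real (count_list (tensor_factors (sym_factors p) a (p - 1)) b) * real (b + 1) / (real (a + 1) * real p) +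
       real (count_list (tensor_factors (sym_factors p) a 1) b) * real (b + 1) / (real (a + 1) * 2)) / 2"
    and support: "a < p \<Longrightarrow> w < p \<Longrightarrow> set (tensor_factors (sym_factors p) a w) \<subseteq> {..<p}"
begin

text \<open>For x = 2 cos \<theta> this says cos(p \<theta>) = cos \<theta>. It is the condition
  under which \<open>cheb x\<close> is additive over \<open>sym_factors\<close>.\<close>

definition spectral_point :: "real \<Rightarrow> bool" where
  "spectral_point x \<longleftrightarrow> cheb x p = x + cheb x (p - 2)"

definition eigenvalue :: "real \<Rightarrow> real" where
  "eigenvalue x = (cheb x (p - 1) / real p + x / 2) / 2"

lemma K_nonneg: "a < p \<Longrightarrow> b < p \<Longrightarrow> 0 \<le> K $$ (a, b)"
  by (simp add: K_entry)

lemma sum_count_cheb: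
  assumes x: "spectral_point x" and "a < p" "w < p"
  shows "(\<Sum>b<p. real (count_list (tensor_factors (sym_factors p) a w) b) * cheb x b) = cheb x a * cheb x w"
proof -
  have "sum_list (map (cheb x) (tensor_factors (sym_factors p) a w)) = cheb x a * cheb x w"
    using assms p5 by (intro sum_list_cheb_tensor sum_list_cheb_sym) (auto simp: spectral_point_def)
  then show ?thesis using sum_list_eq_sum_count_list[OF finite_lessThan support[OF assms(2,3)], of "cheb x"] by simp
qed

text \<open>The factor b + 1 in the transition probability cancels the normalization of the
  character, and the remaining sum over composition factors is the character of a tensor product,
  hence a product.\<close>

lemma K_eigenfunction:
  assumes x: "spectral_point x" and a: "a < p"
  shows "(\<Sum>b<p. K $$ (a, b) * (cheb x b / real (b + 1))) = eigenvalue x * (cheb x a / real (a + 1))"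
proof -
  have "(\<Sum>b<p. K $$ (a, b) * (cheb x b / real (b + 1))) =
      (\<Sum>b<p. 1 / (2 * (real (a + 1) * real p)) * (real (count_list (tensor_factors (sym_factors p) a (p - 1)) b) * cheb x b) +
        1 / (2 * (real (a + 1) * 2)) * (real (count_list (tensor_factors (sym_factors p) a 1) b) * cheb x b))"
  proof (rule sum.cong[OF refl])
    fix b assume b: "b \<in> {..<p}"
    have "(c * s / A + d * s / B) / 2 * (u / s) = 1 / (2 * A) * (c * u) + 1 / (2 * B) * (d * u)"
      if "s \<noteq> 0" for c d s A B u :: real
      using that by (simp add: field_simps add_divide_distrib)
    from this[of "real (b + 1)"]
    show "K $$ (a, b) * (cheb x b / real (b + 1)) =
      1 / (2 * (real (a + 1) * real p)) * (real (count_list (tensor_factors (sym_factors p) a (p - 1)) b) * cheb x b) +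
        1 / (2 * (real (a + 1) * 2)) * (real (count_list (tensor_factors (sym_factors p) a 1) b) * cheb x b)"
      unfolding K_entry[OF a b[unfolded lessThan_iff]] by simp
  qed
  also have "\<dots> = 1 / (2 * (real (a + 1) * real p)) * (cheb x a * cheb x (p - 1)) +
      1 / (2 * (real (a + 1) * 2)) * (cheb x a * cheb x 1)"
    unfolding sum.distrib sum_distrib_left[symmetric] using sum_count_cheb[OF x a] p5 by simp
  also have "\<dots> = eigenvalue x * (cheb x a / real (a + 1))"
  proof -
    have "1 / (2 * (s * P)) * (u * v) + 1 / (2 * (s * 2)) * (u * y) = (v / P + y / 2) / 2 * (u / s)"
      if "s \<noteq> 0" "P \<noteq> 0" for s P u v y :: real
      using that by (simp add: field_simps)
    from this[of "real (a + 1)" "real p" "cheb x a" "cheb x (p - 1)" x] p5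
    show ?thesis unfolding eigenvalue_def by simp
  qed
  finally show ?thesis .
qed

section \<open>Distribution of the walk and spectrum\<close>

definition row :: "nat \<Rightarrow> nat \<Rightarrow> real" where
  "row l b = (K ^\<^sub>m l) $$ (0, b)"

lemma row_0: "b < p \<Longrightarrow> row 0 b = (if b = 0 then 1 else 0)"
  using K_carrier p5 by (auto simp: row_def)

lemma row_Suc: "b < p \<Longrightarrow> row (Suc l) b = (\<Sum>a<p. row l a * K $$ (a, b))"
proof -
  assume b: "b < p"
  have "K ^\<^sub>m l \<in> carrier_mat p p" using K_carrier by (rule pow_carrier_mat)
  then show ?thesis
    using b K_carrier p5 by (simp add: row_def scalar_prod_def lessThan_atLeast0)
qed

lemma row_nonneg: "b < p \<Longrightarrow> 0 \<le> row l b"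
  by (induction l arbitrary: b) (auto simp: row_0 row_Suc K_nonneg intro!: sum_nonneg)

lemma row_cheb:
  assumes x: "spectral_point x"
  shows "(\<Sum>b<p. row l b * (cheb x b / real (b + 1))) = eigenvalue x ^ l"
proof (induction l)
  case 0
  have "(\<Sum>b<p. row 0 b * (cheb x b / real (b + 1))) = (\<Sum>b<p. if b = 0 then 1 else 0)"
    by (intro sum.cong) (auto simp: row_0)
  then show ?case using p5 by simp
next
  case (Suc l)
  have "(\<Sum>b<p. row (Suc l) b * (cheb x b / real (b + 1))) =
      (\<Sum>b<p. \<Sum>a<p. row l a * K $$ (a, b) * (cheb x b / real (b + 1)))"
    by (intro sum.cong) (simp_all add: row_Suc sum_distrib_right sum_divide_distrib)
  also have "\<dots> = (\<Sum>a<p. row l a * (\<Sum>b<p. K $$ (a, b) * (cheb x b / real (b + 1))))"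
    by (subst sum.swap) (simp add: sum_distrib_left mult.assoc)
  also have "\<dots> = (\<Sum>a<p. eigenvalue x * (row l a * (cheb x a / real (a + 1))))"
    by (rule sum.cong[OF refl], subst K_eigenfunction[OF x]) simp_all
  also have "\<dots> = eigenvalue x ^ Suc l" unfolding sum_distrib_left[symmetric] Suc by simp
  finally show ?case .
qed

text \<open>At the nodes of p - 1 one has p \<theta> = \<theta> modulo 2 pi, at those of p + 1 one
  has p \<theta> = -\<theta>. The cosines agree in both cases, and the Steinberg character, a
  quotient of sines, is 1 or -1.\<close>

lemma node_cases:
  assumes "n \<in> {p - 1, p + 1}"
  shows "spectral_point (2 * cos (node n j))"
    and "sin (node n j) \<noteq> 0 \<Longrightarrow> \<bar>cheb (2 * cos (node n j)) (p - 1)\<bar> = 1"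
proof -
  let ?t = "node n j"
  have n0: "real n \<noteq> 0" using assms p5 by auto
  have per: "real n * ?t = 2 * pi * real j" using n0 by (simp add: node_def)
  have "cos (2 * pi * real j) = 1" "sin (2 * pi * real j) = 0"
    using cos_2npi[of j] sin_2npi[of j] by (simp_all add: mult_ac)
  then have C: "cos (2 * pi * real j + s) = cos s" "sin (2 * pi * real j + s) = sin s" for s
    by (simp_all add: cos_add sin_add)
  have cp: "cos (real p * ?t) = cos ?t \<and> \<bar>sin (real p * ?t)\<bar> = \<bar>sin ?t\<bar>"
  proof (cases "n = p - 1")
    case True
    then have "real p * ?t = 2 * pi * real j + ?t" using per p5 by (simp add: algebra_simps of_nat_diff)
    then show ?thesis using C[of ?t] by simp
  next
    case False
    then have "n = p + 1" using assms by simp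
    then have "real p * ?t = 2 * pi * real j + (- ?t)" using per by (simp add: algebra_simps)
    then show ?thesis using C[of "- ?t"] by simp
  qed
  have p2: "p = Suc (Suc (p - 2))" "real (p - 2 + 2) = real p" using p5 by auto
  show "spectral_point (2 * cos ?t)"
    unfolding spectral_point_def using cheb_cos_step[of ?t "p - 2"] cp p2 by simp
  assume s: "sin ?t \<noteq> 0"
  have "cheb (2 * cos ?t) (p - 1) * sin ?t = sin (real p * ?t)"
    using cheb_sin[of ?t "p - 1"] p5 by simp
  then have "\<bar>cheb (2 * cos ?t) (p - 1)\<bar> * \<bar>sin ?t\<bar> = 1 * \<bar>sin ?t\<bar>"
    using cp by (simp add: abs_mult[symmetric])
  then show "\<bar>cheb (2 * cos ?t) (p - 1)\<bar> = 1" using s by simp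
qed

definition rate :: real where "rate = (1 + 1 / real p) / 2"

lemma rate_bounds: "0 < rate" "rate < 1"
  using p5 by (auto simp: rate_def field_simps)

lemma eigenvalue_2: "eigenvalue 2 = 1"
  using p5 by (simp add: eigenvalue_def cheb_2 of_nat_diff)

text \<open>If the sine vanishes away from 0, then \<theta> = pi, the central element -1. There the
  normalized characters of V(p - 1) and V(1) are 1 and -1, because \<open>p\<close> is odd, and the
  eigenvalue is 0.\<close>

lemma eigenvalue_bound:
  assumes n: "n \<in> {p - 1, p + 1}" and j: "0 < j" "j < n"
  shows "\<bar>eigenvalue (2 * cos (node n j))\<bar> \<le> rate"
proof (cases "sin (node n j) = 0")
  case False
  have "\<bar>cheb (2 * cos (node n j)) (p - 1) / real p\<bar> = 1 / real p"
    using node_cases(2)[OF n False] by (simp add: abs_divide)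
  moreover have "\<bar>(u + 2 * v / 2) / 2\<bar> \<le> (1 + w) / 2" if "\<bar>u\<bar> = w" "\<bar>v\<bar> \<le> 1" for u v w :: real
    using that abs_triangle_ineq[of u v] by simp
  moreover have "\<bar>cos (node n j)\<bar> \<le> 1" by simp
  ultimately show ?thesis unfolding eigenvalue_def rate_def by blast
next
  case True
  have n0: "0 < real n" using j by simp
  have range: "0 < node n j" "node n j < 2 * pi" using j n0 by (auto simp: node_def field_simps)
  have "node n j = pi"
  proof (rule ccontr)
    assume "node n j \<noteq> pi"
    then consider "node n j < pi" | "pi < node n j" by linarith
    then show False
    proof cases
      case 1
      then show False using sin_gt_zero[of "node n j"] range True by simp
    next
      case 2
      then show False using sin_lt_zero[of "node n j"] range True by simp
    qed
  qed
  then have "eigenvalue (2 * cos (node n j)) = eigenvalue (-2)" by simp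
  also have "\<dots> = 0" using p5 odd_p by (simp add: eigenvalue_def cheb_minus_2 of_nat_diff)
  finally show ?thesis using rate_bounds by simp
qed

definition proj_dim :: "nat \<Rightarrow> real" where
  "proj_dim b = proj_char p b 0"

lemma proj_dim_eq: "proj_dim b = (if b = p - 1 \<or> b = 0 then 1 else 2)"
  using p5 by (auto simp: proj_dim_def proj_char_def)

text \<open>Here \<open>proj_dim\<close> is the dimension of the projective cover of V(b) divided by
  \<open>p\<close>, so this is dim V(b) dim P(b) over the group order: the share of V(b) in the
  regular representation, which is reproduced by tensoring.\<close>

definition pi0 :: "nat \<Rightarrow> real" where
  "pi0 b = real (b + 1) * proj_dim b / (real p ^ 2 - 1)"

lemma p2_pos: "0 < real p ^ 2 - 1"
proof -
  have "1 < real p ^ 2" using p5 by (intro one_less_power) auto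
  then show ?thesis by simp
qed

lemma pi0_pos: "0 < pi0 b"
  using p2_pos by (auto simp: pi0_def proj_dim_eq)

lemma mean_diff_delta:
  "mean_diff p (\<lambda>\<theta>. g \<theta> * (if \<theta> = 0 then 1 else 0)) = g 0 / (real p ^ 2 - 1)"
proof -
  have s: "(\<Sum>j<n. g (node n j) * (if node n j = 0 then 1 else 0)) = g 0" if "0 < n" for n
  proof -
    have "(\<Sum>j<n. g (node n j) * (if node n j = 0 then 1 else 0)) = (\<Sum>j<n. if j = 0 then g 0 else 0)"
      using that by (intro sum.cong) (auto simp: node_def)
    then show ?thesis using that by simp
  qed
  have "mean_diff p (\<lambda>\<theta>. g \<theta> * (if \<theta> = 0 then 1 else 0)) = (g 0 / real (p - 1) - g 0 / real (p + 1)) / 2"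
    unfolding mean_diff_def using s[of "p - 1"] s[of "p + 1"] p5 by simp
  also have "\<dots> = g 0 / (real p ^ 2 - 1)"
  proof -
    have e: "(x / (P - 1) - x / (P + 1)) / 2 = x / (P ^ 2 - 1)" if "P - 1 \<noteq> 0" "P + 1 \<noteq> 0" for x P :: real
    proof -
      have "x / (P - 1) - x / (P + 1) = (x * (P + 1) - x * (P - 1)) / ((P - 1) * (P + 1))"
        using that by (simp add: diff_frac_eq)
      also have "\<dots> = 2 * (x / (P ^ 2 - 1))" by (simp add: power2_eq_square algebra_simps)
      finally have A: "x / (P - 1) - x / (P + 1) = 2 * (x / (P ^ 2 - 1))" .
      show ?thesis unfolding A by (rule nonzero_mult_div_cancel_left) simp
    qed
    have r: "real (p - 1) = real p - 1" "real (p + 1) = real p + 1" using p5 by auto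
    show ?thesis unfolding r using p5 by (intro e) simp_all
  qed
  finally show ?thesis .
qed

lemma stationary_cheb:
  assumes st: "stationary_distribution p K \<mu>" and x: "spectral_point x"
  shows "(\<Sum>a<p. \<mu> a / real (a + 1) * cheb x a) = eigenvalue x * (\<Sum>a<p. \<mu> a / real (a + 1) * cheb x a)"
proof -
  have inv: "\<And>b. b < p \<Longrightarrow> (\<Sum>a<p. \<mu> a * K $$ (a, b)) = \<mu> b"
    using st by (auto simp: stationary_distribution_def)
  have "(\<Sum>b<p. \<mu> b / real (b + 1) * cheb x b) = (\<Sum>b<p. (\<Sum>a<p. \<mu> a * K $$ (a, b)) * (cheb x b / real (b + 1)))"
      by (intro sum.cong) (simp_all add: inv)
    also have "\<dots> = (\<Sum>b<p. \<Sum>a<p. \<mu> a * (K $$ (a, b) * (cheb x b / real (b + 1))))"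
      by (intro sum.cong) (simp_all add: sum_distrib_right sum_divide_distrib mult.assoc)
    also have "\<dots> = (\<Sum>a<p. \<mu> a * (\<Sum>b<p. K $$ (a, b) * (cheb x b / real (b + 1))))"
      by (subst sum.swap) (simp add: sum_distrib_left)
    also have "\<dots> = (\<Sum>a<p. eigenvalue x * (\<mu> a / real (a + 1) * cheb x a))"
      by (rule sum.cong[OF refl], subst K_eigenfunction[OF x]) simp_all
    finally show ?thesis unfolding sum_distrib_left .
qed

text \<open>The pairing with an eigenfunction is multiplied by its eigenvalue, so it vanishes at
  every node but 0, where it is the total mass 1. Fourier inversion then leaves no freedom. Only
  uniqueness is shown here; existence comes with \<mu>.\<close>

lemma stationary_unique:
  assumes st: "stationary_distribution p K \<mu>" and b: "b < p"
  shows "\<mu> b = pi0 b"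
proof -
  have sum1: "(\<Sum>a<p. \<mu> a) = 1" using st by (auto simp: stationary_distribution_def)
  have "\<mu> b / real (b + 1) = mean_diff p (\<lambda>\<theta>. proj_char p b \<theta> * (\<Sum>a<p. \<mu> a / real (a + 1) * cheb (2 * cos \<theta>) a))"
    using proj_char_inversion[OF p5 b, of "\<lambda>a. \<mu> a / real (a + 1)"] by simp
  also have "\<dots> = mean_diff p (\<lambda>\<theta>. proj_char p b \<theta> * (if \<theta> = 0 then 1 else 0))"
  proof (rule mean_diff_cong)
    fix n j assume n: "n \<in> {p - 1, p + 1}" and j: "j < n"
    have "(\<Sum>a<p. \<mu> a / real (a + 1) * cheb (2 * cos (node n j)) a) = (if node n j = 0 then 1 else 0)"
    proof (cases "j = 0")
      case True
      have "(\<Sum>a<p. \<mu> a / real (a + 1) * cheb 2 a) = (\<Sum>a<p. \<mu> a)"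
        by (intro sum.cong) (simp_all add: cheb_2)
      then show ?thesis using True sum1 by (simp add: node_def)
    next
      case False
      then have "\<bar>eigenvalue (2 * cos (node n j))\<bar> < 1"
        using eigenvalue_bound[OF n _ j] rate_bounds by force
      then have "eigenvalue (2 * cos (node n j)) \<noteq> 1" by auto
      then show ?thesis using stationary_cheb[OF st node_cases(1)[OF n, of j]] False j
        by (simp add: node_def)
    qed
    then show "proj_char p b (node n j) * (\<Sum>a<p. \<mu> a / real (a + 1) * cheb (2 * cos (node n j)) a) =
        proj_char p b (node n j) * (if node n j = 0 then 1 else 0)" by simp
  qed
  also have "\<dots> = proj_dim b / (real p ^ 2 - 1)" unfolding mean_diff_delta proj_dim_def ..
  finally show ?thesis by (simp add: pi0_def field_simps)
qed

text \<open>Subtracting the stationary distribution removes the node 0, the only one with eigenvalue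
  1.\<close>

lemma row_formula:
  assumes "b < p"
  shows "row l b / real (b + 1) - pi0 b / real (b + 1) =
    mean_diff p (\<lambda>\<theta>. proj_char p b \<theta> * (eigenvalue (2 * cos \<theta>) ^ l - (if \<theta> = 0 then 1 else 0)))"
proof -
  have "row l b / real (b + 1) = mean_diff p (\<lambda>\<theta>. proj_char p b \<theta> * (\<Sum>a<p. row l a / real (a + 1) * cheb (2 * cos \<theta>) a))"
    using proj_char_inversion[OF p5 assms, of "\<lambda>a. row l a / real (a + 1)"] by simp
  also have "\<dots> = mean_diff p (\<lambda>\<theta>. proj_char p b \<theta> * eigenvalue (2 * cos \<theta>) ^ l)"
  proof (rule mean_diff_cong)
    fix n j assume "n \<in> {p - 1, p + 1}" "j < n"
    then show "proj_char p b (node n j) * (\<Sum>a<p. row l a / real (a + 1) * cheb (2 * cos (node n j)) a) =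
        proj_char p b (node n j) * eigenvalue (2 * cos (node n j)) ^ l"
      using row_cheb[OF node_cases(1)[of n j], of l] by simp
  qed
  moreover have "pi0 b / real (b + 1) = mean_diff p (\<lambda>\<theta>. proj_char p b \<theta> * (if \<theta> = 0 then 1 else 0))"
    unfolding mean_diff_delta by (simp add: pi0_def proj_dim_def)
  ultimately show ?thesis by (simp only: right_diff_distrib mean_diff_diff)
qed

text \<open>For b = 0 the character is 2 cos((p - 1) \<theta>) - 1. It equals 1 at the nodes of p -
  1, while the general bound is 3.\<close>

lemma abs_proj_char_le:
  assumes "b < p"
  shows "\<bar>proj_char p b (node (p - 1) j)\<bar> \<le> proj_dim b"
    and "\<bar>proj_char p b \<theta>\<bar> \<le> (if b = 0 then 3 else proj_dim b)"
proof -
  have gen: "\<bar>proj_char p b \<theta>\<bar> \<le> (if b = 0 then 3 else proj_dim b)" for \<theta>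
  proof -
    define t where "t = cos (real (p - 1 - b) * \<theta>)"
    have "- 1 \<le> t" "t \<le> 1" unfolding t_def by (rule cos_ge_minus_one, rule cos_le_one)
    moreover have "proj_char p b \<theta> = (if b = p - 1 then 1 else 2 * t - (if b = 0 then 1 else 0))"
      by (simp add: proj_char_def t_def)
    ultimately show ?thesis using p5 by (auto simp: proj_dim_eq abs_le_iff)
  qed
  then show "\<bar>proj_char p b \<theta>\<bar> \<le> (if b = 0 then 3 else proj_dim b)" .
  show "\<bar>proj_char p b (node (p - 1) j)\<bar> \<le> proj_dim b"
  proof (cases "b = 0")
    case True
    have "real (p - 1) * node (p - 1) j = 2 * pi * real j" using p5 by (simp add: node_def)
    moreover have "cos (2 * pi * real j) = 1" using cos_2npi[of j] by (simp add: mult_ac)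
    ultimately have "cos (real (p - 1) * node (p - 1) j) = 1" by simp
    moreover have "0 \<noteq> p - 1" using p5 by simp
    ultimately have "proj_char p b (node (p - 1) j) = 1" using True by (simp add: proj_char_def)
    then show ?thesis by (simp add: proj_dim_eq)
  next
    case False
    then show ?thesis using gen[of "node (p - 1) j"] by simp
  qed
qed

lemma row_close:
  assumes b: "b < p"
  shows "\<bar>row l b / pi0 b - 1\<bar> \<le> (if b = 0 then 2 else 1) * (real p ^ 2 - 1) * rate ^ l"
proof -
  let ?g = "\<lambda>\<theta>. proj_char p b \<theta> * (eigenvalue (2 * cos \<theta>) ^ l - (if \<theta> = 0 then 1 else 0))"
  have avg: "\<bar>(\<Sum>j<n. ?g (node n j)) / real n\<bar> \<le> Q * rate ^ l"
    if n: "n \<in> {p - 1, p + 1}" and Q: "\<And>j. \<bar>proj_char p b (node n j)\<bar> \<le> Q" for n Q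
  proof -
    have n0: "0 < n" using n p5 by auto
    have Q0: "0 \<le> Q" using Q[of 0] by simp
    have "\<bar>?g (node n j)\<bar> \<le> Q * rate ^ l" if j: "j < n" for j
    proof (cases "j = 0")
      case True
      then show ?thesis using Q0 rate_bounds by (simp add: node_def eigenvalue_2)
    next
      case False
      then have "node n j \<noteq> 0" using n0 by (simp add: node_def)
      moreover have "\<bar>eigenvalue (2 * cos (node n j))\<bar> ^ l \<le> rate ^ l"
        using eigenvalue_bound[OF n _ j] False by (intro power_mono) auto
      ultimately show ?thesis using Q[of j] Q0
        by (simp add: abs_mult power_abs mult_mono)
    qed
    then have "(\<Sum>j<n. \<bar>?g (node n j)\<bar>) \<le> (\<Sum>j<n. Q * rate ^ l)" by (intro sum_mono) auto
    then have "\<bar>\<Sum>j<n. ?g (node n j)\<bar> \<le> (\<Sum>j<n. Q * rate ^ l)"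
      by (rule order_trans[OF sum_abs])
    then have "\<bar>\<Sum>j<n. ?g (node n j)\<bar> \<le> real n * (Q * rate ^ l)" by simp
    then show ?thesis using n0 by (simp add: abs_divide field_simps)
  qed
  let ?Q = "if b = 0 then 3 else proj_dim b"
  have 1: "\<bar>(\<Sum>j<p - 1. ?g (node (p - 1) j)) / real (p - 1)\<bar> \<le> proj_dim b * rate ^ l"
    by (rule avg) (use abs_proj_char_le(1)[OF b] in auto)
  have 2: "\<bar>(\<Sum>j<p + 1. ?g (node (p + 1) j)) / real (p + 1)\<bar> \<le> ?Q * rate ^ l"
    by (rule avg) (use abs_proj_char_le(2)[OF b] in auto)
  have "\<bar>(u - v) / 2\<bar> \<le> (x + y) / 2" if "\<bar>u\<bar> \<le> x" "\<bar>v\<bar> \<le> y" for u v x y :: real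
    using that abs_triangle_ineq4[of u v] by simp
  from this[OF 1 2] have "\<bar>mean_diff p ?g\<bar> \<le> (proj_dim b * rate ^ l + ?Q * rate ^ l) / 2"
    unfolding mean_diff_def .
  \<comment> \<open>For b = 0 the two families of nodes contribute bounds 1 and 3, with mean 2;
    otherwise both are \<open>proj_dim b\<close>.\<close>
  also have "\<dots> = (if b = 0 then 2 else 1) * proj_dim b * rate ^ l" by (simp add: proj_dim_eq)
  finally have le: "\<bar>row l b / real (b + 1) - pi0 b / real (b + 1)\<bar> \<le> (if b = 0 then 2 else 1) * proj_dim b * rate ^ l"
    unfolding row_formula[OF b] .
  have pos: "0 < (real p ^ 2 - 1) / proj_dim b" using p2_pos by (simp add: proj_dim_eq)
  have "x / (s * d / D) - 1 = (x / s - s * d / D / s) * (D / d)" if "s \<noteq> 0" "d \<noteq> 0" "D \<noteq> 0" for x s d D :: real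
    using that by (simp add: field_simps)
  from this[of "real (b + 1)" "proj_dim b" "real p ^ 2 - 1" "row l b"]
  have "row l b / pi0 b - 1 = (row l b / real (b + 1) - pi0 b / real (b + 1)) * ((real p ^ 2 - 1) / proj_dim b)"
    using p2_pos unfolding pi0_def by (simp add: proj_dim_eq)
  then have "\<bar>row l b / pi0 b - 1\<bar> = \<bar>row l b / real (b + 1) - pi0 b / real (b + 1)\<bar> * ((real p ^ 2 - 1) / proj_dim b)"
    by (simp only: abs_mult abs_of_pos[OF pos])
  also have "\<dots> \<le> (if b = 0 then 2 else 1) * proj_dim b * rate ^ l * ((real p ^ 2 - 1) / proj_dim b)"
    using pos by (intro mult_right_mono[OF le]) simp
  also have "\<dots> = (if b = 0 then 2 else 1) * (real p ^ 2 - 1) * rate ^ l" by (simp add: proj_dim_eq)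
  finally show ?thesis .
qed

section \<open>Upper bounds for the distance\<close>

definition dist :: "nat \<Rightarrow> real" where
  "dist l = linf_distance p K pi0 l"

lemma dist_cong:
  assumes "stationary_distribution p K \<mu>"
  shows "linf_distance p K \<mu> l = dist l"
  unfolding dist_def linf_distance_def using stationary_unique[OF assms]
  by (intro arg_cong[where f = Max] image_cong) auto

lemma dist_ge: "b < p \<Longrightarrow> \<bar>row l b / pi0 b - 1\<bar> \<le> dist l"
  unfolding dist_def linf_distance_def row_def by (intro Max_ge) auto

lemma dist_le:
  assumes "\<And>b. b < p \<Longrightarrow> \<bar>row l b / pi0 b - 1\<bar> \<le> B" shows "dist l \<le> B"
  unfolding dist_def linf_distance_def using assms p5
  by (subst Max_le_iff) (auto simp: row_def lessThan_empty_iff)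

lemma dist_upper: "dist l \<le> 2 * real p ^ 2 * rate ^ l"
proof (rule dist_le)
  fix b assume b: "b < p"
  have "(if b = 0 then 2 else 1) * (real p ^ 2 - 1) * rate ^ l \<le> 2 * real p ^ 2 * rate ^ l"
    using rate_bounds p2_pos by (intro mult_right_mono) auto
  then show "\<bar>row l b / pi0 b - 1\<bar> \<le> 2 * real p ^ 2 * rate ^ l" using row_close[OF b, of l] by simp
qed

text \<open>At time 1 the extra factor 2 at b = 0 would exceed the bound that is to be proved. But
  V(0) cannot be reached in one step, so its deviation is exactly 1.\<close>

lemma dist_upper_1: "dist 1 \<le> max 1 (real p ^ 2 * rate)"
proof (rule dist_le)
  fix b assume b: "b < p"
  show "\<bar>row 1 b / pi0 b - 1\<bar> \<le> max 1 (real p ^ 2 * rate)"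
  proof (cases "b = 0")
    case True
    have "row 1 0 = (\<Sum>a<p. row 0 a * K $$ (a, 0))" using p5 row_Suc[of 0 0] by simp
    also have "\<dots> = (\<Sum>a<p. if a = 0 then K $$ (0, 0) else 0)" by (intro sum.cong) (auto simp: row_0)
    also have "\<dots> = K $$ (0, 0)" using p5 by simp
    also have "\<dots> = 0" using p5 by (simp add: K_entry sym_factors_def)
    finally show ?thesis using True by simp
  next
    case False
    have "(real p ^ 2 - 1) * rate \<le> real p ^ 2 * rate" using rate_bounds by (intro mult_right_mono) auto
    then show ?thesis using row_close[OF b, of 1] False by simp
  qed
qed

end

section \<open>Lower bounds\<close>

lemma tensor_factors_0 [simp]: "tensor_factors S m 0 = S m"
  by (cases m) simp_all

context steinberg_walk
begin

text \<open>The normalized character at \<theta> = 2 pi / (p - 1) is bounded by 1 and has stationary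
  mean 0, so its expectation after \<open>l\<close> steps, the power of its eigenvalue, is at most
  the distance. As the Steinberg character is 1 there, the eigenvalue is at least 1/2 as soon as 1 -
  cos \<theta> <= 1/p.\<close>

lemma dist_ge_half_power:
  assumes st: "stationary_distribution p K \<mu>" and p: "23 \<le> p"
  shows "(1 / 2) ^ l \<le> dist l"
proof -
  let ?t = "node (p - 1) 1"
  let ?x = "2 * cos ?t" and ?P = "real p"
  have n: "p - 1 \<in> {p - 1, p + 1}" by simp
  have t: "?t = 2 * pi / (?P - 1)" using p by (simp add: node_def of_nat_diff)
  have P: "23 \<le> ?P" using p by simp
  have t0: "0 < ?t" "?t < pi" unfolding t using P by (auto simp: field_simps)
  have s: "0 < sin ?t" using sin_gt_zero[OF t0] .
  have "?P * ?t = ?t + 2 * pi" unfolding t using P by (simp add: field_simps)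
  then have "sin (?P * ?t) = sin ?t" by simp
  then have "cheb ?x (p - 1) * sin ?t = 1 * sin ?t" using cheb_sin[of ?t "p - 1"] p by simp
  then have c1: "cheb ?x (p - 1) = 1" using s by simp
  have "1 - cos ?t = 2 * sin (?t / 2) ^ 2" using cos_double_sin[of "?t / 2"] by simp
  also have "\<dots> \<le> 2 * (?t / 2) ^ 2"
    using power_mono[OF abs_sin_x_le_abs_x[of "?t / 2"] abs_ge_zero, of 2] by (simp only: power2_abs mult_left_mono zero_le_numeral)
  also have "\<dots> = 2 * pi ^ 2 / (?P - 1) ^ 2"
  proof -
    have "2 * (2 * x / y / 2) ^ 2 = 2 * x ^ 2 / y ^ 2" for x y :: real by (simp add: power_divide)
    then show ?thesis unfolding t .
  qed
  also have "\<dots> \<le> 1 / ?P"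
  proof -
    \<comment> \<open>Machin's formula gives the rational bound pi <= 16/5, hence 2 pi^2 <=
      20.48.\<close>
    have "arctan (1 / 5) \<le> (1 / 5 :: real)"
    proof -
      obtain z :: real where "arctan (1 / 5) - arctan 0 = (1 / 5 - 0) * inverse (1 + z ^ 2)"
        using MVT2[of 0 "1 / 5" arctan "\<lambda>x. inverse (1 + x ^ 2)"] DERIV_arctan by auto
      moreover have "inverse (1 + z ^ 2) \<le> 1" by (rule inverse_le_1_iff[THEN iffD2]) simp
      ultimately show ?thesis by simp
    qed
    moreover have "0 \<le> arctan (1 / 239 :: real)" by simp
    ultimately have "pi \<le> 16 / 5" using machin by linarith
    then have "pi ^ 2 \<le> (16 / 5) ^ 2" using pi_gt_zero by (intro power_mono) auto
    then have "2 * pi ^ 2 * ?P \<le> 20.48 * ?P" using P by (intro mult_right_mono) (simp_all add: power2_eq_square)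
    also have "\<dots> \<le> (?P - 1) ^ 2"
    proof -
      \<comment> \<open>The product is 25 ((P - 1)^2 - 20.48 P) - 324; this is where 23 is
        needed.\<close>
      have "0 \<le> (?P - 23) * (25 * ?P + 13)" using P by simp
      then show ?thesis using P by (simp add: power2_eq_square algebra_simps)
    qed
    finally show ?thesis using P by (simp add: field_simps)
  qed
  finally have "1 / 2 \<le> eigenvalue ?x" unfolding eigenvalue_def c1 by simp
  moreover have "\<bar>eigenvalue ?x\<bar> \<le> rate" using eigenvalue_bound[OF n, of 1] p by simp
  ultimately have ev: "1 / 2 \<le> eigenvalue ?x" "eigenvalue ?x \<noteq> 1" using rate_bounds by auto
  have x: "spectral_point ?x" using node_cases(1)[OF n] .
  let ?f = "\<lambda>b. cheb ?x b / real (b + 1)"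
  have "(\<Sum>b<p. \<mu> b / real (b + 1) * cheb ?x b) = 0" using stationary_cheb[OF st x] ev(2) by simp
  moreover have "(\<Sum>b<p. pi0 b * ?f b) = (\<Sum>b<p. \<mu> b / real (b + 1) * cheb ?x b)"
    by (intro sum.cong) (simp_all add: stationary_unique[OF st])
  ultimately have zero: "(\<Sum>b<p. pi0 b * ?f b) = 0" by simp
  have one: "(\<Sum>b<p. pi0 b) = 1"
  proof -
    have "(\<Sum>b<p. pi0 b) = (\<Sum>b<p. \<mu> b)" by (intro sum.cong) (simp_all add: stationary_unique[OF st])
    then show ?thesis using st by (simp add: stationary_distribution_def)
  qed
  have "(1 / 2) ^ l \<le> eigenvalue ?x ^ l" using ev by (intro power_mono) auto
  also have "\<dots> = (\<Sum>b<p. row l b * ?f b) - (\<Sum>b<p. pi0 b * ?f b)" using row_cheb[OF x] zero by simp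
  also have "\<dots> = (\<Sum>b<p. (row l b - pi0 b) * ?f b)" by (simp add: sum_subtractf left_diff_distrib diff_divide_distrib)
  also have "\<dots> \<le> (\<Sum>b<p. dist l * pi0 b)"
  proof (rule sum_mono)
    fix b assume "b \<in> {..<p}"
    then have "\<bar>row l b / pi0 b - 1\<bar> * pi0 b \<le> dist l * pi0 b"
      using dist_ge[of b l] pi0_pos[of b] by (intro mult_right_mono) auto
    moreover have "\<bar>row l b - pi0 b\<bar> = \<bar>row l b / pi0 b - 1\<bar> * pi0 b"
    proof -
      have "row l b - pi0 b = (row l b / pi0 b - 1) * pi0 b" using pi0_pos[of b] by (simp add: field_simps)
      then show ?thesis using pi0_pos[of b] by (simp only: abs_mult abs_of_pos)
    qed
    moreover have "(row l b - pi0 b) * ?f b \<le> \<bar>row l b - pi0 b\<bar> * 1"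
    proof -
      have "\<bar>?f b\<bar> \<le> 1" using abs_cheb_cos_le[of ?t b] by (simp add: field_simps)
      then have "\<bar>row l b - pi0 b\<bar> * \<bar>?f b\<bar> \<le> \<bar>row l b - pi0 b\<bar> * 1" by (intro mult_left_mono) auto
      moreover have "(row l b - pi0 b) * ?f b \<le> \<bar>(row l b - pi0 b) * ?f b\<bar>" by (rule abs_ge_self)
      ultimately show ?thesis by (simp only: abs_mult)
    qed
    ultimately show "(row l b - pi0 b) * ?f b \<le> dist l * pi0 b" by simp
  qed
  also have "\<dots> = dist l" unfolding sum_distrib_left[symmetric] one by simp
  finally show ?thesis .
qed

lemma K_up: "Suc a < p \<Longrightarrow> real (a + 2) / (4 * real (a + 1)) \<le> K $$ (a, Suc a)"
proof -
  assume a: "Suc a < p"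
  have "1 \<le> count_list (tensor_factors (sym_factors p) a 1) (Suc a)"
    using a by (cases a) (simp_all add: sym_factors_def)
  then have "1 * real (Suc a + 1) / (real (a + 1) * 2) \<le>
      real (count_list (tensor_factors (sym_factors p) a 1) (Suc a)) * real (Suc a + 1) / (real (a + 1) * 2)"
    by (intro divide_right_mono mult_right_mono) simp_all
  moreover have "0 \<le> real (count_list (tensor_factors (sym_factors p) a (p - 1)) (Suc a)) * real (Suc a + 1) / (real (a + 1) * real p)"
    by simp
  moreover have "real (a + 2) / (4 * real (a + 1)) = 1 * real (Suc a + 1) / (real (a + 1) * 2) / 2" by simp
  moreover have "x / 2 \<le> (y + z) / 2" if "x \<le> z" "0 \<le> y" for x y z :: real using that by simp
  ultimately show ?thesis unfolding K_entry[OF Suc_lessD[OF a] a] by metis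
qed

text \<open>Only the half of the step that tensors with V(1) is counted, as in \<open>K_up\<close>.
  The state p - 1 is excluded, since V(p - 1) \<otimes> V(1) decomposes differently.\<close>

lemma K_down: "Suc (Suc a) < p \<Longrightarrow> real (a + 1) / (4 * real (a + 2)) \<le> K $$ (Suc a, a)"
proof -
  assume a: "Suc (Suc a) < p"
  have "1 \<le> count_list (tensor_factors (sym_factors p) (Suc a) 1) a"
    using a by (simp add: sym_factors_def)
  then have "1 * real (a + 1) / (real (Suc a + 1) * 2) \<le>
      real (count_list (tensor_factors (sym_factors p) (Suc a) 1) a) * real (a + 1) / (real (Suc a + 1) * 2)"
    by (intro divide_right_mono mult_right_mono) simp_all
  moreover have "0 \<le> real (count_list (tensor_factors (sym_factors p) (Suc a) (p - 1)) a) * real (a + 1) / (real (Suc a + 1) * real p)"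
    by simp
  moreover have "real (a + 1) / (4 * real (a + 2)) = 1 * real (a + 1) / (real (Suc a + 1) * 2) / 2" by simp
  moreover have "x / 2 \<le> (y + z) / 2" if "x \<le> z" "0 \<le> y" for x y z :: real using that by simp
  ultimately show ?thesis unfolding K_entry[OF Suc_lessD[OF a] Suc_lessD[OF Suc_lessD[OF a]]] by metis
qed

lemma row_Suc_ge:
  assumes "S \<subseteq> {..<p}" "b < p"
  shows "(\<Sum>a\<in>S. row l a * K $$ (a, b)) \<le> row (Suc l) b"
  unfolding row_Suc[OF assms(2)] using assms
  by (intro sum_mono2) (auto intro!: mult_nonneg_nonneg row_nonneg K_nonneg)

text \<open>A return from V(1) to itself in two steps, through V(0) or V(2), has probability at
  least 1/8 times 1/2 plus 3/8 times 1/6, which is 1/8.\<close>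

lemma row_odd_ge: "1 / 2 * (1 / 8) ^ k \<le> row (2 * k + 1) 1"
proof (induction k)
  case 0
  have "row 0 0 * K $$ (0, 1) \<le> row 1 1" using row_Suc_ge[of "{0}" 1 0] p5 by simp
  then show ?case using K_up[of 0] p5 by (simp add: row_0)
next
  case (Suc k)
  let ?r = "row (2 * k + 1) 1"
  have r: "0 \<le> ?r" using row_nonneg p5 by simp
  have "?r * K $$ (1, 0) \<le> row (2 * k + 2) 0" using row_Suc_ge[of "{1}" 0 "2 * k + 1"] p5 by simp
  moreover have "?r * (1 / 8) \<le> ?r * K $$ (1, 0)" using K_down[of 0] p5 r by (intro mult_left_mono) simp_all
  ultimately have r0: "?r / 8 \<le> row (2 * k + 2) 0" by simp
  have "?r * K $$ (1, 2) \<le> row (2 * k + 2) 2" using row_Suc_ge[of "{1}" 2 "2 * k + 1"] p5 by simp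
  moreover have "?r * (3 / 8) \<le> ?r * K $$ (1, 2)" using K_up[of 1] p5 r by (intro mult_left_mono) (simp_all add: numeral_2_eq_2)
  ultimately have r2: "?r * 3 / 8 \<le> row (2 * k + 2) 2" by simp
  have "row (2 * k + 2) 0 * K $$ (0, 1) + row (2 * k + 2) 2 * K $$ (2, 1) \<le> row (2 * Suc k + 1) 1"
    using row_Suc_ge[of "{0, 2}" 1 "2 * k + 2"] p5 by simp
  moreover have "?r / 8 * (1 / 2) \<le> row (2 * k + 2) 0 * K $$ (0, 1)"
    using K_up[of 0] p5 r r0 by (intro mult_mono) simp_all
  moreover have "?r * 3 / 8 * (1 / 6) \<le> row (2 * k + 2) 2 * K $$ (2, 1)"
    using K_down[of 1] p5 r r2 by (intro mult_mono) (simp_all add: numeral_2_eq_2)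
  ultimately have "?r / 8 \<le> row (2 * Suc k + 1) 1" by simp
  then show ?case using Suc by simp
qed

lemma row_even_ge: "1 / 2 * (1 / 8) ^ Suc k \<le> row (2 * k + 2) 0"
proof -
  let ?r = "row (2 * k + 1) 1"
  have r: "0 \<le> ?r" using row_nonneg p5 by simp
  have "?r * K $$ (1, 0) \<le> row (2 * k + 2) 0" using row_Suc_ge[of "{1}" 0 "2 * k + 1"] p5 by simp
  moreover have "?r * (1 / 8) \<le> ?r * K $$ (1, 0)" using K_down[of 0] p5 r by (intro mult_left_mono) simp_all
  ultimately show ?thesis using row_odd_ge[of k] by simp
qed

lemma dist_odd_ge: "(real p ^ 2 - 1) / 8 ^ Suc k - 1 \<le> dist (2 * k + 1)"
proof -
  have pi: "pi0 1 = 4 / (real p ^ 2 - 1)" using p5 by (simp add: pi0_def proj_dim_eq)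
  have "1 / 2 * (1 / 8) ^ k / pi0 1 \<le> row (2 * k + 1) 1 / pi0 1"
    using row_odd_ge pi0_pos by (intro divide_right_mono) (auto simp: less_imp_le)
  also have "\<dots> \<le> dist (2 * k + 1) + 1" using dist_ge[of 1 "2 * k + 1"] p5 by simp
  finally show ?thesis unfolding pi using p2_pos by (simp add: field_simps power_divide)
qed

lemma dist_even_ge: "(real p ^ 2 - 1) / (2 * 8 ^ Suc k) - 1 \<le> dist (2 * k + 2)"
proof -
  have pi: "pi0 0 = 1 / (real p ^ 2 - 1)" using p5 by (simp add: pi0_def proj_dim_eq)
  have "1 / 2 * (1 / 8) ^ Suc k / pi0 0 \<le> row (2 * k + 2) 0 / pi0 0"
    using row_even_ge pi0_pos by (intro divide_right_mono) (auto simp: less_imp_le)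
  also have "\<dots> \<le> dist (2 * k + 2) + 1" using dist_ge[of 0 "2 * k + 2"] p5 by simp
  finally show ?thesis unfolding pi using p2_pos by (simp add: field_simps power_divide)
qed

text \<open>With s = p^(2/3) the claimed bound is s^2 / 4^(l + 1), and s^3 = p^2. It is at most
  2^(-l) exactly when s^2 <= 2^(l + 2). For smaller \<open>l\<close> the return probabilities give a
  main term proportional to s^3, which dominates.\<close>

theorem dist_lower_bound:
  assumes st: "stationary_distribution p K \<mu>" and p: "23 \<le> p" and l: "1 \<le> l"
  shows "exp (- (2 * ln 2) * (real l + 1) + (4 / 3) * ln (real p)) \<le> dist l"
proof -
  define s where "s = exp (2 / 3 * ln (real p))"
  have P: "0 < real p" using p by simp
  have s0: "0 < s" by (simp add: s_def)
  have s3: "s ^ 3 = real p ^ 2"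
  proof -
    have "s ^ 3 = exp (2 * ln (real p))" unfolding s_def by (simp flip: exp_of_nat_mult)
    also have "\<dots> = exp (ln (real p)) ^ 2" by (simp flip: exp_of_nat_mult)
    finally show ?thesis using P by simp
  qed
  have T: "exp (- (2 * ln 2) * (real l + 1) + (4 / 3) * ln (real p)) = s ^ 2 / 4 ^ Suc l"
  proof -
    have "s ^ 2 = exp ((4 / 3) * ln (real p))" unfolding s_def by (simp flip: exp_of_nat_mult)
    moreover have "(4::real) ^ Suc l = exp ((2 * ln 2) * (real l + 1))"
    proof -
      have "exp (2 * ln 2) = exp (ln 2 :: real) ^ 2" by (rule exp_double)
      then have "exp (2 * ln 2) = (4::real)" by simp
      then have "(4::real) ^ Suc l = exp (2 * ln 2) ^ Suc l" by simp
      also have "\<dots> = exp (real (Suc l) * (2 * ln 2))" by (rule exp_of_nat_mult[symmetric])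
      finally show ?thesis by (simp add: algebra_simps)
    qed
    moreover have "- (2 * ln 2) * (real l + 1) = - ((2 * ln 2) * (real l + 1))" by simp
    ultimately show ?thesis by (simp only: exp_add exp_minus divide_inverse mult.commute)
  qed
  show ?thesis
  proof (cases "s ^ 2 \<le> 2 ^ (l + 2)")
    case True
    then have "s ^ 2 / 4 ^ Suc l \<le> 2 ^ (l + 2) / 4 ^ Suc l" by (intro divide_right_mono) simp_all
    also have "\<dots> = (1 / 2) ^ l"
    proof -
      have "(4::real) ^ l = 2 ^ l * 2 ^ l" by (simp flip: power_mult_distrib)
      then show ?thesis by (simp add: power_divide field_simps)
    qed
    also have "\<dots> \<le> dist l" by (rule dist_ge_half_power[OF st p])
    finally show ?thesis unfolding T .
  next
    case False
    define k where "k = (l - 1) div 2"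
    \<comment> \<open>The scale on which the return bound at l = 2k + 1 is z^3 up to constants and
      the claimed one at most z^2 / 4; at l = 2k + 2 they are z^3 / 2 and z^2 / 16.\<close>
    define z where "z = s / 2 ^ Suc k"
    have z0: "0 < z" using s0 by (simp add: z_def)
    have z2: "z ^ 2 = s ^ 2 / 4 ^ Suc k"
    proof -
      have "((2::real) ^ Suc k) ^ 2 = (2 ^ 2) ^ Suc k" by (rule power_commutes[THEN trans, OF _] | simp only: power_mult[symmetric] mult.commute)
      then show ?thesis by (simp add: z_def power_divide)
    qed
    have z3: "z ^ 3 = real p ^ 2 / 8 ^ Suc k"
    proof -
      have "((2::real) ^ Suc k) ^ 3 = (2 ^ 3) ^ Suc k" by (simp only: power_mult[symmetric] mult.commute)
      then show ?thesis by (simp add: z_def power_divide s3)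
    qed
    have z3': "z ^ 3 = z * z ^ 2" by (simp add: power3_eq_cube power2_eq_square)
    have e8: "1 / 8 ^ Suc k \<le> (1 / 8 :: real)" by (simp add: field_simps)
    have e4: "4 \<le> (4 :: real) ^ Suc k" by simp
    consider "l = 2 * k + 1" | "l = 2 * k + 2" using l unfolding k_def by linarith
    then show ?thesis
    proof cases
      case 1
      have "2 < z ^ 2"
      proof -
        have "2 ^ (l + 2) < s ^ 2" using False by simp
        moreover have "(2::real) ^ (l + 2) = 2 * 4 ^ Suc k" unfolding 1 by (simp add: power_mult power_add)
        ultimately show ?thesis unfolding z2 by (simp add: field_simps)
      qed
      \<comment> \<open>From z^2 > 2 one gets z > 1.4, so z^3 exceeds z^2 / 4 by more than 2.3,
        enough for the loss 1 + 1/8.\<close>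
      moreover then have "1.4 ^ 2 < z ^ 2" by (simp add: power2_eq_square)
      then have "1.4 < z" by (rule power_less_imp_less_base) (use z0 in simp)
      then have "1.4 * z ^ 2 \<le> z * z ^ 2" by (intro mult_right_mono) simp_all
      ultimately have "z ^ 2 / 4 \<le> z ^ 3 - 1 / 8 - 1" unfolding z3' by simp
      also have "\<dots> \<le> (real p ^ 2 - 1) / 8 ^ Suc k - 1" using e8 unfolding z3 diff_divide_distrib by linarith
      also have "\<dots> \<le> dist l" unfolding 1 by (rule dist_odd_ge)
      finally have "z ^ 2 / 4 \<le> dist l" .
      moreover have "s ^ 2 / 4 ^ Suc l \<le> z ^ 2 / 4"
      proof -
        have "(4::real) ^ Suc l = 4 ^ Suc k * 4 ^ Suc k" unfolding 1 by (simp flip: power_add add: mult_2)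
        then have "s ^ 2 / 4 ^ Suc l = z ^ 2 / 4 ^ Suc k" unfolding z2 by simp
        also have "\<dots> \<le> z ^ 2 / 4" using e4 by (intro divide_left_mono) simp_all
        finally show ?thesis .
      qed
      ultimately show ?thesis unfolding T by linarith
    next
      case 2
      have z4: "4 < z ^ 2"
      proof -
        have "2 ^ (l + 2) < s ^ 2" using False by simp
        moreover have "(2::real) ^ (l + 2) = 4 * 4 ^ Suc k" unfolding 2 by (simp add: power_mult power_add)
        ultimately show ?thesis unfolding z2 by (simp add: field_simps)
      qed
      then have "2 ^ 2 < z ^ 2" by simp
      then have "2 < z" by (rule power_less_imp_less_base) (use z0 in simp)
      then have "2 * z ^ 2 \<le> z * z ^ 2" by (intro mult_right_mono) simp_all
      then have "z ^ 2 / 16 \<le> z ^ 3 / 2 - 1 / 16 - 1" using z4 unfolding z3' by simp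
      also have "\<dots> \<le> (real p ^ 2 - 1) / (2 * 8 ^ Suc k) - 1"
      proof -
        have "(real p ^ 2 - 1) / (2 * 8 ^ Suc k) = (real p ^ 2 / 8 ^ Suc k - 1 / 8 ^ Suc k) / 2"
          by (simp add: diff_divide_distrib)
        moreover have "x / 2 - 1 / 16 - 1 \<le> (x - e) / 2 - 1" if "e \<le> 1 / 8" for x e :: real using that by argo
        ultimately show ?thesis using e8 unfolding z3 by presburger
      qed
      also have "\<dots> \<le> dist l" unfolding 2 by (rule dist_even_ge)
      finally have "z ^ 2 / 16 \<le> dist l" .
      moreover have "s ^ 2 / 4 ^ Suc l \<le> z ^ 2 / 16"
      proof -
        have "(4::real) ^ Suc l = 4 ^ Suc k * (4 * 4 ^ Suc k)" unfolding 2 by (simp flip: power_add add: mult_2)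
        then have "s ^ 2 / 4 ^ Suc l = z ^ 2 / (4 * 4 ^ Suc k)" unfolding z2 by simp
        also have "\<dots> \<le> z ^ 2 / 16" using e4 by (intro divide_left_mono) simp_all
        finally show ?thesis .
      qed
      ultimately show ?thesis unfolding T by linarith
    qed
  qed
qed

text \<open>One has exp(-1/4) >= 3/4, whereas \<open>rate\<close> is at most 12/23, its value at p =
  23. From l = 2 on this gap absorbs the factor 2 of the general bound, since 2 (12/23)^2 <=
  (3/4)^2; the case l = 1 needs the separate estimate.\<close>

theorem dist_upper_bound:
  assumes p: "23 \<le> p" and l: "1 \<le> l"
  shows "dist l \<le> exp (- (real l / 4) + 2 * ln (real p))"
proof -
  have P: "23 \<le> real p" using p by simp
  have r: "rate \<le> 12 / 23" using P by (simp add: rate_def field_simps)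
  have "exp (- (real l / 4) + 2 * ln (real p)) = real p ^ 2 * exp (- 1 / 4) ^ l"
  proof -
    have "exp (2 * ln (real p)) = exp (ln (real p)) ^ 2" by (simp flip: exp_of_nat_mult)
    then have "exp (2 * ln (real p)) = real p ^ 2" using P by simp
    moreover have "exp (- (real l / 4)) = exp (- 1 / 4) ^ l" by (simp flip: exp_of_nat_mult)
    moreover have "exp (- (real l / 4) + 2 * ln (real p)) = exp (- (real l / 4)) * exp (2 * ln (real p))"
      by (rule exp_add)
    ultimately show ?thesis by (simp only: mult.commute)
  qed
  moreover have "(3 / 4) ^ l \<le> exp (- 1 / 4 :: real) ^ l"
    using exp_ge_add_one_self[of "- 1 / 4 :: real"] by (intro power_mono) simp_all
  then have "real p ^ 2 * (3 / 4) ^ l \<le> real p ^ 2 * exp (- 1 / 4) ^ l" by (intro mult_left_mono) simp_all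
  moreover have "dist l \<le> real p ^ 2 * (3 / 4) ^ l"
  proof (cases "l = 1")
    case True
    have "real p ^ 2 * rate \<le> real p ^ 2 * (3 / 4)" using r by (intro mult_left_mono) simp_all
    moreover have "23 ^ 2 \<le> real p ^ 2" using P by (intro power_mono) simp_all
    ultimately show ?thesis using dist_upper_1 True by simp
  next
    case False
    then have "2 \<le> l" using l by simp
    then have "2 * rate ^ l \<le> (3 / 4) ^ l"
    proof (induction l rule: dec_induct)
      case base
      have "rate ^ 2 \<le> (12 / 23) ^ 2" using r rate_bounds by (intro power_mono) simp_all
      then show ?case by (simp add: power2_eq_square)
    next
      case (step l)
      have "2 * rate ^ l * rate \<le> (3 / 4) ^ l * (3 / 4)" using step r rate_bounds by (intro mult_mono) simp_all
      then show ?case by (simp add: mult_ac)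
    qed
    then have "real p ^ 2 * (2 * rate ^ l) \<le> real p ^ 2 * (3 / 4) ^ l" by (intro mult_left_mono) simp_all
    then show ?thesis using dist_upper[of l] by simp
  qed
  ultimately show ?thesis by linarith
qed

text \<open>Tensoring with V(1), which happens with probability 1/2, moves a state \<open>a\<close>
  of this range only to its neighbours, so the bound on the state grows by at most 1 per
  step.\<close>

lemma row_sum_ge: "l < p \<Longrightarrow> (1 / 2) ^ l \<le> (\<Sum>b\<le>l. row l b)"
proof (induction l)
  case 0
  then show ?case by (simp add: row_0)
next
  case (Suc l)
  have half: "1 / 2 \<le> (\<Sum>b\<le>Suc l. K $$ (a, b))" if "a \<le> l" for a
  proof (cases a)
    case 0
    have "K $$ (a, 1) \<le> (\<Sum>b\<le>Suc l. K $$ (a, b))"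
      using Suc.prems that by (intro member_le_sum) (auto intro!: K_nonneg)
    then show ?thesis using K_up[of 0] p5 0 by simp
  next
    case (Suc a')
    have "(\<Sum>b\<in>{a', Suc (Suc a')}. K $$ (a, b)) \<le> (\<Sum>b\<le>Suc l. K $$ (a, b))"
      using Suc.prems that \<open>Suc l < p\<close> Suc by (intro sum_mono2) (auto intro!: K_nonneg)
    moreover have "real (a' + 1) / (4 * real (a' + 2)) \<le> K $$ (a, a')"
      using K_down[of a'] Suc that \<open>Suc l < p\<close> by simp
    moreover have "real (Suc a' + 2) / (4 * real (Suc a' + 1)) \<le> K $$ (a, Suc (Suc a'))"
      using K_up[of "Suc a'"] Suc that \<open>Suc l < p\<close> by simp
    moreover have "real (a' + 1) / (4 * real (a' + 2)) + real (Suc a' + 2) / (4 * real (Suc a' + 1)) = 1 / 2"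
    proof -
      define y where "y = real a'"
      have "(y + 1) / (4 * (y + 2)) + (y + 3) / (4 * (y + 2)) = (2 * (y + 2)) / (4 * (y + 2))"
        unfolding add_divide_distrib[symmetric] by simp
      also have "\<dots> = 1 / 2" by (simp add: y_def field_simps)
      finally show ?thesis by (simp add: y_def add_ac)
    qed
    moreover have "(\<Sum>b\<in>{a', Suc (Suc a')}. K $$ (a, b)) = K $$ (a, a') + K $$ (a, Suc (Suc a'))" by simp
    ultimately show ?thesis by linarith
  qed
  have "(1 / 2) ^ Suc l \<le> (\<Sum>a\<le>l. row l a) * (1 / 2)" using Suc by simp
  also have "\<dots> = (\<Sum>a\<le>l. row l a * (1 / 2))" by (rule sum_distrib_right)
  also have "\<dots> \<le> (\<Sum>a\<le>l. row l a * (\<Sum>b\<le>Suc l. K $$ (a, b)))"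
    using half Suc.prems by (intro sum_mono mult_left_mono row_nonneg) auto
  also have "\<dots> = (\<Sum>b\<le>Suc l. \<Sum>a\<le>l. row l a * K $$ (a, b))"
    unfolding sum_distrib_left by (rule sum.swap)
  also have "\<dots> \<le> (\<Sum>b\<le>Suc l. row (Suc l) b)"
    using Suc.prems by (intro sum_mono row_Suc_ge) auto
  finally show ?case .
qed

text \<open>At distance D every state has probability at most D + 1 times its stationary mass. The l
  + 1 states up to \<open>l\<close> have stationary mass at most 2 (l + 1) / (p^2 - 1) each, yet
  together they carry probability at least 2^(-l).\<close>

lemma dist_ge_early:
  assumes "l < p"
  shows "(1 / 2) ^ l * (real p ^ 2 - 1) / (2 * (real l + 1) ^ 2) - 1 \<le> dist l"
proof -
  have "(1 / 2) ^ l \<le> (\<Sum>b\<le>l. row l b)" using row_sum_ge[OF assms] .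
  also have "\<dots> \<le> (\<Sum>b\<le>l. (dist l + 1) * (2 * (real l + 1) / (real p ^ 2 - 1)))"
  proof (rule sum_mono)
    fix b assume "b \<in> {..l}"
    then have b: "b \<le> l" "b < p" using assms by auto
    have d: "row l b / pi0 b \<le> dist l + 1" using dist_ge[OF b(2), of l] by simp
    have d0: "0 \<le> dist l + 1"
      using d row_nonneg[OF b(2), of l] pi0_pos[of b] by (meson divide_nonneg_pos order_trans)
    have "row l b = row l b / pi0 b * pi0 b" using pi0_pos[of b] by simp
    also have "\<dots> \<le> (dist l + 1) * pi0 b" using d pi0_pos[of b] by (intro mult_right_mono) simp_all
    also have "\<dots> \<le> (dist l + 1) * (2 * (real l + 1) / (real p ^ 2 - 1))"
    proof (rule mult_left_mono[OF _ d0])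
      have "real (b + 1) * proj_dim b \<le> (real l + 1) * 2" using b by (intro mult_mono) (auto simp: proj_dim_eq)
      then show "pi0 b \<le> 2 * (real l + 1) / (real p ^ 2 - 1)"
        unfolding pi0_def using p2_pos by (intro divide_right_mono) simp_all
    qed
    finally show "row l b \<le> (dist l + 1) * (2 * (real l + 1) / (real p ^ 2 - 1))" .
  qed
  also have "\<dots> = (dist l + 1) * (2 * (real l + 1) ^ 2) / (real p ^ 2 - 1)"
    by (simp add: power2_eq_square algebra_simps)
  finally have "(1 / 2) ^ l * (real p ^ 2 - 1) \<le> (dist l + 1) * (2 * (real l + 1) ^ 2)"
    using p2_pos by (simp add: field_simps)
  then have "(1 / 2) ^ l * (real p ^ 2 - 1) / (2 * (real l + 1) ^ 2) \<le> dist l + 1"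
    by (simp add: divide_le_eq)
  then show ?thesis by simp
qed

end

section \<open>Cutoff\<close>

text \<open>The passage from modules to lists: composition multiplicities become counts, and the
  dimensions of V(p - 1) and V(1) become \<open>p\<close> and 2.\<close>

lemma steinberg_walk_mixed_walk:
  fixes R :: "'k ring"
  assumes ac: "algebraic_closure R F" and card: "card F = p" and p: "prime p" "odd p" "5 \<le> p"
  shows "steinberg_walk p (mixed_walk R F p)"
proof -
  interpret prime_subfield R F p
  proof (intro prime_subfield.intro prime_subfield_axioms.intro)
    show "field R" "subfield F R" using ac unfolding algebraic_closure_def by auto
  qed (use card p in auto)
  have entry: "mixed_walk R F p $$ (a, b) =
      (tensor_prob (SL2 (R\<lparr>carrier := F\<rparr>)) R (sym_rep R (p - 1)) (sym_rep R a) (sym_rep R b) +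
       tensor_prob (SL2 (R\<lparr>carrier := F\<rparr>)) R (sym_rep R 1) (sym_rep R a) (sym_rep R b)) / 2"
    if "a < p" "b < p" for a b
    using that by (simp add: mixed_walk_def tensor_walk_def add_divide_distrib)
  have prob: "tensor_prob (SL2 (R\<lparr>carrier := F\<rparr>)) R (sym_rep R w) (sym_rep R a) (sym_rep R b) =
      real (count_list (tensor_factors (sym_factors p) a w) b) * real (b + 1) / (real (a + 1) * real (w + 1))"
    if "a < p" "w < p" "b < p" for a w b
    using comp_mult_tensor(1)[OF p(2) that] by (simp add: tensor_prob_def rep_dim_def sym_rep_def)
  show ?thesis
  proof
    show "5 \<le> p" "odd p" using p by auto
    show "mixed_walk R F p \<in> carrier_mat p p" by (simp add: mixed_walk_def tensor_walk_def)
    show "set (tensor_factors (sym_factors p) a w) \<subseteq> {..<p}" if "a < p" "w < p" for a w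
      by (rule comp_mult_tensor(2)[OF p(2) that(1) that(2) that(1)])
    fix a b assume "a < p" "b < p"
    then show "mixed_walk R F p $$ (a, b) =
      (real (count_list (tensor_factors (sym_factors p) a (p - 1)) b) * real (b + 1) / (real (a + 1) * real p) +
       real (count_list (tensor_factors (sym_factors p) a 1) b) * real (b + 1) / (real (a + 1) * 2)) / 2"
      using p by (simp only: entry prob) simp
  qed
qed

lemma asymp_equiv_eventually_ge:
  fixes f g :: "'a \<Rightarrow> real"
  assumes "f \<sim>[F] g" "c < 1" "eventually (\<lambda>x. 0 < g x) F"
  shows "eventually (\<lambda>x. c * g x \<le> f x) F"
proof -
  have "eventually (\<lambda>x. c < (if f x = 0 \<and> g x = 0 then 1 else f x / g x)) F"
    using assms(1,2) unfolding asymp_equiv_def by (rule order_tendstoD)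
  with assms(3) show ?thesis by eventually_elim (auto simp: field_simps split: if_splits)
qed

lemma asymp_equiv_eventually_le:
  fixes f g :: "'a \<Rightarrow> real"
  assumes "f \<sim>[F] g" "1 < c" "eventually (\<lambda>x. 0 < g x) F"
  shows "eventually (\<lambda>x. f x \<le> c * g x) F"
proof -
  have "eventually (\<lambda>x. (if f x = 0 \<and> g x = 0 then 1 else f x / g x) < c) F"
    using assms(1,2) unfolding asymp_equiv_def by (rule order_tendstoD)
  with assms(3) show ?thesis by eventually_elim (auto simp: field_simps split: if_splits)
qed

lemma odd_primes_le: "odd_primes \<le> at_top"
  by (simp add: odd_primes_def)

lemma eventually_odd_primes: "eventually P at_top \<Longrightarrow> eventually P odd_primes"
  using odd_primes_le by (rule filter_leD)

lemma log2_square: "0 < x \<Longrightarrow> log 2 (x ^ 2) = 2 * ln x / ln 2"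
  by (simp add: log_def ln_realpow)

lemma log2_pos: "eventually (\<lambda>p::nat. 0 < c * log 2 (real p ^ 2)) odd_primes" if "0 < c" for c :: real
  by (rule eventually_odd_primes) (use that in real_asymp)

text \<open>The exponent equals -2 \<epsilon> ln p plus a constant times (ln p) / p. The latter
  comes from the factor 1 + 1/p in \<open>rate\<close> and tends to 0.\<close>

lemma upper_limit:
  assumes "0 < \<epsilon>"
  shows "((\<lambda>p. 2 * exp (2 * ln (real p) - (ln 2 - 1 / real p) * ((1 + \<epsilon>) * (2 * ln (real p) / ln 2)))) \<longlongrightarrow> 0) at_top"
proof -
  have lim: "((\<lambda>p::nat. 2 * exp (k * (ln (real p) / real p) - d * ln (real p))) \<longlongrightarrow> 0) at_top"
    if "0 < d" for d k :: real
    using that by real_asymp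
  have "2 * x - (ln 2 - 1 / y) * ((1 + \<epsilon>) * (2 * x / ln 2)) = (1 + \<epsilon>) * 2 / ln 2 * (x / y) - 2 * \<epsilon> * x"
    for x y :: real
  proof -
    have "2 * x - (z - w) * ((1 + \<epsilon>) * (2 * x / z)) = (1 + \<epsilon>) * 2 / z * (x * w) - 2 * \<epsilon> * x"
      if "z \<noteq> 0" for z w :: real
      using that by (simp add: field_simps)
    from this[of "ln 2" "1 / y"] show ?thesis by simp
  qed
  then show ?thesis using lim[of "2 * \<epsilon>" "(1 + \<epsilon>) * 2 / ln 2"] assms by simp
qed

text \<open>The first factor is p^(2 \<epsilon> - 2), so the numerator grows like p^(2 \<epsilon>)
  while the denominator is only quadratic in ln p.\<close>

lemma lower_limit:
  assumes "0 < \<epsilon>" "\<epsilon> < 1"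
  shows "filterlim (\<lambda>p. exp (- ((1 - \<epsilon>) * (2 * ln (real p)))) * (real p ^ 2 - 1) /
      (2 * ((1 - \<epsilon>) * (2 * ln (real p) / ln 2) + 1) ^ 2) - 1) at_top at_top"
proof -
  have lim: "filterlim (\<lambda>p::nat. real p powr (d - 2) * (real p ^ 2 - 1) / (2 * (k * ln (real p) + 1) ^ 2) - 1) at_top at_top"
    if "0 < d" "0 < k" for d k :: real
    using that by real_asymp
  have "exp (- ((1 - \<epsilon>) * (2 * ln x))) = x powr (2 * \<epsilon> - 2)" if "0 < x" for x :: real
    using that by (simp add: powr_def algebra_simps)
  moreover have "(1 - \<epsilon>) * (2 * x / ln 2) = (1 - \<epsilon>) * 2 / ln 2 * x" for x :: real by simp
  ultimately have "eventually (\<lambda>p::nat. real p powr (2 * \<epsilon> - 2) * (real p ^ 2 - 1) /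
        (2 * ((1 - \<epsilon>) * 2 / ln 2 * ln (real p) + 1) ^ 2) - 1 =
      exp (- ((1 - \<epsilon>) * (2 * ln (real p)))) * (real p ^ 2 - 1) /
        (2 * ((1 - \<epsilon>) * (2 * ln (real p) / ln 2) + 1) ^ 2) - 1) at_top"
    by (intro eventually_mono[OF eventually_gt_at_top[of 0]]) (simp only: of_nat_0_less_iff)
  from filterlim_cong[OF refl refl this] lim[of "2 * \<epsilon>" "(1 - \<epsilon>) * 2 / ln 2"] assms show ?thesis by simp
qed

context steinberg_walk
begin

lemma rate_power_le:
  assumes "c \<le> real l"
  shows "2 * real p ^ 2 * rate ^ l \<le> 2 * exp (2 * ln (real p) - (ln 2 - 1 / real p) * c)"
proof -
  have P: "0 < real p" using p5 by simp
  have "0 < rate" by (rule rate_bounds)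
  have "rate = (1 + 1 / real p) * exp (- ln 2)" by (simp add: rate_def exp_minus)
  also have "\<dots> \<le> exp (1 / real p) * exp (- ln 2)" by (intro mult_right_mono exp_ge_add_one_self) simp
  also have "\<dots> = exp (- (ln 2 - 1 / real p))" by (simp flip: exp_add)
  finally have "rate ^ l \<le> exp (- (ln 2 - 1 / real p)) ^ l" using \<open>0 < rate\<close> by (intro power_mono) auto
  also have "\<dots> = exp (real l * - (ln 2 - 1 / real p))" by (rule exp_of_nat_mult[symmetric])
  also have "\<dots> \<le> exp (- ((ln 2 - 1 / real p) * c))"
  proof -
    \<comment> \<open>From ln(1/2) <= -1/2 one gets ln 2 >= 1/2 >= 1/p. The sign is needed to
      replace \<open>l\<close> by its lower bound \<open>c\<close>.\<close>
    have "1 / real p \<le> 1 / 2" using p5 by (simp add: field_simps)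
    then have "0 \<le> ln 2 - 1 / real p" using ln_le_minus_one[of "1 / 2"] by (simp add: ln_div)
    then have "c * (ln 2 - 1 / real p) \<le> real l * (ln 2 - 1 / real p)" using assms by (rule mult_right_mono[rotated])
    then show ?thesis by (simp add: algebra_simps)
  qed
  finally have "2 * real p ^ 2 * rate ^ l \<le> 2 * real p ^ 2 * exp (- ((ln 2 - 1 / real p) * c))"
    by (intro mult_left_mono) simp_all
  also have "\<dots> = 2 * exp (2 * ln (real p) - (ln 2 - 1 / real p) * c)"
    using P exp_double[of "ln (real p)"] by (simp add: exp_diff exp_minus divide_inverse)
  finally show ?thesis .
qed

lemma dist_nonneg: "0 \<le> dist l"
  using dist_ge[of 0 l] p5 by linarith

lemma dist_ge_exp:
  assumes c: "real l \<le> c" "c < real p"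
  shows "exp (- (c * ln 2)) * (real p ^ 2 - 1) / (2 * (c + 1) ^ 2) - 1 \<le> dist l"
proof -
  have "exp (- (c * ln 2)) \<le> exp (- (real l * ln 2))" using c by simp
  also have "\<dots> = exp (- ln 2) ^ l" by (simp flip: exp_of_nat_mult)
  also have "\<dots> = (1 / 2) ^ l" by (simp add: exp_minus inverse_eq_divide)
  finally have "exp (- (c * ln 2)) * (real p ^ 2 - 1) / (2 * (c + 1) ^ 2) \<le>
      (1 / 2) ^ l * (real p ^ 2 - 1) / (2 * (real l + 1) ^ 2)"
    using p2_pos c by (intro frac_le mult_right_mono mult_nonneg_nonneg mult_left_mono power_mono mult_pos_pos zero_less_power) auto
  also have "\<dots> \<le> dist l + 1" using dist_ge_early[of l] c by simp
  finally show ?thesis by simp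
qed

end

theorem theorem3p4:
  fixes R :: "nat \<Rightarrow> 'k ring" and F :: "nat \<Rightarrow> 'k set" and \<mu> :: "nat \<Rightarrow> nat \<Rightarrow> real"
  assumes closure: "\<And>p. prime p \<Longrightarrow> odd p \<Longrightarrow> algebraic_closure (R p) (F p) \<and> card (F p) = p"
    and stationary: "\<And>p. prime p \<Longrightarrow> odd p \<Longrightarrow>
      stationary_distribution p (mixed_walk (R p) (F p) p) (\<mu> p)"
  shows "(\<forall>p l. prime p \<and> odd p \<and> 23 \<le> p \<and> 1 \<le> l \<longrightarrow>
            linf_distance p (mixed_walk (R p) (F p) p) (\<mu> p) l
              \<ge> exp (- (2 * ln 2) * (real l + 1) + (4/3) * ln (real p)) \<and>
            linf_distance p (mixed_walk (R p) (F p) p) (\<mu> p) l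
              \<le> exp (- (real l / 4) + 2 * ln (real p)))
       \<and> has_cutoff odd_primes (\<lambda>p. linf_distance p (mixed_walk (R p) (F p) p) (\<mu> p))
           (\<lambda>p. log 2 (real p ^ 2))"
proof (intro conjI)
  let ?D = "\<lambda>p. linf_distance p (mixed_walk (R p) (F p) p) (\<mu> p)"
  have walk: "steinberg_walk p (mixed_walk (R p) (F p) p)" if "prime p" "odd p" "5 \<le> p" for p
    using steinberg_walk_mixed_walk closure that by blast
  show "\<forall>p l. prime p \<and> odd p \<and> 23 \<le> p \<and> 1 \<le> l \<longrightarrow>
      ?D p l \<ge> exp (- (2 * ln 2) * (real l + 1) + (4/3) * ln (real p)) \<and>
      ?D p l \<le> exp (- (real l / 4) + 2 * ln (real p))"
  proof (intro allI impI)
    fix p l :: nat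
    assume *: "prime p \<and> odd p \<and> 23 \<le> p \<and> 1 \<le> l"
    then interpret steinberg_walk p "mixed_walk (R p) (F p) p" by (intro walk) auto
    have st: "stationary_distribution p (mixed_walk (R p) (F p) p) (\<mu> p)" using stationary * by blast
    show "?D p l \<ge> exp (- (2 * ln 2) * (real l + 1) + (4/3) * ln (real p)) \<and>
      ?D p l \<le> exp (- (real l / 4) + 2 * ln (real p))"
      unfolding dist_cong[OF st] using dist_lower_bound[OF st] dist_upper_bound * by blast
  qed
  have ev: "eventually (\<lambda>p. prime p \<and> odd p \<and> 5 \<le> p) odd_primes"
    unfolding odd_primes_def eventually_inf_principal using eventually_ge_at_top[of 5]
    by eventually_elim simp
  show "has_cutoff odd_primes ?D (\<lambda>p. log 2 (real p ^ 2))"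
    unfolding has_cutoff_def
  proof (intro allI impI conjI)
    fix \<epsilon> :: real and l :: "nat \<Rightarrow> nat"
    assume \<epsilon>: "0 < \<epsilon> \<and> \<epsilon> < 1"
    {
      assume l: "(\<lambda>p. real (l p)) \<sim>[odd_primes] (\<lambda>p. (1 + \<epsilon>) * log 2 (real p ^ 2))"
      \<comment> \<open>Half of \<epsilon> is given up to turn the asymptotic equivalence into an
        inequality for all large \<open>p\<close>.\<close>
      define c where "c = (1 + \<epsilon> / 2) / (1 + \<epsilon>)"
      have "c < 1" "c * (1 + \<epsilon>) = 1 + \<epsilon> / 2" using \<epsilon> by (auto simp: c_def field_simps)
      then have "eventually (\<lambda>p. (1 + \<epsilon> / 2) * log 2 (real p ^ 2) \<le> real (l p)) odd_primes"
        using asymp_equiv_eventually_ge[OF l \<open>c < 1\<close> log2_pos] \<epsilon> by (simp flip: mult.assoc)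
      with ev have bound: "eventually (\<lambda>p. 0 \<le> ?D p (l p) \<and> ?D p (l p) \<le>
          2 * exp (2 * ln (real p) - (ln 2 - 1 / real p) * ((1 + \<epsilon> / 2) * (2 * ln (real p) / ln 2)))) odd_primes"
      proof eventually_elim
        case (elim p)
        then interpret steinberg_walk p "mixed_walk (R p) (F p) p" by (intro walk) auto
        have st: "stationary_distribution p (mixed_walk (R p) (F p) p) (\<mu> p)" using stationary elim by blast
        have "(1 + \<epsilon> / 2) * (2 * ln (real p) / ln 2) \<le> real (l p)" using elim log2_square[of "real p"] by simp
        from order_trans[OF dist_upper rate_power_le[OF this]] show ?case
          unfolding dist_cong[OF st] using dist_nonneg by blast
      qed
      show "((\<lambda>p. ?D p (l p)) \<longlongrightarrow> 0) odd_primes"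
      proof (rule tendsto_sandwich[OF _ _ tendsto_const])
        show "((\<lambda>p. 2 * exp (2 * ln (real p) - (ln 2 - 1 / real p) * ((1 + \<epsilon> / 2) * (2 * ln (real p) / ln 2)))) \<longlongrightarrow> 0) odd_primes"
          by (rule filterlim_mono[OF upper_limit order_refl odd_primes_le]) (use \<epsilon> in simp)
      qed (use bound in \<open>auto elim: eventually_mono\<close>)
    }
    {
      assume l: "(\<lambda>p. real (l p)) \<sim>[odd_primes] (\<lambda>p. (1 - \<epsilon>) * log 2 (real p ^ 2))"
      define c where "c = (1 - \<epsilon> / 2) / (1 - \<epsilon>)"
      have "1 < c" "c * (1 - \<epsilon>) = 1 - \<epsilon> / 2" using \<epsilon> by (auto simp: c_def field_simps)
      then have "eventually (\<lambda>p. real (l p) \<le> (1 - \<epsilon> / 2) * log 2 (real p ^ 2)) odd_primes"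
        using asymp_equiv_eventually_le[OF l \<open>1 < c\<close> log2_pos] \<epsilon> by (simp flip: mult.assoc)
      \<comment> \<open>The bound for early times requires l < p; here the time is only logarithmic
        in \<open>p\<close>.\<close>
      moreover have "eventually (\<lambda>p. (1 - \<epsilon> / 2) * (2 * ln (real p) / ln 2) < real p) odd_primes"
        by (rule eventually_odd_primes) (use \<epsilon> in real_asymp)
      ultimately have "eventually (\<lambda>p. exp (- ((1 - \<epsilon> / 2) * (2 * ln (real p)))) * (real p ^ 2 - 1) /
          (2 * ((1 - \<epsilon> / 2) * (2 * ln (real p) / ln 2) + 1) ^ 2) - 1 \<le> ?D p (l p)) odd_primes"
        using ev
      proof eventually_elim
        case (elim p)
        then interpret steinberg_walk p "mixed_walk (R p) (F p) p" by (intro walk) auto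
        have st: "stationary_distribution p (mixed_walk (R p) (F p) p) (\<mu> p)" using stationary elim by blast
        have "real (l p) \<le> (1 - \<epsilon> / 2) * (2 * ln (real p) / ln 2)" using elim log2_square[of "real p"] by simp
        from dist_ge_exp[OF this] elim show ?case unfolding dist_cong[OF st] by simp
      qed
      then show "filterlim (\<lambda>p. ?D p (l p)) at_top odd_primes"
        by (rule filterlim_at_top_mono[rotated])
          (rule filterlim_mono[OF lower_limit order_refl odd_primes_le], use \<epsilon> in simp_all)
    }
  qed
qed

end
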